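(* Let $\ell\in BV([0,T];\mathbb R^d)$ and let $z\in BV([0,T];\mathbb R^d)$ be a local solution associated with $\ell$. Assume that $\mathcal R$ is symmetric in the sense that $$\mathcal R(z_1)=\mathcal R(z_2)\iff\|z_1\|=\|z_2\|\qquad\text{for all }z_1,z_2\in\mathbb R^d,$$ and that $z$ (i.e. its representative satisfying the local stability condition and the energy inequality in the definition of a local solution) has only finitely many jumps. Then there exist $S\in(0,\infty)$, $\hat t\in W^{1,\infty}(0,S)$, $\hat z\in W^{1,\infty}(0,S;\mathbb R^d)$ and $\hat\ell\in BV([0,S];\mathbb R^d)$ such that $(S,\hat t,\hat z,\hat\ell)$ is a relaxed solution associated with $\ell$ and $z\in\mathfrak P(\hat t,\hat z)$.
   Context: Standing assumptions. $d\in\mathbb N$, $T>0$, $\langle\cdot,\cdot\rangle$ and $\|\cdot\|$ are the Euclidean scalar product and norm on $\mathbb R^d$. $A\in\mathbb R^{d\times d}$ is symmetric positive definite; $\mathcal F\in C^2(\mathbb R^d;\mathbb R)$, $\mathcal F\ge0$, and $\|D^2\mathcal F(z)v\|\le C(1+\|z\|^q)\|v\|$ for all $v,z\in\mathbb R^d$, for some $C>0$, $q\ge1$. Put $\mathcal E(z)=\frac12\langle Az,z\rangle+\mathcal F(z)$ and, for $\ell\in BV([0,T];\mathbb R^d)$, $\mathcal I(t,z)=\mathcal E(z)-\langle\ell(t),z\rangle$. $\mathcal R:\mathbb R^d\to[0,\infty)$ is proper, convex, lower semicontinuous, positively 1-homogeneous ($\mathcal R(\lambda z)=\lambda\mathcal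 R(z)$ for $\lambda>0$), and $c\|z\|\le\mathcal R(z)\le C\|z\|$ for all $z$ with constants $c,C>0$. The initial value $z_0\in\mathbb R^d$ is such that there is $\ell_0\in\mathbb R^d$ with $-D_z\mathcal E(z_0)+\ell_0\in\partial\mathcal R(0)$. $\partial\mathcal R(0)$ is the convex subdifferential at $0$ and $\operatorname{dist}(w,\partial\mathcal R(0))$ the Euclidean distance to it. $BV([0,T];\mathbb R^d)$ is the set of functions $f:[0,T]\to\mathbb R^d$ (defined everywhere) with finite pointwise total variation. $W^{1,\infty}$ functions are identified with their continuous representatives. Local solution. $z\in BV([0,T];\mathbb R^d)$ is a local solution associated with $\ell$ if $0\in\partial\mathcal R(0)+D_z\mathcal I(t,z(t))$ for almost all $t\in[0,T]$ (local stability) and, for all $0\le t_1\le t_2\le T$, $$\mathcal I(t_2,z(t_2))+\mathrm{Diss}_{\mathcal R}(z;[t_1,t_2])\le\mathcal I(t_1,z(t_1))-\int_{t_1}^{t_2}z(r)\,d\ell(r)\quad\text{(energy inequality)},$$ where $\mathrm{Diss}_{\mathcal R}(z;[t_1,t_2])=\sup\{\sum_{i=1}^n\mathcal R(z(\xi_i)-z(\xi_{i-1})): t_1=\xi_0<\xi_1<\dots<\xi_n=t_2,\ n\in\mathbb N\}$ and the integral is the Kurzweil (Kurzweil–Stieltjes) integral, i.e. the gauge limit of the sums $\sum_j\langle z(\tau_j),\ell(x_j)-\ell(x_{j-1})\rangle$ over tagged partitions with $\tau_j\in[x_{j-1},x_j]\subset(\tau_j-\delta(\tau_j),\tau_j+\delta(\tau_j))$,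 $\delta>0$ a gauge function. A local solution need not satisfy $z(0)=z_0$. Relaxed solution. For $\hat\ell\in BV([0,S];\mathbb R^d)$ put $\hat{\mathcal I}(s,z)=\mathcal E(z)-\langle\hat\ell(s),z\rangle$. A tuple $(S,\hat t,\hat z,\hat\ell)\in(0,\infty)\times W^{1,\infty}(0,S)\times W^{1,\infty}(0,S;\mathbb R^d)\times BV([0,S];\mathbb R^d)$ is a relaxed (normalized, $\mathfrak p$-parametrized BV) solution associated with $\ell$ if: (1) $\hat t(0)=0$, $\hat t(S)=T$, $\hat z(0)=z_0$; (2) for almost all $s\in(0,S)$: $\hat t'(s)\ge0$, $\hat t'(s)\operatorname{dist}(-D_z\hat{\mathcal I}(s,\hat z(s)),\partial\mathcal R(0))=0$, and $\hat t'(s)+\mathcal R(\hat z'(s))+\|\hat z'(s)\|\operatorname{dist}(-D_z\hat{\mathcal I}(s,\hat z(s)),\partial\mathcal R(0))=1$; (3) for all $s_1,s_2\in[0,S]$: $\mathcal E(\hat z(s_2))+\int_{s_1}^{s_2}\mathcal R(\hat z'(r))+\|\hat z'(r)\|\operatorname{dist}(-D_z\hat{\mathcal I}(r,\hat z(r)),\partial\mathcal R(0))\,dr=\mathcal E(\hat z(s_1))+\int_{s_1}^{s_2}\langle\hat\ell(r),\hat z'(r)\rangle\,dr$; (4) $\hat\ell(s)=\ell(\hat t(s))$ for almost all $s\in M$, where $M=\{s\in(0,S):\hat t(s_1)<\hat t(s_2)\text{ for all }s_1,s_2\in[0,S]\text{ with }s_1<s<s_2\}$. Projections. $\mathfrak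 P(\hat t,\hat z)=\{z:[0,T]\to\mathbb R^d:\ \forall t\in[0,T]\ \exists s\in[0,S]\text{ with }(t,z(t))=(\hat t(s),\hat z(s))\}$. *)

theory Defs
  imports "HOL-Analysis.Analysis"
begin

text \<open>For \<open>a = b\<close> the trivial partition \<open>n = 0\<close> is the only one, so that variation and
  dissipation vanish on one-point intervals.\<close>

definition partition :: "real \<Rightarrow> real \<Rightarrow> nat \<Rightarrow> (nat \<Rightarrow> real) \<Rightarrow> bool" where
  "partition a b n \<xi> \<longleftrightarrow> \<xi> 0 = a \<and> \<xi> n = b \<and> (\<forall>i<n. \<xi> i < \<xi> (Suc i))"

definition dissipation_sums ::
    "('a::real_normed_vector \<Rightarrow> real) \<Rightarrow> (real \<Rightarrow> 'a) \<Rightarrow> real \<Rightarrow> real \<Rightarrow> real set" where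
  "dissipation_sums R z a b = {\<Sum>i<n. R (z (\<xi> (Suc i)) - z (\<xi> i)) |n \<xi>. partition a b n \<xi>}"

definition BV_on :: "real \<Rightarrow> real \<Rightarrow> (real \<Rightarrow> 'a::real_normed_vector) \<Rightarrow> bool" where
  "BV_on a b f \<longleftrightarrow> bdd_above (dissipation_sums norm f a b)"

text \<open>The supremum is taken in the reals; it is only used for \<open>z\<close> of bounded variation and
  \<open>R\<close> bounded by a multiple of the norm, where the set of sums is bounded.\<close>

definition Diss ::
    "('a::real_normed_vector \<Rightarrow> real) \<Rightarrow> (real \<Rightarrow> 'a) \<Rightarrow> real \<Rightarrow> real \<Rightarrow> real" where
  "Diss R z a b = Sup (dissipation_sums R z a b)"

text \<open>The gauge limit of the sums \<open>\<Sum>\<^sub>j \<langle>f(\<tau>\<^sub>j), g(x\<^sub>j) - g(x\<^sub>j\<^sub>-\<^sub>1)\<rangle>\<close>. The library's tagged divisions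
  are sets of pairs \<open>(\<tau>, K)\<close> with \<open>\<tau> \<in> K = {x..y}\<close>; they admit degenerate intervals, whose
  contribution is zero.\<close>

definition has_ks_integral ::
    "(real \<Rightarrow> 'a::real_inner) \<Rightarrow> (real \<Rightarrow> 'a) \<Rightarrow> real \<Rightarrow> real \<Rightarrow> real \<Rightarrow> bool" where
  "has_ks_integral f g I a b \<longleftrightarrow>
     (\<forall>e>0. \<exists>\<delta>. (\<forall>x. 0 < \<delta> x) \<and>
       (\<forall>p. p tagged_division_of {a..b} \<and> (\<lambda>x. ball x (\<delta> x)) fine p \<longrightarrow>
         \<bar>(\<Sum>(\<tau>, K)\<in>p. f \<tau> \<bullet> (g (Sup K) - g (Inf K))) - I\<bar> < e))"

definition grad :: "('a::real_inner \<Rightarrow> real) \<Rightarrow> 'a \<Rightarrow> 'a" where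
  "grad f x = (THE D. GDERIV f x :> D)"

definition hessian :: "(real^'n \<Rightarrow> real) \<Rightarrow> real^'n \<Rightarrow> real^'n^'n" where
  "hessian f x = jacobian (grad f) (at x)"

definition C2 :: "(real^'n \<Rightarrow> real) \<Rightarrow> bool" where
  "C2 f \<longleftrightarrow> (\<forall>x. f differentiable (at x)) \<and> (\<forall>x. grad f differentiable (at x)) \<and>
     continuous_on UNIV (hessian f)"

definition subdifferential :: "('a::real_inner \<Rightarrow> real) \<Rightarrow> 'a \<Rightarrow> 'a set" where
  "subdifferential f x = {w. \<forall>v. f x + w \<bullet> (v - x) \<le> f v}"

definition lower_semicontinuous :: "('a::topological_space \<Rightarrow> real) \<Rightarrow> bool" where
  "lower_semicontinuous f \<longleftrightarrow> (\<forall>x. \<forall>c<f x. eventually (\<lambda>y. c < f y) (nhds x))"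

text \<open>Properness needs no separate clause, because the potential is finite everywhere.\<close>

definition dissipation_potential :: "('a::real_inner \<Rightarrow> real) \<Rightarrow> bool" where
  "dissipation_potential R \<longleftrightarrow>
     (\<forall>v. 0 \<le> R v) \<and> convex_on UNIV R \<and> lower_semicontinuous R \<and>
     (\<forall>r>0. \<forall>v. R (r *\<^sub>R v) = r * R v) \<and>
     (\<exists>c>0. \<exists>C>0. \<forall>v. c * norm v \<le> R v \<and> R v \<le> C * norm v)"

text \<open>\<open>C\<^sup>\<infinity>\<close> functions with compact support in the open interval \<open>(0,S)\<close>.\<close>

definition test_function :: "real \<Rightarrow> (real \<Rightarrow> real) \<Rightarrow> bool" where
  "test_function S \<phi> \<longleftrightarrow> (\<forall>n x. ((deriv ^^ n) \<phi>) differentiable (at x)) \<and>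
     closure {x. \<phi> x \<noteq> 0} \<subseteq> {0<..<S}"

text \<open>\<open>f\<close> is the continuous representative on \<open>[0,S]\<close> of an element of \<open>W\<^sup>1\<^sup>,\<^sup>\<infinity>(0,S)\<close>,
  and \<open>g \<in> L\<^sup>\<infinity>(0,S)\<close> is its weak derivative. Boundedness of \<open>f\<close> itself follows from
  continuity on \<open>[0,S]\<close>.\<close>

definition W1inf :: "real \<Rightarrow> (real \<Rightarrow> 'a::euclidean_space) \<Rightarrow> (real \<Rightarrow> 'a) \<Rightarrow> bool" where
  "W1inf S f g \<longleftrightarrow> continuous_on {0..S} f \<and>
     g \<in> borel_measurable (lebesgue_on {0<..<S}) \<and>
     (\<exists>B. AE s in lebesgue_on {0<..<S}. norm (g s) \<le> B) \<and>
     (\<forall>\<phi>. test_function S \<phi> \<longrightarrow>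
        integral\<^sup>L (lebesgue_on {0<..<S}) (\<lambda>s. deriv \<phi> s *\<^sub>R f s) =
        - integral\<^sup>L (lebesgue_on {0<..<S}) (\<lambda>s. \<phi> s *\<^sub>R g s))"

definition energy :: "real^'n^'n \<Rightarrow> (real^'n \<Rightarrow> real) \<Rightarrow> real^'n \<Rightarrow> real" where
  "energy A F z = 1/2 * ((A *v z) \<bullet> z) + F z"

definition loaded_energy ::
    "('a::real_inner \<Rightarrow> real) \<Rightarrow> (real \<Rightarrow> 'a) \<Rightarrow> real \<Rightarrow> 'a \<Rightarrow> real" where
  "loaded_energy E l t z = E z - l t \<bullet> z"

definition jump_points :: "real \<Rightarrow> (real \<Rightarrow> 'a::topological_space) \<Rightarrow> real set" where
  "jump_points T z = {t \<in> {0..T}. \<not> continuous (at t within {0..T}) z}"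

text \<open>The integral in the energy inequality is a number \<open>I\<close>, asserted to be the
  Kurzweil--Stieltjes integral; it exists whenever \<open>z\<close> and \<open>l\<close> are of bounded variation.\<close>

definition local_solution ::
    "real \<Rightarrow> ('a::euclidean_space \<Rightarrow> real) \<Rightarrow> ('a \<Rightarrow> real) \<Rightarrow> (real \<Rightarrow> 'a) \<Rightarrow> (real \<Rightarrow> 'a) \<Rightarrow> bool" where
  "local_solution T E R l z \<longleftrightarrow> BV_on 0 T z \<and>
     (AE t in lebesgue_on {0..T}.
        0 \<in> {w + grad (loaded_energy E l t) (z t) |w. w \<in> subdifferential R 0}) \<and>
     (\<forall>t1 t2. 0 \<le> t1 \<and> t1 \<le> t2 \<and> t2 \<le> T \<longrightarrow>
        (\<exists>I. has_ks_integral z l I t1 t2 \<and>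
           loaded_energy E l t2 (z t2) + Diss R z t1 t2 \<le> loaded_energy E l t1 (z t1) - I))"

text \<open>\<open>\<partial>R(0)\<close> contains \<open>0\<close> for every dissipation potential, so the value of \<^const>\<open>infdist\<close>
  for the empty set plays no role.\<close>

definition stability_dist ::
    "('a::euclidean_space \<Rightarrow> real) \<Rightarrow> ('a \<Rightarrow> real) \<Rightarrow> (real \<Rightarrow> 'a) \<Rightarrow> real \<Rightarrow> 'a \<Rightarrow> real" where
  "stability_dist E R l s x = infdist (- grad (loaded_energy E l s) x) (subdifferential R 0)"

definition increase_points :: "real \<Rightarrow> (real \<Rightarrow> real) \<Rightarrow> real set" where
  "increase_points S th = {s \<in> {0<..<S}.
     \<forall>s1\<in>{0..S}. \<forall>s2\<in>{0..S}. s1 < s \<and> s < s2 \<longrightarrow> th s1 < th s2}"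

text \<open>\<open>td\<close> and \<open>zd\<close> are the weak derivatives of \<open>th\<close> and \<open>zh\<close>, unique up to null sets.
  The interval integrals are oriented, so they also cover \<open>s2 < s1\<close>.\<close>

definition relaxed_solution ::
    "real \<Rightarrow> ('a::euclidean_space \<Rightarrow> real) \<Rightarrow> ('a \<Rightarrow> real) \<Rightarrow> 'a \<Rightarrow> (real \<Rightarrow> 'a) \<Rightarrow>
     real \<Rightarrow> (real \<Rightarrow> real) \<Rightarrow> (real \<Rightarrow> 'a) \<Rightarrow> (real \<Rightarrow> 'a) \<Rightarrow> bool" where
  "relaxed_solution T E R z0 l S th zh lh \<longleftrightarrow> 0 < S \<and> BV_on 0 S lh \<and>
     (\<exists>td zd. W1inf S th td \<and> W1inf S zh zd \<and>
        th 0 = 0 \<and> th S = T \<and> zh 0 = z0 \<and>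
        (AE s in lebesgue_on {0<..<S}.
           0 \<le> td s \<and>
           td s * stability_dist E R lh s (zh s) = 0 \<and>
           td s + R (zd s) + norm (zd s) * stability_dist E R lh s (zh s) = 1) \<and>
        (\<forall>s1\<in>{0..S}. \<forall>s2\<in>{0..S}.
           E (zh s2) + (LINT r=ereal s1..ereal s2|lebesgue.
              (R (zd r) + norm (zd r) * stability_dist E R lh r (zh r))) =
           E (zh s1) + (LINT r=ereal s1..ereal s2|lebesgue. (lh r \<bullet> zd r))) \<and>
        (AE s in lebesgue. s \<in> increase_points S th \<longrightarrow> lh s = l (th s)))"

definition projections ::
    "real \<Rightarrow> real \<Rightarrow> (real \<Rightarrow> real) \<Rightarrow> (real \<Rightarrow> 'a) \<Rightarrow> (real \<Rightarrow> 'a) set" where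
  "projections T S th zh = {z. \<forall>t\<in>{0..T}. \<exists>s\<in>{0..S}. (t, z t) = (th s, zh s)}"

end

theory Submission
  imports Defs "HOL-Probability.Distribution_Functions"
begin

text \<open>Symmetry and homogeneity force \<open>R = \<rho> * norm\<close> with \<open>\<rho> > 0\<close>, so the subdifferential of \<open>R\<close> at \<open>0\<close> is the
  closed ball of radius \<open>\<rho>\<close>. Let \<open>G\<close> be the gradient of the energy \<open>E\<close>. If the
  stability distance vanishes along a curve, the conditions on a relaxed solution reduce to
  \<open>td + \<rho> * norm zd = 1\<close>, \<open>norm (lh - G zh) \<le> \<rho>\<close> and \<open>(lh - G zh) \<bullet> zd = \<rho> * norm zd\<close>
  almost everywhere, the last one being the differentiated energy balance. Such curves can be
  concatenated, and they are called admissible arcs.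

  The load \<open>lh\<close> has to agree with \<open>l\<close> only at points of increase of \<open>th\<close>. While time stands still it is
  arbitrary, and on a straight segment with direction \<open>e\<close> the choice \<open>lh = G zh + \<rho> e\<close> satisfies all
  conditions (\<open>arc_joins_vertical\<close>). Therefore any two states can be joined at a fixed time: the given initial
  state with the initial value of \<open>z\<close>, and at every jump the left limit, the value
  and the right limit of \<open>z\<close>.

  On an interval where \<open>z\<close> is continuous its graph is parametrized by arclength with weight \<open>\<rho>\<close> on the state
  (\<open>arclength_parametrization\<close>), and \<open>lh\<close> is \<open>l \<circ> th\<close>. The energy inequality becomes, after
  integration by parts in the Kurzweil--Stieltjes integral (\<open>ks_integral_by_parts\<close>),
  \<open>\<rho> * norm zd \<le> (lh - G zh) \<bullet> zd\<close>. Local stability and the Cauchy--Schwarz inequality give the converse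
  (\<open>arc_joins_continuous\<close>). As there are finitely many jumps, concatenation of finitely
  many arcs gives the curve.

  Densities of Lipschitz functions are obtained from the Radon--Nikodym theorem
  (\<open>lipschitz_has_density\<close>), pointwise inequalities for them from inequalities for integrals over
  intervals (\<open>AE_le_of_integral_le\<close>), and the chain rule from a vanishing-derivative argument
  (\<open>primitive_on_chain_rule\<close>).\<close>

section \<open>Comparison of measures and densities on the line\<close>

text \<open>The difference of the two distribution functions is nondecreasing and right-continuous, so it
  generates a measure \<open>K\<close>. The measures \<open>M + K\<close> and \<open>N\<close> agree on half-open intervals, hence
  everywhere, and \<open>K\<close> is nonnegative.\<close>

lemma emeasure_le_of_Ioc_le:
  fixes M N :: "real measure"
  assumes M: "finite_borel_measure M" and N: "finite_borel_measure N"
    and le: "\<And>a b. a < b \<Longrightarrow> emeasure M {a<..b} \<le> emeasure N {a<..b}"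
    and A: "A \<in> sets borel"
  shows "emeasure M A \<le> emeasure N A"
proof -
  interpret M: finite_borel_measure M by fact
  interpret N: finite_borel_measure N by fact
  define D where "D x = cdf N x - cdf M x" for x
  have D_diff: "D b - D a = measure N {a<..b} - measure M {a<..b}" if "a < b" for a b
    using that by (simp add: D_def M.cdf_diff_eq[symmetric] N.cdf_diff_eq[symmetric])
  have le': "measure M {a<..b} \<le> measure N {a<..b}" if "a < b" for a b
    using le[OF that] by (simp add: M.emeasure_eq_measure N.emeasure_eq_measure)
  have D_mono: "D x \<le> D y" if "x \<le> y" for x y
    using D_diff[of x y] le'[of x y] that by (cases "x = y") auto
  have D_cont: "continuous (at_right a) D" for a
    unfolding D_def by (intro continuous_diff M.cdf_is_right_cont N.cdf_is_right_cont)
  define K where "K = interval_measure D"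
  have K_Ioc: "emeasure K {a<..b} = ennreal (D b - D a)" if "a \<le> b" for a b
    unfolding K_def by (rule emeasure_interval_measure_Ioc[OF that D_mono D_cont])
  define P where "P = measure_of UNIV (sets borel) (\<lambda>A. emeasure M A + emeasure K A)"
  have sets_P: "sets P = sets borel"
    by (simp add: P_def sets_measure_of_conv sets.sigma_sets_eq[of borel, simplified])
  have P_eq: "emeasure P X = emeasure M X + emeasure K X" if X: "X \<in> sets borel" for X
    unfolding P_def
  proof (rule emeasure_measure_of_sigma[OF _ _ _ X])
    show "sigma_algebra UNIV (sets (borel :: real measure))"
      using sets.sigma_algebra_axioms[of "borel :: real measure"] by simp
    show "positive (sets borel) (\<lambda>A. emeasure M A + emeasure K A)"
      by (simp add: positive_def)
    show "countably_additive (sets borel) (\<lambda>A. emeasure M A + emeasure K A)"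
    proof (rule countably_additiveI)
      fix B :: "nat \<Rightarrow> real set"
      assume B: "range B \<subseteq> sets borel" "disjoint_family B"
      have "(\<Sum>i. emeasure M (B i) + emeasure K (B i)) = (\<Sum>i. emeasure M (B i)) + (\<Sum>i. emeasure K (B i))"
        by (intro suminf_add[symmetric] summableI)
      also have "\<dots> = emeasure M (\<Union>i. B i) + emeasure K (\<Union>i. B i)"
        using B by (subst (1 2) suminf_emeasure) (auto simp: M.M_is_borel K_def)
      finally show "(\<Sum>i. emeasure M (B i) + emeasure K (B i)) =
        emeasure M (\<Union>i. B i) + emeasure K (\<Union>i. B i)" .
    qed
  qed
  have Ioc: "emeasure P {a<..b} = emeasure N {a<..b}" for a b
  proof (cases "a < b")
    case True
    have "emeasure P {a<..b} = ennreal (measure M {a<..b}) + ennreal (D b - D a)"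
      using True by (simp add: P_eq K_Ioc M.emeasure_eq_measure)
    also have "\<dots> = ennreal (measure N {a<..b})"
      using True le'[of a b] by (subst ennreal_plus[symmetric]) (auto simp: D_diff)
    finally show ?thesis by (simp add: N.emeasure_eq_measure)
  qed simp
  have "P = N"
  proof (rule measure_eqI_generator_eq[where \<Omega>=UNIV and E="range (\<lambda>(a, b). {a<..b})"
        and A="\<lambda>i. {- real i<..real i}"])
    show "(\<Union>i. {- real (i::nat)<..real i}) = UNIV"
      by (rule UN_Ioc_eq_UNIV)
  qed (auto simp: Ioc sets_P N.M_is_borel borel_sigma_sets_Ioc Int_stable_def
      N.emeasure_eq_measure)
  then show ?thesis
    using P_eq[OF A] by simp
qed

lemma integrable_bounded_borel:
  fixes g :: "real \<Rightarrow> 'a::euclidean_space"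
  assumes "g \<in> borel_measurable borel" "bounded (range g)"
  shows "g absolutely_integrable_on {x..y}" and "g integrable_on {x..y}"
proof -
  obtain B where B: "\<And>x. norm (g x) \<le> B"
    using assms(2) by (auto simp: bounded_iff)
  have "g \<in> borel_measurable (lebesgue_on {x..y})"
    using assms(1) by (intro measurable_restrict_space1 measurable_completion) simp
  then show *: "g absolutely_integrable_on {x..y}"
    by (rule measurable_bounded_by_integrable_imp_absolutely_integrable[where g="\<lambda>_. B"])
       (auto simp: B)
  show "g integrable_on {x..y}"
    using * by (rule set_lebesgue_integral_eq_integral)
qed

lemma emeasure_density_Ioc:
  fixes h :: "real \<Rightarrow> real"
  assumes "h \<in> borel_measurable borel" "\<And>x. 0 \<le> h x" "bounded (range h)" "a \<le> b"
  shows "emeasure (density lborel (\<lambda>x. ennreal (h x))) {a<..b} = ennreal (integral {a..b} h)"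
proof -
  have "emeasure (density lborel (\<lambda>x. ennreal (h x))) {a<..b} =
      (\<integral>\<^sup>+x. ennreal (h x) * indicator {a<..b} x \<partial>lborel)"
    using assms by (simp add: emeasure_density)
  also have "\<dots> = (\<integral>\<^sup>+x. ennreal (h x) * indicator {a..b} x \<partial>lborel)"
    by (rule nn_integral_cong_AE, rule AE_mp[OF AE_lborel_singleton[of a]])
       (auto simp: indicator_def)
  also have "\<dots> = (\<integral>\<^sup>+x. ennreal (indicator {a..b} x * h x) \<partial>lborel)"
    by (intro nn_integral_cong) (auto simp: indicator_def)
  also have "\<dots> = ennreal (integral {a..b} h)"
  proof (rule nn_integral_has_integral_lborel)
    have "((\<lambda>x. if x \<in> {a..b} then h x else 0) has_integral integral {a..b} h) UNIV"
      using integrable_bounded_borel(2)[OF assms(1,3), of a b]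
      by (simp only: has_integral_restrict_UNIV has_integral_integral)
    then show "((\<lambda>x. indicator {a..b} x * h x) has_integral integral {a..b} h) UNIV"
      by (rule has_integral_eq[rotated]) (auto simp: indicator_def)
  qed (use assms in auto)
  finally show ?thesis .
qed

text \<open>On the set \<open>A\<close> where the inequality fails, the integral of \<open>f - g\<close> is at most \<open>0\<close> although the
  integrand is positive there; subtracting the integrals is legitimate because \<open>g\<close> has finite
  mass.\<close>

lemma AE_le_of_density_le:
  fixes f g :: "'a \<Rightarrow> ennreal"
  assumes [measurable]: "f \<in> borel_measurable M" "g \<in> borel_measurable M"
    and fin: "emeasure (density M g) (space M) < \<infinity>"
    and le: "\<And>A. A \<in> sets M \<Longrightarrow> emeasure (density M f) A \<le> emeasure (density M g) A"
  shows "AE x in M. f x \<le> g x"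
proof -
  define A where "A = {x \<in> space M. g x < f x}"
  have [measurable]: "A \<in> sets M" unfolding A_def by measurable
  have le2: "(\<integral>\<^sup>+x. f x * indicator A x \<partial>M) \<le> (\<integral>\<^sup>+x. g x * indicator A x \<partial>M)"
    using le[of A] by (simp add: emeasure_density)
  have "emeasure (density M g) A \<le> emeasure (density M g) (space M)"
    using emeasure_space[of "density M g" A] by simp
  with fin have fin2: "(\<integral>\<^sup>+x. g x * indicator A x \<partial>M) \<noteq> \<infinity>"
    by (simp add: emeasure_density top_unique less_top)
  have "(\<integral>\<^sup>+x. f x * indicator A x - g x * indicator A x \<partial>M) =
      (\<integral>\<^sup>+x. f x * indicator A x \<partial>M) - (\<integral>\<^sup>+x. g x * indicator A x \<partial>M)"
    by (rule nn_integral_diff) (use fin2 in \<open>auto simp: A_def indicator_def less_imp_le\<close>)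
  also have "\<dots> = 0"
    using le2 fin2 by (simp add: diff_eq_0_iff_ennreal less_top)
  finally have "AE x in M. f x * indicator A x - g x * indicator A x = 0"
    by (subst (asm) nn_integral_0_iff_AE) auto
  with AE_space show ?thesis
  proof eventually_elim
    case (elim x)
    show ?case
    proof (rule ccontr)
      assume "\<not> f x \<le> g x"
      then have "g x < f x" by simp
      moreover from this elim(1) have "x \<in> A" by (simp add: A_def)
      ultimately show False using elim(2) by (auto simp: diff_eq_0_iff_ennreal)
    qed
  qed
qed

text \<open>This comparison does the work of the Lebesgue differentiation theorem: estimates for increments
  over intervals become estimates for densities almost everywhere. After adding a constant and
  restricting to a compact subinterval both functions are densities of finite measures, to which
  the domination principle applies.\<close>

lemma AE_le_of_integral_le:
  fixes f g :: "real \<Rightarrow> real"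
  assumes f: "f \<in> borel_measurable borel" "bounded (range f)"
    and g: "g \<in> borel_measurable borel" "bounded (range g)"
    and le: "\<And>x y. 0 < x \<Longrightarrow> x < y \<Longrightarrow> y < S \<Longrightarrow> integral {x..y} f \<le> integral {x..y} g"
  shows "AE s in lebesgue. 0 < s \<and> s < S \<longrightarrow> f s \<le> g s"
proof -
  have *: "AE s in lborel. a < s \<and> s < b \<longrightarrow> f s \<le> g s" if ab: "0 < a" "b < S" for a b
  proof -
    obtain B where B: "\<And>s. \<bar>f s\<bar> \<le> B" "\<And>s. \<bar>g s\<bar> \<le> B"
    proof -
      obtain B1 B2 where "\<And>s. \<bar>f s\<bar> \<le> B1" "\<And>s. \<bar>g s\<bar> \<le> B2"
        using f(2) g(2) by (auto simp: bounded_iff)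
      then have "\<And>s. \<bar>f s\<bar> \<le> max B1 B2" "\<And>s. \<bar>g s\<bar> \<le> max B1 B2"
        by (auto simp: le_max_iff_disj)
      then show ?thesis using that by blast
    qed
    define f' where "f' s = indicator {a..b} s * (f s + B)" for s
    define g' where "g' s = indicator {a..b} s * (g s + B)" for s
    have nn: "0 \<le> f' s" "0 \<le> g' s" for s
      using B[of s] by (auto simp: f'_def g'_def indicator_def)
    have bd: "bounded (range f')" "bounded (range g')"
      unfolding bounded_iff using B nn
      by (auto intro!: exI[of _ "2*B"] simp: f'_def g'_def indicator_def abs_le_iff)
         (smt (verit) B)+
    have [measurable]: "f' \<in> borel_measurable borel" "g' \<in> borel_measurable borel"
      unfolding f'_def g'_def using f(1) g(1) by measurable
    have le': "integral {x..y} f' \<le> integral {x..y} g'" if "x < y" for x y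
    proof -
      have *: "integral {x..y} (\<lambda>s. indicator {a..b} s * (h s + B)) =
          integral {max x a..min y b} h + integral {max x a..min y b} (\<lambda>_. B)"
        if "h \<in> borel_measurable borel" "bounded (range h)" for h :: "real \<Rightarrow> real"
      proof -
        have "integral {x..y} (\<lambda>s. indicator {a..b} s * (h s + B)) =
            integral {x..y} (\<lambda>s. if s \<in> {a..b} then h s + B else 0)"
          by (intro integral_cong) (auto simp: indicator_def)
        also have "\<dots> = integral ({x..y} \<inter> {a..b}) (\<lambda>s. h s + B)"
          using integral_restrict_Int[of "{x..y}" "{a..b}" "\<lambda>s. h s + B"] by (simp only: Int_commute)
        also have "\<dots> = integral {max x a..min y b} (\<lambda>s. h s + B)"
          by simp
        also have "\<dots> = integral {max x a..min y b} h + integral {max x a..min y b} (\<lambda>_. B)"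
          by (rule integral_add[OF integrable_bounded_borel(2)[OF that] integrable_const_ivl])
        finally show ?thesis .
      qed
      have "integral {max x a..min y b} f \<le> integral {max x a..min y b} g"
      proof (cases "max x a < min y b")
        case True
        then show ?thesis using ab by (intro le) auto
      next
        case False
        then have "{max x a..min y b} = {} \<or> {max x a..min y b} = {max x a}" by auto
        then show ?thesis by auto
      qed
      then show ?thesis
        unfolding f'_def g'_def using *[OF f] *[OF g] by simp
    qed
    let ?M = "\<lambda>h. density lborel (\<lambda>s. ennreal (h s))"
    have fin: "finite_borel_measure (?M h)"
      if h: "h = f' \<or> h = g'" for h
    proof -
      have [measurable]: "h \<in> borel_measurable borel" and hb: "bounded (range h)" "\<And>s. 0 \<le> h s"
        using h bd nn by auto
      have *: "emeasure (?M h) A = (\<integral>\<^sup>+x. ennreal (h x) * indicator A x \<partial>lborel)"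
        if "A \<in> sets borel" for A
        by (rule emeasure_density) (use that in auto)
      have "emeasure (?M h) UNIV = (\<integral>\<^sup>+x. ennreal (h x) * indicator UNIV x \<partial>lborel)"
        by (rule *) simp
      also have "\<dots> = (\<integral>\<^sup>+x. ennreal (h x) * indicator {a - 1<..b} x \<partial>lborel)"
        by (rule nn_integral_cong)
          (use h in \<open>auto simp: f'_def g'_def split: split_indicator\<close>)
      also have "\<dots> = emeasure (?M h) {a - 1<..b}"
        by (rule *[symmetric]) simp
      also have "\<dots> < \<infinity>"
        using emeasure_density_Ioc[of h "a-1" b] hb
        by (cases "a - 1 \<le> b") auto
      finally show ?thesis
        by (intro finite_borel_measure.intro finite_borel_measure_axioms.intro finite_measureI) simp_all
    qed
    interpret G: finite_borel_measure "?M g'" by (rule fin) simp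
    have "AE x in lborel. ennreal (f' x) \<le> ennreal (g' x)"
    proof (rule AE_le_of_density_le)
      show "emeasure (?M f') A \<le> emeasure (?M g') A" if "A \<in> sets lborel" for A
      proof (rule emeasure_le_of_Ioc_le[OF fin fin])
        show "emeasure (?M f') {a<..b} \<le> emeasure (?M g') {a<..b}" if "a < b" for a b
          using le'[OF that] that nn bd by (simp add: emeasure_density_Ioc ennreal_leI)
      qed (use that in auto)
      show "emeasure (?M g') (space lborel) < \<infinity>"
        unfolding infinity_ennreal_def top.not_eq_extremum[symmetric]
        using G.emeasure_finite by simp
    qed auto
    then show ?thesis
    proof eventually_elim
      case (elim x)
      show ?case
        using elim nn[of x] by (auto simp: ennreal_le_iff indicator_def f'_def g'_def split: if_splits)
    qed
  qed
  have "AE s in lborel. \<forall>n::nat. 1 / real (Suc n) < s \<and> s < S - 1 / real (Suc n) \<longrightarrow> f s \<le> g s"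
    unfolding AE_all_countable by (auto intro!: *)
  then have "AE s in lborel. 0 < s \<and> s < S \<longrightarrow> f s \<le> g s"
  proof eventually_elim
    case (elim s)
    show ?case
    proof
      assume s: "0 < s \<and> s < S"
      obtain n where "inverse (real (Suc n)) < min s (S - s)"
        using reals_Archimedean[of "min s (S - s)"] s by auto
      then show "f s \<le> g s"
        using elim[rule_format, of n] by (auto simp: field_simps)
    qed
  qed
  then show ?thesis by (rule AE_completion)
qed

section \<open>Lipschitz functions as primitives\<close>

text \<open>The density is required to be Borel measurable and bounded at every point, so that sums,
  products and concatenations of densities stay integrable over every interval.\<close>

definition primitive_on :: "real \<Rightarrow> (real \<Rightarrow> 'a::euclidean_space) \<Rightarrow> (real \<Rightarrow> 'a) \<Rightarrow> bool" where
  "primitive_on S f g \<longleftrightarrow> g \<in> borel_measurable borel \<and> bounded (range g) \<and>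
     (\<forall>x y. 0 \<le> x \<and> x \<le> y \<and> y \<le> S \<longrightarrow> (g has_integral (f y - f x)) {x..y})"

text \<open>The interval measure of \<open>f\<close> is dominated by \<open>L\<close> times Lebesgue measure, so the
  Radon--Nikodym theorem provides the density; cutting it off at \<open>L\<close> makes it bounded
  everywhere without changing the measure.\<close>

lemma mono_lipschitz_has_density:
  fixes f :: "real \<Rightarrow> real"
  assumes S: "0 \<le> S" and L: "0 \<le> L"
    and mono: "\<And>x y. 0 \<le> x \<Longrightarrow> x \<le> y \<Longrightarrow> y \<le> S \<Longrightarrow> f x \<le> f y"
    and lip: "\<And>x y. 0 \<le> x \<Longrightarrow> x \<le> y \<Longrightarrow> y \<le> S \<Longrightarrow> f y - f x \<le> L * (y - x)"
  shows "\<exists>g. primitive_on S f g"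
proof -
  define c where "c s = max 0 (min S s)" for s
  define H where "H s = f (c s) - f 0" for s
  have c: "0 \<le> c x" "c x \<le> S" "x \<le> y \<Longrightarrow> c x \<le> c y" for x y
    using S by (auto simp: c_def)
  have H_mono: "H x \<le> H y" if "x \<le> y" for x y
    using mono[of "c x" "c y"] c that by (simp add: H_def)
  have H_lip: "H y - H x \<le> L * (c y - c x)" if "x \<le> y" for x y
    using lip[of "c x" "c y"] c that by (simp add: H_def)
  have "L-lipschitz_on UNIV H"
  proof (rule lipschitz_onI[OF _ L])
    have *: "\<bar>H x - H y\<bar> \<le> L * \<bar>x - y\<bar>" if "x \<le> y" for x y
    proof -
      have "H y - H x \<le> L * (y - x)"
        using H_lip[OF that] that L S
        by (elim order_trans) (auto intro!: mult_left_mono simp: c_def)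
      then show ?thesis using H_mono[OF that] that by simp
    qed
    show "dist (H x) (H y) \<le> L * dist x y" for x y
      using *[of x y] *[of y x] by (cases "x \<le> y") (auto simp: dist_real_def abs_minus_commute)
  qed
  then have H_cont: "continuous_on UNIV H" by (rule lipschitz_on_continuous_on)
  then have H_right: "continuous (at_right a) H" for a
    by (simp add: continuous_on_eq_continuous_at continuous_at_imp_continuous_at_within)
  define M where "M = interval_measure H"
  have M: "finite_borel_measure M"
    unfolding M_def
  proof (rule finite_borel_measure_interval_measure[OF H_mono H_right])
    show "(H \<longlongrightarrow> 0) at_bot"
      by (rule tendsto_eventually)
         (use S in \<open>auto simp: eventually_at_bot_linorder H_def c_def intro!: exI[of _ 0]\<close>)
    show "(H \<longlongrightarrow> f S - f 0) at_top"
      by (rule tendsto_eventually)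
         (use S in \<open>auto simp: eventually_at_top_linorder H_def c_def intro!: exI[of _ S]\<close>)
    show "0 \<le> f S - f 0" using mono[of 0 S] S by simp
  qed
  define h where "h s = L * indicator {0..S} s" for s :: real
  have h: "h \<in> borel_measurable borel" "\<And>s. 0 \<le> h s" "bounded (range h)"
    subgoal unfolding h_def[abs_def] by measurable
    using L by (auto simp: h_def bounded_iff indicator_def intro!: exI[of _ L])
  note [measurable] = h(1)
  let ?N = "density lborel (\<lambda>s. ennreal (h s))"
  have N: "finite_borel_measure ?N"
  proof -
    have *: "emeasure ?N A = (\<integral>\<^sup>+x. ennreal (h x) * indicator A x \<partial>lborel)"
      if "A \<in> sets borel" for A
      by (rule emeasure_density) (use that in auto)
    have "emeasure ?N UNIV = (\<integral>\<^sup>+x. ennreal (h x) * indicator UNIV x \<partial>lborel)"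
      by (rule *) simp
    also have "\<dots> = (\<integral>\<^sup>+x. ennreal (h x) * indicator {-1<..S} x \<partial>lborel)"
      by (rule nn_integral_cong) (simp add: h_def split: split_indicator)
    also have "\<dots> = emeasure ?N {-1<..S}"
      by (rule *[symmetric]) simp
    also have "\<dots> < \<infinity>"
      using emeasure_density_Ioc[OF h, of "-1" S] S by simp
    finally show ?thesis
      by (intro finite_borel_measure.intro finite_borel_measure_axioms.intro finite_measureI) simp_all
  qed
  have int_h: "integral {a..b} h = L * (c b - c a)" if "a \<le> b" for a b
  proof -
    have "integral {a..b} h = integral {a..b} (\<lambda>s. if s \<in> {0..S} then L else 0)"
      by (intro integral_cong) (auto simp: h_def indicator_def)
    also have "\<dots> = integral ({0..S} \<inter> {a..b}) (\<lambda>s. L)"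
      using integral_restrict_Int[of "{a..b}" "{0..S}" "\<lambda>s. L"] by (simp only: Int_commute)
    also have "\<dots> = L * (c b - c a)"
      using that S by (auto simp: c_def max_def min_def)
    finally show ?thesis .
  qed
  have MN: "emeasure M A \<le> emeasure ?N A" if "A \<in> sets borel" for A
  proof (rule emeasure_le_of_Ioc_le[OF M N _ that])
    show "emeasure M {a<..b} \<le> emeasure ?N {a<..b}" if "a < b" for a b
      using that H_lip[of a b]
      by (simp add: emeasure_density_Ioc[OF h] int_h M_def
          emeasure_interval_measure_Ioc[OF _ H_mono H_right] ennreal_leI)
  qed
  have "absolutely_continuous lborel M"
    unfolding absolutely_continuous_def
  proof
    fix A :: "real set" assume A: "A \<in> null_sets lborel"
    have "emeasure ?N A = 0"
      using absolutely_continuousI_density[of "\<lambda>s. ennreal (h s)" lborel] A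
      by (auto simp: absolutely_continuous_def)
    with MN[of A] A show "A \<in> null_sets M"
      by (auto simp: null_sets_def M_def)
  qed
  then obtain k where k[measurable]: "k \<in> borel_measurable borel" and kM: "density lborel k = M"
    using sigma_finite_measure.Radon_Nikodym[OF sigma_finite_lborel, of M] by (auto simp: M_def)
  have kh: "AE s in lborel. k s \<le> ennreal (h s)"
  proof (rule AE_le_of_density_le)
    interpret N: finite_borel_measure ?N by (rule N)
    show "emeasure ?N (space lborel) < \<infinity>"
      unfolding infinity_ennreal_def top.not_eq_extremum[symmetric]
      using N.emeasure_finite by simp
  qed (use MN kM in auto)
  define g where "g s = enn2real (min (k s) (ennreal (h s)))" for s
  have g_meas: "g \<in> borel_measurable borel" unfolding g_def by measurable
  have g_nn: "0 \<le> g s" for s by (simp add: g_def)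
  have eg: "ennreal (g s) = min (k s) (ennreal (h s))" for s
    unfolding g_def by (rule ennreal_enn2real) (simp add: min_less_iff_disj)
  have "g s \<le> L" for s
  proof -
    have "ennreal (g s) \<le> ennreal (h s)" by (simp add: eg)
    then have "g s \<le> h s" using h(2) by (simp add: ennreal_le_iff)
    also have "h s \<le> L" using L by (simp add: h_def indicator_def)
    finally show ?thesis .
  qed
  then have g_bd: "bounded (range g)"
    using g_nn by (auto simp: bounded_iff intro!: exI[of _ L])
  have gM: "density lborel (\<lambda>s. ennreal (g s)) = M"
    unfolding kM[symmetric]
    by (rule density_cong) (use kh g_meas in \<open>auto simp: eg min_def elim!: eventually_mono\<close>)
  have "(g has_integral (f y - f x)) {x..y}" if xy: "0 \<le> x" "x \<le> y" "y \<le> S" for x y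
  proof -
    have "ennreal (integral {x..y} g) = emeasure M {x<..y}"
      using emeasure_density_Ioc[OF g_meas g_nn g_bd xy(2)] by (simp add: gM)
    also have "\<dots> = ennreal (f y - f x)"
      using xy emeasure_interval_measure_Ioc[OF xy(2) H_mono H_right]
      by (simp add: M_def H_def c_def)
    finally have "integral {x..y} g = f y - f x"
      using mono[of x y] xy integral_nonneg[OF integrable_bounded_borel(2)[OF g_meas g_bd]] g_nn
      by (subst (asm) ennreal_inj) auto
    with integrable_bounded_borel(2)[OF g_meas g_bd, of x y] show ?thesis
      by (simp add: has_integral_integrable_integral)
  qed
  with g_meas g_bd show ?thesis by (auto simp: primitive_on_def)
qed

text \<open>Adding \<open>L * s\<close> turns every coordinate of \<open>f\<close> into a nondecreasing function.\<close>

lemma lipschitz_has_density: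
  fixes f :: "real \<Rightarrow> 'a::euclidean_space"
  assumes S: "0 \<le> S" and L: "0 \<le> L"
    and lip: "\<And>x y. 0 \<le> x \<Longrightarrow> x \<le> y \<Longrightarrow> y \<le> S \<Longrightarrow> norm (f y - f x) \<le> L * (y - x)"
  shows "\<exists>g. primitive_on S f g"
proof -
  have "\<exists>g. primitive_on S (\<lambda>s. f s \<bullet> i + L * s) g" if i: "i \<in> Basis" for i
  proof (rule mono_lipschitz_has_density[OF S])
    fix x y assume xy: "0 \<le> x" "x \<le> y" "y \<le> S"
    have "\<bar>(f y - f x) \<bullet> i\<bar> \<le> L * (y - x)"
      using Basis_le_norm[OF i, of "f y - f x"] lip[OF xy] by linarith
    then show "f x \<bullet> i + L * x \<le> f y \<bullet> i + L * y"
      and "f y \<bullet> i + L * y - (f x \<bullet> i + L * x) \<le> (2 * L) * (y - x)"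
      by (auto simp: inner_diff_left algebra_simps abs_le_iff)
  qed (use L in simp)
  then obtain g where g: "\<And>i. i \<in> Basis \<Longrightarrow> primitive_on S (\<lambda>s. f s \<bullet> i + L * s) (g i)"
    by metis
  define G where "G s = (\<Sum>i\<in>Basis. (g i s - L) *\<^sub>R i)" for s
  have "primitive_on S f G"
    unfolding primitive_on_def
  proof (intro conjI allI impI)
    show "G \<in> borel_measurable borel"
      unfolding G_def[abs_def]
    proof (rule borel_measurable_sum)
      fix i :: 'a assume "i \<in> Basis"
      with g have [measurable]: "g i \<in> borel_measurable borel" by (simp add: primitive_on_def)
      show "(\<lambda>s. (g i s - L) *\<^sub>R i) \<in> borel_measurable borel" by measurable
    qed
    have "\<exists>B. \<forall>s. \<bar>g i s\<bar> \<le> B" if "i \<in> Basis" for i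
      using g[OF that] by (auto simp: primitive_on_def bounded_iff)
    then obtain B where B: "\<And>i s. i \<in> Basis \<Longrightarrow> \<bar>g i s\<bar> \<le> B i" by metis
    have "norm (G s) \<le> (\<Sum>i\<in>Basis. B i + L)" for s
      unfolding G_def
    proof (rule sum_norm_le)
      show "norm ((g i s - L) *\<^sub>R i) \<le> B i + L" if "i \<in> Basis" for i
        using B[OF that, of s] that L by simp
    qed
    then show "bounded (range G)" by (auto simp: bounded_iff)
    fix x y assume xy: "0 \<le> x \<and> x \<le> y \<and> y \<le> S"
    have "((\<lambda>s. (g i s - L) *\<^sub>R i) has_integral (((f y - f x) \<bullet> i) *\<^sub>R i)) {x..y}" if i: "i \<in> Basis" for i
    proof -
      have "(g i has_integral (f y \<bullet> i + L * y - (f x \<bullet> i + L * x))) {x..y}"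
        using g[OF i] xy by (simp add: primitive_on_def)
      from has_integral_diff[OF this has_integral_const_real[of L x y]]
      have "((\<lambda>s. g i s - L) has_integral ((f y - f x) \<bullet> i)) {x..y}"
        using xy by (simp add: inner_diff_left algebra_simps)
      then show ?thesis by (rule has_integral_scaleR_left)
    qed
    then have "((\<lambda>s. \<Sum>i\<in>Basis. (g i s - L) *\<^sub>R i) has_integral (\<Sum>i\<in>Basis. ((f y - f x) \<bullet> i) *\<^sub>R i)) {x..y}"
      by (intro has_integral_sum) auto
    then show "(G has_integral (f y - f x)) {x..y}"
      unfolding G_def[abs_def] euclidean_representation .
  qed
  then show ?thesis by blast
qed

lemma primitive_on_lipschitz:
  assumes "primitive_on S f g"
  shows "\<exists>B>0. \<forall>x y. 0 \<le> x \<and> x \<le> y \<and> y \<le> S \<longrightarrow> norm (f y - f x) \<le> B * (y - x)"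
proof -
  obtain B where B: "B > 0" "\<And>s. norm (g s) \<le> B"
    using assms by (auto simp: primitive_on_def bounded_pos)
  have "norm (f y - f x) \<le> B * (y - x)" if "0 \<le> x" "x \<le> y" "y \<le> S" for x y
    using has_integral_bound_real[of B "{}" g "f y - f x" x y] assms B that
    by (auto simp: primitive_on_def less_imp_le)
  then show ?thesis using B(1) by blast
qed

lemma primitive_on_continuous:
  assumes "primitive_on S f g"
  shows "continuous_on {0..S} f"
proof -
  obtain B where B: "B > 0" "\<And>x y. 0 \<le> x \<Longrightarrow> x \<le> y \<Longrightarrow> y \<le> S \<Longrightarrow> norm (f y - f x) \<le> B * (y - x)"
    using primitive_on_lipschitz[OF assms] by blast
  have "B-lipschitz_on {0..S} f"
  proof (rule lipschitz_onI)
    show "dist (f x) (f y) \<le> B * dist x y" if "x \<in> {0..S}" "y \<in> {0..S}" for x y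
      using B(2)[of x y] B(2)[of y x] that
      by (cases "x \<le> y") (auto simp: dist_norm norm_minus_commute abs_minus_commute)
  qed (use B in simp)
  then show ?thesis by (rule lipschitz_on_continuous_on)
qed

lemma continuous_times_bounded_integrable:
  fixes u :: "real \<Rightarrow> 'a::euclidean_space" and g :: "real \<Rightarrow> 'b::euclidean_space"
    and h :: "'a \<Rightarrow> 'b \<Rightarrow> 'c::euclidean_space"
  assumes u: "continuous_on {x..y} u" and g: "g \<in> borel_measurable borel" "bounded (range g)"
    and h: "bounded_bilinear h"
  shows "(\<lambda>r. h (u r) (g r)) absolutely_integrable_on {x..y}"
proof -
  interpret h: bounded_bilinear h by (rule h)
  obtain B where B: "B > 0" "\<And>s. norm (g s) \<le> B"
    using g by (auto simp: bounded_pos)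
  have "bounded (u ` {x..y})"
    using u by (simp add: compact_continuous_image compact_imp_bounded)
  then obtain C where C: "C > 0" "\<And>r. r \<in> {x..y} \<Longrightarrow> norm (u r) \<le> C"
    by (auto simp: bounded_pos)
  obtain K where K: "K > 0" "\<And>a b. norm (h a b) \<le> norm a * norm b * K"
    using h.pos_bounded by blast
  have m: "(\<lambda>r. h (u r) (g r)) \<in> borel_measurable (lebesgue_on {x..y})"
  proof -
    have "u \<in> borel_measurable (lebesgue_on {x..y})"
      using u by (simp add: continuous_imp_measurable_on_sets_lebesgue)
    moreover have "g \<in> borel_measurable (lebesgue_on {x..y})"
      by (intro measurable_restrict_space1 measurable_completion) (use g in simp)
    ultimately have "(\<lambda>r. (u r, g r)) \<in> borel_measurable (lebesgue_on {x..y})"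
      by (intro borel_measurable_Pair)
    moreover have "(\<lambda>p. h (fst p) (snd p)) \<in> borel_measurable borel"
      by (intro borel_measurable_continuous_onI h.continuous_on continuous_intros)
    ultimately show ?thesis by (auto dest: measurable_compose)
  qed
  show ?thesis
  proof (rule measurable_bounded_by_integrable_imp_absolutely_integrable[OF m])
    show "norm (h (u r) (g r)) \<le> C * B * K" if "r \<in> {x..y}" for r
      by (rule order_trans[OF K(2)])
         (use C(1) C(2)[OF that] B(1) B(2)[of r] K(1) in \<open>auto intro!: mult_mono\<close>)
  qed auto
qed

text \<open>The difference \<open>D\<close> of the two sides, as a
  function of the upper end point, has increments of order \<open>o(y - x)\<close> at every point: the
  differentiability of \<open>\<Psi>\<close> controls one part, the continuity of \<open>G\<close> along \<open>w\<close> the other.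
  So \<open>D\<close> has derivative zero and is constant.\<close>

lemma primitive_on_chain_rule:
  fixes \<Psi> :: "'a::euclidean_space \<Rightarrow> real"
  assumes w: "primitive_on S w wd"
    and der: "\<And>x. (\<Psi> has_derivative (\<lambda>h. G x \<bullet> h)) (at x)"
    and G: "continuous_on UNIV G"
    and xy: "0 \<le> x" "x \<le> y" "y \<le> S"
  shows "((\<lambda>r. G (w r) \<bullet> wd r) has_integral (\<Psi> (w y) - \<Psi> (w x))) {x..y}"
proof -
  define q where "q r = G (w r) \<bullet> wd r" for r
  define D where "D s = \<Psi> (w s) - integral {0..s} q" for s
  obtain B where B: "B > 0" and wd_bd: "\<And>s. norm (wd s) \<le> B"
    using w by (auto simp: primitive_on_def bounded_pos)
  have lip: "norm (w b - w a) \<le> B * (b - a)" if "0 \<le> a" "a \<le> b" "b \<le> S" for a b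
    using has_integral_bound_real[of B "{}" wd "w b - w a" a b] w wd_bd B that
    by (auto simp: primitive_on_def less_imp_le)
  have Gw: "continuous_on {0..S} (\<lambda>r. G (w r))"
    using continuous_on_compose2[OF G primitive_on_continuous[OF w]] by auto
  have q_int: "q integrable_on {a..b}" if "0 \<le> a" "b \<le> S" for a b
  proof -
    have "continuous_on {a..b} (\<lambda>r. G (w r))"
      using that by (intro continuous_on_subset[OF Gw]) auto
    then show ?thesis
      unfolding q_def[abs_def] using w
      by (intro set_lebesgue_integral_eq_integral(1) continuous_times_bounded_integrable
          bounded_bilinear_inner) (auto simp: primitive_on_def)
  qed
  have D_diff: "D b - D a = \<Psi> (w b) - \<Psi> (w a) - integral {a..b} q"
    if "0 \<le> a" "a \<le> b" "b \<le> S" for a b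
    using Henstock_Kurzweil_Integration.integral_combine[OF that(1,2) q_int[of 0 b]] that by (simp add: D_def)
  have "(D has_derivative (\<lambda>h. 0)) (at s within {0..S})" if s: "s \<in> {0..S}" for s
    unfolding has_derivative_within_alt
  proof (intro conjI allI impI bounded_linear_zero)
    fix e :: real assume e: "e > 0"
    define e1 where "e1 = e / (2 * B)"
    have e1: "e1 > 0" using e B by (simp add: e1_def)
    obtain d1 where d1: "d1 > 0"
      "\<And>v. norm (v - w s) < d1 \<Longrightarrow> norm (\<Psi> v - \<Psi> (w s) - G (w s) \<bullet> (v - w s)) \<le> e1 * norm (v - w s)"
      using der[of "w s"] e1 unfolding has_derivative_at_alt by blast
    obtain d2 where d2: "d2 > 0"
      "\<And>r. r \<in> {0..S} \<Longrightarrow> dist r s < d2 \<Longrightarrow> dist (G (w r)) (G (w s)) < e1"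
      using Gw s e1 unfolding continuous_on_iff by metis
    define d where "d = min (d1 / B) d2"
    have d: "d > 0" using d1 d2 B by (simp add: d_def)
    have main: "norm (D b - D a) \<le> e * (b - a)"
      if ab: "0 \<le> a" "a \<le> b" "b \<le> S" "b - a < d" "s = a \<or> s = b" for a b
    proof -
      have nw: "norm (w b - w a) \<le> B * (b - a)" by (rule lip[OF ab(1-3)])
      also have "\<dots> < d1"
        using ab(4) B by (auto simp: d_def field_simps)
      finally have near: "norm (w b - w a) < d1" .
      have "norm (\<Psi> (w b) - \<Psi> (w a) - G (w s) \<bullet> (w b - w a)) \<le> e1 * norm (w b - w a)"
        using ab(5)
      proof
        assume "s = a"
        then show ?thesis using d1(2)[of "w b"] near by simp
      next
        assume "s = b"
        have "norm (\<Psi> (w a) - \<Psi> (w b) - G (w s) \<bullet> (w a - w b)) \<le> e1 * norm (w a - w b)"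
          using d1(2)[of "w a"] near \<open>s = b\<close> by (simp add: norm_minus_commute)
        moreover have "\<Psi> (w b) - \<Psi> (w a) - G (w s) \<bullet> (w b - w a) =
            - (\<Psi> (w a) - \<Psi> (w b) - G (w s) \<bullet> (w a - w b))"
          by (simp add: inner_diff_right)
        ultimately show ?thesis by (simp add: norm_minus_commute)
      qed
      also have "\<dots> \<le> e1 * (B * (b - a))"
        using nw e1 by (intro mult_left_mono) auto
      finally have 1: "norm (\<Psi> (w b) - \<Psi> (w a) - G (w s) \<bullet> (w b - w a)) \<le> e1 * (B * (b - a))" .
      have "((\<lambda>r. q r - G (w s) \<bullet> wd r) has_integral (integral {a..b} q - G (w s) \<bullet> (w b - w a))) {a..b}"
      proof (rule has_integral_diff)
        show "(q has_integral integral {a..b} q) {a..b}"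
          using q_int[of a b] ab by (simp add: has_integral_integral)
        have "(wd has_integral (w b - w a)) {a..b}"
          using w ab by (simp add: primitive_on_def)
        from has_integral_linear[OF this bounded_linear_inner_right]
        show "((\<lambda>r. G (w s) \<bullet> wd r) has_integral (G (w s) \<bullet> (w b - w a))) {a..b}"
          by (simp add: o_def)
      qed
      moreover have "norm (q r - G (w s) \<bullet> wd r) \<le> e1 * B" if r: "r \<in> {a..b}" for r
      proof -
        have "norm (q r - G (w s) \<bullet> wd r) = \<bar>(G (w r) - G (w s)) \<bullet> wd r\<bar>"
          by (simp add: q_def inner_diff_left)
        also have "\<dots> \<le> norm (G (w r) - G (w s)) * norm (wd r)"
          by (rule Cauchy_Schwarz_ineq2)
        also have "\<dots> \<le> e1 * B"
          using d2(2)[of r] r ab wd_bd[of r] e1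
          by (intro mult_mono) (auto simp: dist_norm d_def)
        finally show ?thesis .
      qed
      ultimately have "norm (integral {a..b} q - G (w s) \<bullet> (w b - w a)) \<le> e1 * B * measure lborel {a..b}"
        using e1 B by (intro has_integral_bound_real[of "e1 * B" "{}"]) auto
      then have 2: "norm (integral {a..b} q - G (w s) \<bullet> (w b - w a)) \<le> e1 * B * (b - a)"
        using ab by simp
      have "norm (D b - D a) \<le> e1 * (B * (b - a)) + e1 * B * (b - a)"
        using 1 2 unfolding D_diff[OF ab(1-3)] real_norm_def by linarith
      also have "\<dots> = e * (b - a)"
        using B by (simp add: e1_def field_simps)
      finally show ?thesis .
    qed
    have "norm (D v - D s - 0) \<le> e * norm (v - s)" if v: "v \<in> {0..S}" "norm (v - s) < d" for v
      using main[of s v] main[of v s] v s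
      by (cases "s \<le> v") (auto simp: norm_minus_commute abs_minus_commute)
    then show "\<exists>d>0. \<forall>v\<in>{0..S}. norm (v - s) < d \<longrightarrow> norm (D v - D s - 0) \<le> e * norm (v - s)"
      using d by blast
  qed
  then obtain c where "\<And>s. s \<in> {0..S} \<Longrightarrow> D s = c"
    using has_derivative_zero_constant[of "{0..S}" D] by auto
  then have "D y - D x = 0" using xy by simp
  then have "integral {x..y} q = \<Psi> (w y) - \<Psi> (w x)"
    using D_diff[OF xy] by simp
  with q_int[of x y] xy show ?thesis
    by (simp add: has_integral_integrable_integral q_def[abs_def])
qed

text \<open>Coordinatewise, the integration by parts in the definition of the weak derivative is the
  chain rule for \<open>(s, v) \<mapsto> \<phi> s * (v \<bullet> i)\<close> along the curve \<open>s \<mapsto> (s, f s)\<close>; the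
  boundary terms vanish with \<open>\<phi>\<close>.\<close>

lemma primitive_on_W1inf:
  fixes f :: "real \<Rightarrow> 'a::euclidean_space"
  assumes S: "0 < S" and f: "primitive_on S f g"
  shows "W1inf S f g"
  unfolding W1inf_def
proof (intro conjI allI impI)
  show "continuous_on {0..S} f" by (rule primitive_on_continuous[OF f])
  have g: "g \<in> borel_measurable borel" "bounded (range g)"
    using f by (auto simp: primitive_on_def)
  show "g \<in> borel_measurable (lebesgue_on {0<..<S})"
    by (intro measurable_restrict_space1 measurable_completion) (use g in simp)
  show "\<exists>B. AE s in lebesgue_on {0<..<S}. norm (g s) \<le> B"
    using g(2) by (auto simp: bounded_iff)
  fix \<phi> assume \<phi>: "test_function S \<phi>"
  have diff: "((deriv ^^ n) \<phi>) differentiable (at x)" for n x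
    using \<phi> by (auto simp: test_function_def)
  have d\<phi>: "(\<phi> has_real_derivative deriv \<phi> x) (at x)" for x
    using diff[of 0 x] by (simp add: DERIV_deriv_iff_real_differentiable)
  have cont: "continuous_on A \<phi>" "continuous_on A (deriv \<phi>)" for A
    using differentiable_imp_continuous_within[OF diff[of 0]]
      differentiable_imp_continuous_within[OF diff[of 1]]
    by (auto intro!: continuous_at_imp_continuous_on)
  have supp: "\<phi> 0 = 0" "\<phi> S = 0"
    using \<phi> closure_subset[of "{x. \<phi> x \<noteq> 0}"] by (auto simp: test_function_def)
  have fc: "continuous_on {0..S} f" by (rule primitive_on_continuous[OF f])
  have i1: "(\<lambda>s. deriv \<phi> s *\<^sub>R f s) absolutely_integrable_on {0..S}"
    by (intro absolutely_integrable_continuous_real continuous_intros cont fc)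
  have i2: "(\<lambda>s. \<phi> s *\<^sub>R g s) absolutely_integrable_on {0..S}"
    by (intro continuous_times_bounded_integrable bounded_bilinear_scaleR cont g)
  have conv: "integral\<^sup>L (lebesgue_on {0<..<S}) h = integral {0..S} h"
    if h: "h absolutely_integrable_on {0..S}" for h :: "real \<Rightarrow> 'a"
  proof -
    have "h absolutely_integrable_on {0<..<S}"
      by (rule set_integrable_subset[OF h]) auto
    then have "integrable (lebesgue_on {0<..<S}) h"
      by (simp add: integrable_restrict_space set_integrable_def)
    then have "integral\<^sup>L (lebesgue_on {0<..<S}) h = integral {0<..<S} h"
      by (rule lebesgue_integral_eq_integral) simp
    then show ?thesis by (simp add: integral_open_interval_real)
  qed
  have "integral {0..S} (\<lambda>s. deriv \<phi> s *\<^sub>R f s) = - integral {0..S} (\<lambda>s. \<phi> s *\<^sub>R g s)"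
  proof (rule euclidean_eqI)
    fix i :: 'a assume i: "i \<in> Basis"
    define \<Psi> where "\<Psi> p = \<phi> (fst p) * (snd p \<bullet> i)" for p :: "real \<times> 'a"
    define G where "G p = (deriv \<phi> (fst p) * (snd p \<bullet> i), \<phi> (fst p) *\<^sub>R i)" for p :: "real \<times> 'a"
    have w: "primitive_on S (\<lambda>s. (s, f s)) (\<lambda>s. (1, g s))"
      unfolding primitive_on_def
    proof (intro conjI allI impI)
      show "(\<lambda>s. (1::real, g s)) \<in> borel_measurable borel"
        using g by (intro borel_measurable_Pair) auto
      have "range (\<lambda>s. (1::real, g s)) \<subseteq> {1} \<times> range g" by auto
      then show "bounded (range (\<lambda>s. (1::real, g s)))"
        by (rule bounded_subset[rotated]) (intro bounded_Times g bounded_insert[THEN iffD2] bounded_empty)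
      fix x y :: real assume xy: "0 \<le> x \<and> x \<le> y \<and> y \<le> S"
      have "((\<lambda>s. 1) has_integral (y - x)) {x..y}"
        using has_integral_const_real[of "1::real" x y] xy by simp
      moreover have "(g has_integral (f y - f x)) {x..y}"
        using f xy by (simp add: primitive_on_def)
      ultimately have "((\<lambda>s. (1, 0) + (0, g s)) has_integral ((y - x, 0) + (0, f y - f x))) {x..y}"
        by (intro has_integral_add has_integral_linear[OF _ bounded_linear_Pair[OF bounded_linear_ident bounded_linear_zero], unfolded o_def]
            has_integral_linear[OF _ bounded_linear_Pair[OF bounded_linear_zero bounded_linear_ident], unfolded o_def])
      then show "((\<lambda>s. (1, g s)) has_integral ((y, f y) - (x, f x))) {x..y}" by simp
    qed
    have der: "(\<Psi> has_derivative (\<lambda>h. G p \<bullet> h)) (at p)" for p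
    proof -
      have "(\<Psi> has_derivative (\<lambda>h. \<phi> (fst p) * (snd h \<bullet> i) + (deriv \<phi> (fst p) * fst h) * (snd p \<bullet> i))) (at p)"
        unfolding \<Psi>_def
        by (intro has_derivative_mult has_derivative_inner_left has_derivative_snd has_derivative_ident
            has_derivative_compose[OF has_derivative_fst[OF has_derivative_ident], of \<phi> "\<lambda>h. deriv \<phi> (fst p) * h"])
           (use d\<phi> in \<open>simp add: has_field_derivative_def\<close>)
      then show ?thesis
        by (simp add: G_def inner_prod_def case_prod_beta algebra_simps inner_commute)
    qed
    have Gc: "continuous_on UNIV G"
      unfolding G_def
      by (intro continuous_intros continuous_on_compose2[OF cont(1)[of UNIV]]
          continuous_on_compose2[OF cont(2)[of UNIV]]) auto
    have "((\<lambda>r. G (r, f r) \<bullet> (1, g r)) has_integral (\<Psi> (S, f S) - \<Psi> (0, f 0))) {0..S}"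
      by (rule primitive_on_chain_rule[OF w der Gc]) (use S in auto)
    then have "((\<lambda>s. (deriv \<phi> s *\<^sub>R f s) \<bullet> i + (\<phi> s *\<^sub>R g s) \<bullet> i) has_integral 0) {0..S}"
      by (simp add: G_def \<Psi>_def supp inner_commute)
    then have "integral {0..S} (\<lambda>s. (deriv \<phi> s *\<^sub>R f s) \<bullet> i + (\<phi> s *\<^sub>R g s) \<bullet> i) = 0"
      by (rule integral_unique)
    moreover have "integral {0..S} (\<lambda>s. (deriv \<phi> s *\<^sub>R f s) \<bullet> i + (\<phi> s *\<^sub>R g s) \<bullet> i) =
        integral {0..S} (\<lambda>s. (deriv \<phi> s *\<^sub>R f s) \<bullet> i) + integral {0..S} (\<lambda>s. (\<phi> s *\<^sub>R g s) \<bullet> i)"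
      by (intro integral_add integrable_component set_lebesgue_integral_eq_integral(1) i1 i2)
    ultimately show "integral {0..S} (\<lambda>s. deriv \<phi> s *\<^sub>R f s) \<bullet> i =
        (- integral {0..S} (\<lambda>s. \<phi> s *\<^sub>R g s)) \<bullet> i"
      using set_lebesgue_integral_eq_integral(1)[OF i1] set_lebesgue_integral_eq_integral(1)[OF i2]
      by (simp only: integral_component_eq inner_minus_left)
  qed
  then show "integral\<^sup>L (lebesgue_on {0<..<S}) (\<lambda>s. deriv \<phi> s *\<^sub>R f s) =
      - integral\<^sup>L (lebesgue_on {0<..<S}) (\<lambda>s. \<phi> s *\<^sub>R g s)"
    by (simp only: conv[OF i1] conv[OF i2])
qed

section \<open>Functions of bounded variation\<close>

lemma partition_le:
  assumes "partition a b n \<xi>" "i \<le> j" "j \<le> n"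
  shows "\<xi> i \<le> \<xi> j"
  using assms(2,3)
proof (induction j rule: dec_induct)
  case (step k)
  then have "\<xi> k < \<xi> (Suc k)" using assms(1) by (auto simp: partition_def)
  with step show ?case by simp
qed simp

lemma variation_sum_le:
  assumes p: "partition a b n \<xi>"
    and dom: "\<And>x y. a \<le> x \<Longrightarrow> x \<le> y \<Longrightarrow> y \<le> b \<Longrightarrow> norm (f y - f x) \<le> m y - m x"
  shows "(\<Sum>i<n. norm (f (\<xi> (Suc i)) - f (\<xi> i))) \<le> (m b - m a :: real)"
proof -
  have "(\<Sum>i<n. norm (f (\<xi> (Suc i)) - f (\<xi> i))) \<le> (\<Sum>i<n. m (\<xi> (Suc i)) - m (\<xi> i))"
  proof (rule sum_mono)
    fix i assume "i \<in> {..<n}"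
    then show "norm (f (\<xi> (Suc i)) - f (\<xi> i)) \<le> m (\<xi> (Suc i)) - m (\<xi> i)"
      using partition_le[OF p, of 0 i] partition_le[OF p, of i "Suc i"]
        partition_le[OF p, of "Suc i" n] p
      by (intro dom) (auto simp: partition_def)
  qed
  also have "\<dots> = m b - m a"
    using p by (subst sum_lessThan_telescope) (simp add: partition_def)
  finally show ?thesis .
qed

lemma dissipation_sums_nonempty:
  assumes "a \<le> b" shows "dissipation_sums R f a b \<noteq> {}"
proof (cases "a = b")
  case True
  then have "partition a b 0 (\<lambda>_. a)" by (simp add: partition_def)
  then show ?thesis unfolding dissipation_sums_def by blast
next
  case False
  then have "partition a b 1 (\<lambda>i. if i = 0 then a else b)"
    using assms by (simp add: partition_def)
  then show ?thesis unfolding dissipation_sums_def by blast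
qed

text \<open>The variation is the smallest increment of a function \<open>m\<close> that dominates the increments of
  \<open>f\<close>. Together with \<open>BV_on_variation\<close>, which says that the variation function itself is such
  an \<open>m\<close>, this replaces most arguments with partitions: an upper bound for a variation is
  proved by exhibiting a suitable \<open>m\<close>.\<close>

lemma Diss_norm_le:
  assumes "a \<le> b"
    and "\<And>x y. a \<le> x \<Longrightarrow> x \<le> y \<Longrightarrow> y \<le> b \<Longrightarrow> norm (f y - f x) \<le> m y - m x"
  shows "Diss norm f a b \<le> m b - m a"
  unfolding Diss_def
  by (rule cSup_least[OF dissipation_sums_nonempty[OF assms(1)]])
     (use variation_sum_le[OF _ assms(2)] in \<open>auto simp: dissipation_sums_def\<close>)

lemma BV_onI:
  assumes "\<And>x y. a \<le> x \<Longrightarrow> x \<le> y \<Longrightarrow> y \<le> b \<Longrightarrow> norm (f y - f x) \<le> (m y - m x :: real)"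
  shows "BV_on a b f"
  unfolding BV_on_def bdd_above_def
  by (rule exI[of _ "m b - m a"]) (use variation_sum_le[OF _ assms] in \<open>auto simp: dissipation_sums_def\<close>)

lemma Diss_refl [simp]: "Diss norm f a a = 0"
proof -
  have "n = 0" if "partition a a n \<xi>" for n \<xi>
  proof (rule ccontr)
    assume "n \<noteq> 0"
    then have "\<xi> 0 < \<xi> (Suc 0)" "\<xi> (Suc 0) \<le> \<xi> n"
      using that partition_le[OF that, of "Suc 0" n] by (auto simp: partition_def)
    then show False using that by (simp add: partition_def)
  qed
  then have "dissipation_sums norm f a a = {0}"
    using dissipation_sums_nonempty[of a a norm f] by (fastforce simp: dissipation_sums_def)
  then show ?thesis by (simp add: Diss_def)
qed

lemma dissipation_sums_snoc:
  assumes s: "s \<in> dissipation_sums norm f a x" and "x < y"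
  shows "s + norm (f y - f x) \<in> dissipation_sums norm f a y"
proof -
  obtain n \<xi> where p: "partition a x n \<xi>" and s: "s = (\<Sum>i<n. norm (f (\<xi> (Suc i)) - f (\<xi> i)))"
    using s by (auto simp: dissipation_sums_def)
  define \<eta> where "\<eta> i = (if i \<le> n then \<xi> i else y)" for i
  have "partition a y (Suc n) \<eta>"
    using p assms(2) by (auto simp: partition_def \<eta>_def less_Suc_eq)
  moreover have "(\<Sum>i<Suc n. norm (f (\<eta> (Suc i)) - f (\<eta> i))) = s + norm (f y - f x)"
    using p by (simp add: s \<eta>_def partition_def)
  ultimately show ?thesis unfolding dissipation_sums_def by (intro CollectI exI conjI) auto
qed

lemma BV_on_initial:
  assumes bv: "BV_on a b f" and "x \<le> b"
  shows "BV_on a x f"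
proof (cases "x = b")
  case False
  then have "x < b" using assms by simp
  obtain M where M: "\<And>s. s \<in> dissipation_sums norm f a b \<Longrightarrow> s \<le> M"
    using bv by (auto simp: BV_on_def bdd_above_def)
  have "s \<le> M" if "s \<in> dissipation_sums norm f a x" for s
    using M[OF dissipation_sums_snoc[OF that \<open>x < b\<close>]] by (smt (verit) norm_ge_zero)
  then show ?thesis unfolding BV_on_def bdd_above_def by blast
qed (use bv in simp)

lemma BV_on_variation:
  assumes bv: "BV_on a b f" and xy: "a \<le> x" "x \<le> y" "y \<le> b"
  shows "norm (f y - f x) \<le> Diss norm f a y - Diss norm f a x"
proof (cases "x = y")
  case False
  then have "x < y" using xy by simp
  have bdd: "bdd_above (dissipation_sums norm f a y)"
    using BV_on_initial[OF bv xy(3)] by (simp add: BV_on_def)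
  have "Diss norm f a x \<le> Diss norm f a y - norm (f y - f x)"
    unfolding Diss_def[of _ _ _ x]
  proof (rule cSup_least[OF dissipation_sums_nonempty[OF xy(1)]])
    fix s assume "s \<in> dissipation_sums norm f a x"
    then have "s + norm (f y - f x) \<le> Diss norm f a y"
      unfolding Diss_def by (intro cSup_upper dissipation_sums_snoc \<open>x < y\<close> bdd)
    then show "s \<le> Diss norm f a y - norm (f y - f x)" by simp
  qed
  then show ?thesis by simp
qed simp

lemma BV_on_subinterval:
  assumes "BV_on a b f" "a \<le> x" "y \<le> b"
  shows "BV_on x y f"
  by (rule BV_onI[where m="Diss norm f a"]) (use assms in \<open>auto intro!: BV_on_variation\<close>)

lemma Diss_norm_triangle:
  assumes bv: "BV_on a c f" and "a \<le> b" "b \<le> c"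
  shows "Diss norm f a c \<le> Diss norm f a b + Diss norm f b c"
proof -
  define m where "m t = (if t \<le> b then Diss norm f a t else Diss norm f a b + Diss norm f b t)" for t
  have bv': "BV_on b c f" by (rule BV_on_subinterval[OF bv]) (use assms in auto)
  have "Diss norm f a c \<le> m c - m a"
  proof (rule Diss_norm_le)
    fix x y assume xy: "a \<le> x" "x \<le> y" "y \<le> c"
    consider "y \<le> b" | "x \<le> b" "b < y" | "b < x" by linarith
    then show "norm (f y - f x) \<le> m y - m x"
    proof cases
      case 1
      then show ?thesis using BV_on_variation[OF bv, of x y] xy by (simp add: m_def)
    next
      case 2
      have "norm (f y - f x) \<le> norm (f y - f b) + norm (f b - f x)"
        using norm_triangle_ineq[of "f y - f b" "f b - f x"] by simp
      then show ?thesis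
        using 2 BV_on_variation[OF bv, of x b] BV_on_variation[OF bv', of b y] xy assms
        by (simp add: m_def)
    next
      case 3
      then show ?thesis using BV_on_variation[OF bv', of x y] xy by (simp add: m_def)
    qed
  qed (use assms in simp)
  then show ?thesis using assms by (auto simp: m_def split: if_splits)
qed

text \<open>The variation function of \<open>f\<close> is enlarged by two jumps at \<open>c\<close>, one for each side.\<close>

lemma BV_on_change_one:
  assumes bv: "BV_on a b f" and eq: "\<And>x. x \<in> {a..b} \<Longrightarrow> x \<noteq> c \<Longrightarrow> g x = f x"
  shows "BV_on a b g"
proof -
  define K where "K = norm (f c - g c)"
  define m where "m x = Diss norm f a x + K * (of_bool (c < x) + of_bool (c \<le> x))" for x
  have K: "K \<ge> 0" by (simp add: K_def)
  show ?thesis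
  proof (rule BV_onI[where m=m])
    fix x y assume xy: "a \<le> x" "x \<le> y" "y \<le> b"
    note v = BV_on_variation[OF bv xy]
    have t: "norm (g y - g x) \<le> norm (f y - f x) + norm (g y - f y) + norm (f x - g x)"
      by (smt (verit) add_diff_eq diff_add_cancel norm_triangle_ineq)
    show "norm (g y - g x) \<le> m y - m x"
    proof (cases "x = y")
      case False
      have "norm (g y - f y) \<le> K * of_bool (y = c)"
        using eq[of y] xy by (cases "y = c") (auto simp: K_def norm_minus_commute)
      moreover have "norm (f x - g x) \<le> K * of_bool (x = c)"
        using eq[of x] xy by (cases "x = c") (auto simp: K_def)
      moreover have "K * of_bool (y = c) + K * of_bool (x = c) \<le>
          K * (of_bool (c < y) + of_bool (c \<le> y)) - K * (of_bool (c < x) + of_bool (c \<le> x))"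
        using False xy K by (auto simp: of_bool_def)
      ultimately show ?thesis using v t by (simp add: m_def)
    qed simp
  qed
qed

text \<open>The dominating function takes an extra jump of height \<open>norm (g 0 - f S1)\<close> at the seam.\<close>

lemma BV_on_concat:
  assumes f: "BV_on 0 S1 f" and g: "BV_on 0 S2 g" and S: "0 \<le> S1"
  shows "BV_on 0 (S1 + S2) (\<lambda>s. if s \<le> S1 then f s else g (s - S1))"
proof -
  define m where "m s = (if s \<le> S1 then Diss norm f 0 s
     else Diss norm f 0 S1 + norm (g 0 - f S1) + Diss norm g 0 (s - S1))" for s
  show ?thesis
  proof (rule BV_onI[where m=m])
    fix x y assume xy: "0 \<le> x" "x \<le> y" "y \<le> S1 + S2"
    consider "y \<le> S1" | "x \<le> S1" "S1 < y" | "S1 < x" by linarith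
    then show "norm ((if y \<le> S1 then f y else g (y - S1)) - (if x \<le> S1 then f x else g (x - S1))) \<le> m y - m x"
    proof cases
      case 1
      then show ?thesis using BV_on_variation[OF f, of x y] xy by (simp add: m_def)
    next
      case 2
      have "norm (g (y - S1) - f x) \<le> norm (g (y - S1) - g 0) + norm (g 0 - f S1) + norm (f S1 - f x)"
        by (smt (verit) add_diff_eq diff_add_cancel norm_triangle_ineq)
      then show ?thesis
        using 2 BV_on_variation[OF f, of x S1] BV_on_variation[OF g, of 0 "y - S1"] xy S
        by (simp add: m_def)
    next
      case 3
      then show ?thesis using BV_on_variation[OF g, of "x - S1" "y - S1"] xy by (simp add: m_def)
    qed
  qed
qed

lemma BV_on_compose_mono:
  assumes f: "BV_on a b f"
    and th: "\<And>x y. 0 \<le> x \<Longrightarrow> x \<le> y \<Longrightarrow> y \<le> S \<Longrightarrow> th x \<le> th y" "th 0 = a" "th S = b"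
  shows "BV_on 0 S (\<lambda>s. f (th s))"
proof (rule BV_onI[where m="\<lambda>s. Diss norm f a (th s)"])
  fix x y assume "0 \<le> x" "x \<le> y" "y \<le> S"
  then show "norm (f (th y) - f (th x)) \<le> Diss norm f a (th y) - Diss norm f a (th x)"
    using th(1)[of 0 x] th(1)[of x y] th(1)[of y S] th(2,3) by (intro BV_on_variation[OF f]) auto
qed

text \<open>\<open>f\<close> is continuous wherever its variation function is, and a monotone function has only
  countably many discontinuities.\<close>

lemma BV_on_countable_discontinuities:
  fixes f :: "real \<Rightarrow> 'a::euclidean_space"
  assumes bv: "BV_on a b f"
  shows "countable {t \<in> {a<..<b}. \<not> isCont f t}"
proof -
  have "mono_on {a<..<b} (Diss norm f a)"
  proof (rule mono_onI)
    fix r s assume "r \<in> {a<..<b}" "s \<in> {a<..<b}" "r \<le> s"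
    then have "norm (f s - f r) \<le> Diss norm f a s - Diss norm f a r"
      by (intro BV_on_variation[OF bv]) auto
    then show "Diss norm f a r \<le> Diss norm f a s"
      using norm_ge_zero[of "f s - f r"] by linarith
  qed
  then have "countable {t \<in> {a<..<b}. \<not> isCont (Diss norm f a) t}"
    by (intro mono_on_ctble_discont_open) auto
  moreover have "isCont f t" if t: "t \<in> {a<..<b}" "isCont (Diss norm f a) t" for t
  proof -
    have "((\<lambda>x. f x - f t) \<longlongrightarrow> 0) (at t)"
    proof (rule Lim_null_comparison)
      have "\<forall>\<^sub>F x in at t. x \<in> {a<..<b}"
        using t(1) by (intro eventually_at_in_open') auto
      then show "\<forall>\<^sub>F x in at t. norm (f x - f t) \<le> \<bar>Diss norm f a x - Diss norm f a t\<bar>"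
      proof eventually_elim
        case (elim x)
        show ?case
          using BV_on_variation[OF bv, of x t] BV_on_variation[OF bv, of t x] elim t
          by (cases "x \<le> t") (auto simp: norm_minus_commute)
      qed
      have "((\<lambda>x. Diss norm f a x - Diss norm f a t) \<longlongrightarrow> 0) (at t)"
        using t(2) by (simp add: isCont_def LIM_zero_iff)
      then show "((\<lambda>x. \<bar>Diss norm f a x - Diss norm f a t\<bar>) \<longlongrightarrow> 0) (at t)"
        by (rule tendsto_rabs_zero)
    qed
    then show ?thesis by (simp add: isCont_def LIM_zero_iff)
  qed
  then have "{t \<in> {a<..<b}. \<not> isCont f t} \<subseteq> {t \<in> {a<..<b}. \<not> isCont (Diss norm f a) t}" by blast
  ultimately show ?thesis by (rule countable_subset[rotated])
qed

text \<open>The variation function is bounded and monotone, hence nearly constant close to an end point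
  (which is left out); it bounds the oscillation of \<open>f\<close>, so the Cauchy criterion applies.\<close>

lemma BV_on_one_sided_limits:
  fixes f :: "real \<Rightarrow> 'a::euclidean_space"
  assumes bv: "BV_on a b f" and ab: "a < b"
  shows "\<exists>p. (f \<longlongrightarrow> p) (at_right a)" and "\<exists>p. (f \<longlongrightarrow> p) (at_left b)"
proof -
  define V where "V = Diss norm f a"
  have V: "norm (f y - f x) \<le> V y - V x" if "a \<le> x" "x \<le> y" "y \<le> b" for x y
    using BV_on_variation[OF bv that] by (simp add: V_def)
  have mono: "V x \<le> V y" if "a \<le> x" "x \<le> y" "y \<le> b" for x y
    using V[OF that] norm_ge_zero[of "f y - f x"] by linarith
  have dist: "dist (f x) (f y) \<le> \<bar>V y - V x\<bar>" if "x \<in> {a<..<b}" "y \<in> {a<..<b}" for x y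
    using V[of x y] V[of y x] that by (cases "x \<le> y") (auto simp: dist_norm norm_minus_commute)
  have ne: "{a<..<b} \<noteq> {}" using ab by auto
  have bdd: "bdd_below (V ` {a<..<b})" "bdd_above (V ` {a<..<b})"
    using mono[of a] mono[of _ b] by (auto intro!: bdd_belowI[of _ "V a"] bdd_aboveI[of _ "V b"])
  have cauchy: "\<exists>p. (f \<longlongrightarrow> p) F"
    if F: "F \<noteq> bot" and P: "\<And>e. e > 0 \<Longrightarrow> \<exists>P. eventually P F \<and> (\<forall>x y. P x \<and> P y \<longrightarrow> dist (f x) (f y) < e)"
    for F
  proof -
    have "cauchy_filter (filtermap f F)" using P by (simp add: cauchy_filter_metric_filtermap)
    then have "\<exists>c. filtermap f F \<le> nhds c"
      using F by (intro cauchy_filter_complete_converges[of _ UNIV])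
        (auto simp: complete_UNIV filtermap_bot_iff)
    then show ?thesis by (simp add: filterlim_def)
  qed
  show "\<exists>p. (f \<longlongrightarrow> p) (at_right a)"
  proof (rule cauchy)
    fix e :: real assume "e > 0"
    then obtain t where t: "t \<in> {a<..<b}" "V t < Inf (V ` {a<..<b}) + e"
      using cInf_lessD[of "V ` {a<..<b}" "Inf (V ` {a<..<b}) + e"] ne by auto
    have "dist (f x) (f y) < e" if "x \<in> {a<..<t}" "y \<in> {a<..<t}" for x y
    proof -
      have "Inf (V ` {a<..<b}) \<le> V x" "Inf (V ` {a<..<b}) \<le> V y"
        using that t by (auto intro!: cInf_lower bdd)
      moreover have "V x \<le> V t" "V y \<le> V t" using that t by (auto intro!: mono)
      ultimately show ?thesis using dist[of x y] that t by auto
    qed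
    moreover have "\<forall>\<^sub>F x in at_right a. x \<in> {a<..<t}"
      using t by (auto simp: eventually_at_right_field)
    ultimately show "\<exists>P. eventually P (at_right a) \<and> (\<forall>x y. P x \<and> P y \<longrightarrow> dist (f x) (f y) < e)"
      by (intro exI[of _ "\<lambda>x. x \<in> {a<..<t}"]) auto
  qed simp
  show "\<exists>p. (f \<longlongrightarrow> p) (at_left b)"
  proof (rule cauchy)
    fix e :: real assume "e > 0"
    then obtain t where t: "t \<in> {a<..<b}" "Sup (V ` {a<..<b}) - e < V t"
      using less_cSupD[of "V ` {a<..<b}" "Sup (V ` {a<..<b}) - e"] ne by auto
    have "dist (f x) (f y) < e" if "x \<in> {t<..<b}" "y \<in> {t<..<b}" for x y
    proof -
      have "V x \<le> Sup (V ` {a<..<b})" "V y \<le> Sup (V ` {a<..<b})"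
        using that t by (auto intro!: cSup_upper bdd)
      moreover have "V t \<le> V x" "V t \<le> V y" using that t by (auto intro!: mono)
      ultimately show ?thesis using dist[of x y] that t by auto
    qed
    moreover have "\<forall>\<^sub>F x in at_left b. x \<in> {t<..<b}"
      using t by (auto simp: eventually_at_left_field)
    ultimately show "\<exists>P. eventually P (at_left b) \<and> (\<forall>x y. P x \<and> P y \<longrightarrow> dist (f x) (f y) < e)"
      by (intro exI[of _ "\<lambda>x. x \<in> {t<..<b}"]) auto
  qed simp
qed

lemma dissipation_sums_cong:
  assumes "\<And>t. t \<in> {a..b} \<Longrightarrow> f t = g t"
  shows "dissipation_sums R f a b = dissipation_sums R g a b"
proof -
  have "(\<Sum>i<n. R (f (\<xi> (Suc i)) - f (\<xi> i))) = (\<Sum>i<n. R (g (\<xi> (Suc i)) - g (\<xi> i)))"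
    if p: "partition a b n \<xi>" for n \<xi>
  proof (rule sum.cong)
    fix i assume "i \<in> {..<n}"
    then show "R (f (\<xi> (Suc i)) - f (\<xi> i)) = R (g (\<xi> (Suc i)) - g (\<xi> i))"
      using partition_le[OF p, of 0 i] partition_le[OF p, of i "Suc i"]
        partition_le[OF p, of "Suc i" n] p assms[of "\<xi> i"] assms[of "\<xi> (Suc i)"]
      by (auto simp: partition_def)
  qed simp
  then show ?thesis unfolding dissipation_sums_def by (intro Collect_cong) metis
qed

lemma Diss_norm_le_scaled:
  assumes \<rho>: "0 < \<rho>" and R: "\<And>v. R v = \<rho> * norm v" and bv: "BV_on a b f" and ab: "a \<le> b"
  shows "\<rho> * Diss norm f a b \<le> Diss R f a b"
proof -
  have sums: "s \<in> dissipation_sums R f a b \<longleftrightarrow> s / \<rho> \<in> dissipation_sums norm f a b" for s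
    using \<rho> unfolding dissipation_sums_def R sum_distrib_left[symmetric]
    by (auto simp: field_simps)
  obtain M where M: "\<And>s. s \<in> dissipation_sums norm f a b \<Longrightarrow> s \<le> M"
    using bv by (auto simp: BV_on_def bdd_above_def)
  have bdd: "bdd_above (dissipation_sums R f a b)"
  proof (rule bdd_aboveI[of _ "\<rho> * M"])
    show "s \<le> \<rho> * M" if "s \<in> dissipation_sums R f a b" for s
      using M[of "s / \<rho>"] that sums \<rho> by (simp add: field_simps)
  qed
  have "Diss norm f a b \<le> Diss R f a b / \<rho>"
    unfolding Diss_def[of norm]
  proof (rule cSup_least[OF dissipation_sums_nonempty[OF ab]])
    fix s assume "s \<in> dissipation_sums norm f a b"
    then have "\<rho> * s \<in> dissipation_sums R f a b" using sums[of "\<rho> * s"] \<rho> by simp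
    then have "\<rho> * s \<le> Diss R f a b" unfolding Diss_def by (rule cSup_upper[OF _ bdd])
    then show "s \<le> Diss R f a b / \<rho>" using \<rho> by (simp add: field_simps)
  qed
  then show ?thesis using \<rho> by (simp add: field_simps)
qed

section \<open>Arclength parametrization of a continuous graph\<close>

lemma negligible_of_AE:
  assumes "AE s in lebesgue. P s"
  shows "negligible {s. \<not> P s}"
proof -
  obtain N where "\<And>s. s \<in> space lebesgue - N \<Longrightarrow> P s" "N \<in> null_sets lebesgue"
    using AE_E3[OF assms] by blast
  then have "{s. \<not> P s} \<subseteq> N" "negligible N"
    by (auto simp: negligible_iff_null_sets)
  then show ?thesis by (rule negligible_subset[rotated])
qed

lemma integral_le_AE:
  fixes f g :: "real \<Rightarrow> real"
  assumes f: "f integrable_on {x..y}" and g: "g integrable_on {x..y}"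
    and le: "AE s in lebesgue. x < s \<and> s < y \<longrightarrow> f s \<le> g s"
  shows "integral {x..y} f \<le> integral {x..y} g"
proof -
  define N where "N = {s. \<not> (x < s \<and> s < y \<longrightarrow> f s \<le> g s)} \<union> {x, y}"
  have N: "negligible N"
    unfolding N_def using negligible_of_AE[OF le] by (intro negligible_Un) auto
  define h where "h s = (if s \<in> N then g s else f s)" for s
  have "integral {x..y} f = integral {x..y} h"
    by (rule integral_spike[OF N]) (auto simp: h_def)
  also have "\<dots> \<le> integral {x..y} g"
  proof (rule integral_le)
    show "h integrable_on {x..y}"
      by (rule integrable_spike[OF f N]) (auto simp: h_def)
    show "h s \<le> g s" if "s \<in> {x..y}" for s
      using that by (auto simp: h_def N_def)
  qed (rule g)
  finally show ?thesis .
qed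

text \<open>The parameter is the length \<open>\<sigma> t\<close> of the graph of \<open>w\<close> over \<open>{a..t}\<close>, where the time
  direction has weight \<open>1\<close> and the space direction weight \<open>\<rho>\<close>, and \<open>th\<close> is its generalised
  inverse. A jump of \<open>\<sigma>\<close> would make \<open>th\<close> constant on an
  interval; the continuity of \<open>w\<close> shows that even then \<open>th\<close> and \<open>w \<circ> th\<close> are Lipschitz with
  \<open>td + \<rho> * norm zd \<le> 1\<close>. Equality holds because no length is lost. The variation of \<open>w\<close> between
  \<open>th s\<close> and \<open>th s'\<close> is at most the integral of \<open>norm zd\<close>, so a strict inequality
  on a set of positive measure would contradict \<open>S = (b - a) + \<rho> * Diss norm w a b\<close>. The same
  bookkeeping on subintervals gives the strict monotonicity of \<open>th\<close> and the estimate of the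
  length of the curve by the variation of \<open>w\<close>.\<close>

lemma arclength_parametrization:
  fixes w :: "real \<Rightarrow> 'a::euclidean_space"
  assumes ab: "a < b" and cont: "continuous_on {a..b} w" and bv: "BV_on a b w" and \<rho>: "0 < \<rho>"
  obtains S th td zd where "0 < S" "primitive_on S th td" "primitive_on S (\<lambda>s. w (th s)) zd"
    "th 0 = a" "th S = b"
    "\<And>x y. 0 \<le> x \<Longrightarrow> x < y \<Longrightarrow> y \<le> S \<Longrightarrow> th x < th y"
    "AE s in lebesgue. 0 < s \<and> s < S \<longrightarrow> 0 \<le> td s \<and> td s + \<rho> * norm (zd s) = 1"
    "\<And>x y. 0 \<le> x \<Longrightarrow> x \<le> y \<Longrightarrow> y \<le> S \<Longrightarrow>
       integral {x..y} (\<lambda>r. norm (zd r)) \<le> Diss norm w (th x) (th y)"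
proof -
  define \<sigma> where "\<sigma> t = t - a + \<rho> * Diss norm w a t" for t
  define S where "S = \<sigma> b"
  define A where "A s = {t \<in> {a..b}. \<sigma> t \<le> s}" for s
  define th where "th s = Sup (A s)" for s
  have \<sigma>_ge: "(y - x) + \<rho> * norm (w y - w x) \<le> \<sigma> y - \<sigma> x" if "a \<le> x" "x \<le> y" "y \<le> b" for x y
    using mult_left_mono[OF BV_on_variation[OF bv that], of \<rho>] \<rho>
    by (simp add: \<sigma>_def right_diff_distrib)
  have \<sigma>_less: "\<sigma> x < \<sigma> y" if "a \<le> x" "x < y" "y \<le> b" for x y
    using \<sigma>_ge[of x y] that \<rho> by (smt (verit) mult_nonneg_nonneg norm_ge_zero)
  then have \<sigma>_le: "\<sigma> x \<le> \<sigma> y" if "a \<le> x" "x \<le> y" "y \<le> b" for x y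
    using that by (cases "x = y") (auto intro: less_imp_le)
  have \<sigma>_a: "\<sigma> a = 0" by (simp add: \<sigma>_def)
  have S: "0 < S" using \<sigma>_less[of a b] ab by (simp add: S_def \<sigma>_a)
  have aA: "a \<in> A s" if "0 \<le> s" for s using that ab by (simp add: A_def \<sigma>_a)
  have bddA: "bdd_above (A s)" for s by (auto simp: A_def intro: bdd_aboveI[of _ b])
  have th_in: "th s \<in> {a..b}" if "0 \<le> s" for s
  proof -
    have "a \<le> th s" unfolding th_def by (rule cSup_upper[OF aA[OF that] bddA])
    moreover have "th s \<le> b" unfolding th_def
      by (rule cSup_least) (use aA[OF that] in \<open>auto simp: A_def\<close>)
    ultimately show ?thesis by simp
  qed
  have th_\<sigma>: "th (\<sigma> t) = t" if "t \<in> {a..b}" for t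
    unfolding th_def
  proof (rule cSup_eq_maximum)
    show "x \<le> t" if "x \<in> A (\<sigma> t)" for x
      using that \<open>t \<in> {a..b}\<close> \<sigma>_less[of t x] by (auto simp: A_def not_less[symmetric])
  qed (use that in \<open>simp add: A_def\<close>)
  have th_0: "th 0 = a" and th_S: "th S = b"
    using th_\<sigma>[of a] th_\<sigma>[of b] ab by (auto simp: \<sigma>_a S_def)
  have th_mono: "th s \<le> th s'" if "0 \<le> s" "s \<le> s'" for s s'
    unfolding th_def using aA[OF that(1)] that
    by (intro cSup_subset_mono bddA) (auto simp: A_def)
  have below: "\<sigma> x \<le> s" if s: "0 \<le> s" and x: "a \<le> x" "x < th s" for x s
  proof -
    have "A s \<noteq> {}" using aA[OF s] by blast
    then obtain t where "t \<in> A s" "x < t"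
      using x(2) less_cSupD[of "A s" x] by (auto simp: th_def)
    then show ?thesis using \<sigma>_le[of x t] x by (auto simp: A_def)
  qed
  have above: "s < \<sigma> x" if "0 \<le> s" "th s < x" "x \<le> b" for x s
  proof (rule ccontr)
    assume "\<not> s < \<sigma> x"
    then have "x \<in> A s" using that th_in[OF that(1)] by (auto simp: A_def)
    then have "x \<le> th s" unfolding th_def by (rule cSup_upper[OF _ bddA])
    with that show False by simp
  qed
  \<comment> \<open>The increments strictly inside the time interval are bounded by those of \<open>\<sigma>\<close>, which may jump at the ends; the continuity of \<open>w\<close> carries the bound to the closed interval.\<close>
  have key: "(th s2 - th s1) + \<rho> * norm (w (th s2) - w (th s1)) \<le> s2 - s1"
    if s: "0 \<le> s1" "s1 \<le> s2" for s1 s2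
  proof (cases "th s1 = th s2")
    case False
    define t1 where "t1 = th s1"
    define t2 where "t2 = th s2"
    have t: "a \<le> t1" "t1 < t2" "t2 \<le> b"
      using th_in[of s1] th_in[of s2] th_mono[OF s] False s by (auto simp: t1_def t2_def)
    have ev: "\<forall>\<^sub>F e in at_right 0. 0 < e \<and> e < (t2 - t1) / 2"
      using t by (auto simp: eventually_at_right_field intro!: exI[of _ "(t2 - t1) / 2"])
    have lim: "((\<lambda>e. (t2 - e) - (t1 + e) + \<rho> * norm (w (t2 - e) - w (t1 + e))) \<longlongrightarrow>
        (t2 - 0) - (t1 + 0) + \<rho> * norm (w t2 - w t1)) (at_right 0)"
    proof (intro tendsto_intros)
      show "((\<lambda>e. w (t2 - e)) \<longlongrightarrow> w t2) (at_right 0)"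
      proof (rule continuous_on_tendsto_compose[OF cont])
        have "((\<lambda>e. t2 - e) \<longlongrightarrow> t2 - 0) (at_right 0)" by (intro tendsto_intros)
        then show "((\<lambda>e. t2 - e) \<longlongrightarrow> t2) (at_right 0)" by simp
        show "\<forall>\<^sub>F e in at_right 0. t2 - e \<in> {a..b}"
          using ev by eventually_elim (use t in auto)
      qed (use t in auto)
      show "((\<lambda>e. w (t1 + e)) \<longlongrightarrow> w t1) (at_right 0)"
      proof (rule continuous_on_tendsto_compose[OF cont])
        have "((\<lambda>e. t1 + e) \<longlongrightarrow> t1 + 0) (at_right 0)" by (intro tendsto_intros)
        then show "((\<lambda>e. t1 + e) \<longlongrightarrow> t1) (at_right 0)" by simp
        show "\<forall>\<^sub>F e in at_right 0. t1 + e \<in> {a..b}"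
          using ev by eventually_elim (use t in auto)
      qed (use t in auto)
    qed
    have "(t2 - 0) - (t1 + 0) + \<rho> * norm (w t2 - w t1) \<le> s2 - s1"
    proof (rule tendsto_upperbound[OF lim])
      show "\<forall>\<^sub>F e in at_right 0. (t2 - e) - (t1 + e) + \<rho> * norm (w (t2 - e) - w (t1 + e)) \<le> s2 - s1"
        using ev
      proof eventually_elim
        case (elim e)
        have "(t2 - e) - (t1 + e) + \<rho> * norm (w (t2 - e) - w (t1 + e)) \<le> \<sigma> (t2 - e) - \<sigma> (t1 + e)"
          using elim t by (intro \<sigma>_ge) auto
        moreover have "\<sigma> (t2 - e) \<le> s2" using elim t s by (intro below) (auto simp: t2_def)
        moreover have "s1 < \<sigma> (t1 + e)" using elim t s by (intro above) (auto simp: t1_def)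
        ultimately show ?case by simp
      qed
    qed simp
    then show ?thesis by (simp add: t1_def t2_def)
  qed (use s in simp)
  have key_w: "norm (w (th y) - w (th x)) \<le> 1 / \<rho> * (y - x)" if "0 \<le> x" "x \<le> y" for x y
    using key[OF that] th_mono[OF that] \<rho> by (simp add: field_simps)
  have key_t: "norm (th y - th x) \<le> 1 * (y - x)" if "0 \<le> x" "x \<le> y" for x y
    using key[OF that] th_mono[OF that] \<rho>
    by (smt (verit) mult_nonneg_nonneg norm_ge_zero real_norm_def)
  obtain td where td: "primitive_on S th td"
    using lipschitz_has_density[of S 1 th] key_t S by auto
  obtain zd where zd: "primitive_on S (\<lambda>s. w (th s)) zd"
    using lipschitz_has_density[of S "1 / \<rho>" "\<lambda>s. w (th s)"] key_w S \<rho> by auto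
  have td_m: "td \<in> borel_measurable borel" "bounded (range td)"
    and zd_m: "zd \<in> borel_measurable borel" "bounded (range zd)"
    using td zd by (auto simp: primitive_on_def)
  note [measurable] = td_m(1) zd_m(1)
  have td_int: "(td has_integral (th y - th x)) {x..y}" if "0 \<le> x" "x \<le> y" "y \<le> S" for x y
    using td that by (simp add: primitive_on_def)
  have zd_int: "(zd has_integral (w (th y) - w (th x))) {x..y}" if "0 \<le> x" "x \<le> y" "y \<le> S" for x y
    using zd that by (simp add: primitive_on_def)
  have n_m: "(\<lambda>s. norm (zd s)) \<in> borel_measurable borel" "bounded (range (\<lambda>s. norm (zd s)))"
    using zd_m by (auto simp: bounded_iff)
  note n_int = integrable_bounded_borel(2)[OF n_m]
  define f where "f s = td s + \<rho> * norm (zd s)" for s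
  have f_m: "f \<in> borel_measurable borel" "bounded (range f)"
  proof -
    show "f \<in> borel_measurable borel" unfolding f_def[abs_def] by measurable
    obtain B C where "\<And>s. \<bar>td s\<bar> \<le> B" "\<And>s. norm (zd s) \<le> C"
      using td_m zd_m by (auto simp: bounded_iff)
    then have "\<bar>f s\<bar> \<le> B + \<rho> * C" for s
      unfolding f_def using \<rho> by (smt (verit) mult_left_mono mult_nonneg_nonneg norm_ge_zero)
    then show "bounded (range f)" by (auto simp: bounded_iff)
  qed
  have f_int: "(f has_integral (th y - th x + \<rho> * integral {x..y} (\<lambda>r. norm (zd r)))) {x..y}"
    if "0 \<le> x" "x \<le> y" "y \<le> S" for x y
    unfolding f_def[abs_def]
    by (intro has_integral_add td_int that has_integral_mult_right integrable_integral n_int)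
  have one: "(\<lambda>_::real. c) \<in> borel_measurable borel" "bounded (range (\<lambda>_::real. c))" for c :: real
    by auto
  have one_int: "integral {x..y} (\<lambda>_. c) = c * (y - x)" if "x \<le> y" for x y c :: real
    using that by simp
  have td_nonneg: "AE s in lebesgue. 0 < s \<and> s < S \<longrightarrow> 0 \<le> td s"
  proof (rule AE_le_of_integral_le[OF one td_m])
    show "integral {x..y} (\<lambda>_. 0) \<le> integral {x..y} td" if "0 < x" "x < y" "y < S" for x y
      using integral_unique[OF td_int[of x y]] th_mono[of x y] that by simp
  qed
  \<comment> \<open>The norm is a supremum of linear functionals; countably many directions \<open>d\<close> suffice. Multiplying by \<open>norm d\<close> avoids normalising \<open>d\<close>, so that \<open>d\<close> may finally be replaced by \<open>zd s\<close>.\<close>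
  obtain D :: "'a set" where D: "countable D" "\<And>X. open X \<Longrightarrow> X \<noteq> {} \<Longrightarrow> \<exists>d\<in>D. d \<in> X"
    using countable_dense_exists by blast
  have "AE s in lebesgue. 0 < s \<and> s < S \<longrightarrow> norm d * td s + \<rho> * (d \<bullet> zd s) \<le> norm d" for d
  proof (rule AE_le_of_integral_le[OF _ _ one])
    show "(\<lambda>s. norm d * td s + \<rho> * (d \<bullet> zd s)) \<in> borel_measurable borel" by measurable
    obtain B C where B: "\<And>s. \<bar>td s\<bar> \<le> B" "\<And>s. norm (zd s) \<le> C"
      using td_m zd_m by (auto simp: bounded_iff)
    have "\<bar>norm d * td s + \<rho> * (d \<bullet> zd s)\<bar> \<le> norm d * B + \<rho> * (norm d * C)" for s
    proof -
      have "\<bar>norm d * td s\<bar> \<le> norm d * B"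
        using B(1)[of s] by (simp add: abs_mult mult_left_mono)
      moreover have "\<bar>d \<bullet> zd s\<bar> \<le> norm d * C"
        using Cauchy_Schwarz_ineq2[of d "zd s"] mult_left_mono[OF B(2)[of s] norm_ge_zero[of d]]
        by linarith
      then have "\<bar>\<rho> * (d \<bullet> zd s)\<bar> \<le> \<rho> * (norm d * C)"
        using \<rho> by (simp add: abs_mult)
      ultimately show ?thesis by linarith
    qed
    then show "bounded (range (\<lambda>s. norm d * td s + \<rho> * (d \<bullet> zd s)))" by (auto simp: bounded_iff)
    show "integral {x..y} (\<lambda>s. norm d * td s + \<rho> * (d \<bullet> zd s)) \<le> integral {x..y} (\<lambda>_. norm d)"
      if xy: "0 < x" "x < y" "y < S" for x y
    proof -
      have "((\<lambda>s. d \<bullet> zd s) has_integral (d \<bullet> (w (th y) - w (th x)))) {x..y}"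
        using has_integral_linear[OF zd_int[of x y] bounded_linear_inner_right[of d]] xy
        by (simp add: o_def)
      then have "((\<lambda>s. norm d * td s + \<rho> * (d \<bullet> zd s)) has_integral
          (norm d * (th y - th x) + \<rho> * (d \<bullet> (w (th y) - w (th x))))) {x..y}"
        using xy by (intro has_integral_add has_integral_mult_right td_int) auto
      then have "integral {x..y} (\<lambda>s. norm d * td s + \<rho> * (d \<bullet> zd s)) =
          norm d * (th y - th x) + \<rho> * (d \<bullet> (w (th y) - w (th x)))"
        by (rule integral_unique)
      also have "\<dots> \<le> norm d * (th y - th x) + \<rho> * (norm d * norm (w (th y) - w (th x)))"
        using \<rho> by (intro add_left_mono mult_left_mono norm_cauchy_schwarz) auto
      also have "\<dots> = norm d * ((th y - th x) + \<rho> * norm (w (th y) - w (th x)))"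
        by (simp add: algebra_simps)
      also have "\<dots> \<le> norm d * (y - x)"
        using key[of x y] xy by (intro mult_left_mono) auto
      finally show ?thesis using xy by (subst one_int) auto
    qed
  qed
  then have "AE s in lebesgue. \<forall>d\<in>D. 0 < s \<and> s < S \<longrightarrow> norm d * td s + \<rho> * (d \<bullet> zd s) \<le> norm d"
    by (subst AE_ball_countable[OF D(1)]) blast
  then have f_le: "AE s in lebesgue. 0 < s \<and> s < S \<longrightarrow> f s \<le> 1"
  proof eventually_elim
    case (elim s)
    show ?case
    proof
      assume s: "0 < s \<and> s < S"
      have all: "norm d * td s + \<rho> * (d \<bullet> zd s) \<le> norm d" for d
      proof (rule ccontr)
        assume "\<not> norm d * td s + \<rho> * (d \<bullet> zd s) \<le> norm d"
        then have "d \<in> {d. norm d < norm d * td s + \<rho> * (d \<bullet> zd s)}" by simp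
        moreover have "open {d. norm d < norm d * td s + \<rho> * (d \<bullet> zd s)}"
          by (intro open_Collect_less continuous_intros)
        ultimately obtain d' where "d' \<in> D" "norm d' < norm d' * td s + \<rho> * (d' \<bullet> zd s)"
          using D(2) by blast
        then show False using elim s by force
      qed
      show "f s \<le> 1"
      proof (cases "zd s = 0")
        case True
        obtain e :: 'a where "e \<in> Basis" by (rule nonempty_Basis[THEN ex_in_conv[THEN iffD2, THEN exE]])
        then show ?thesis using all[of e] True by (simp add: f_def)
      next
        case False
        have "norm (zd s) * f s \<le> norm (zd s) * 1"
          using all[of "zd s"] by (simp add: f_def algebra_simps dot_square_norm power2_eq_square)
        then show ?thesis using False by simp
      qed
    qed
  qed
  have up: "th y - th x + \<rho> * integral {x..y} (\<lambda>r. norm (zd r)) \<le> y - x"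
    if xy: "0 \<le> x" "x \<le> y" "y \<le> S" for x y
  proof -
    have "integral {x..y} f \<le> integral {x..y} (\<lambda>_. 1)"
      by (rule integral_le_AE)
        (use f_int[OF xy] f_le xy in \<open>auto simp: integrable_on_def elim!: eventually_mono\<close>)
    then show ?thesis using integral_unique[OF f_int[OF xy]] xy by simp
  qed
  have Diss_le: "Diss norm w (th s) (th s') \<le> integral {s..s'} (\<lambda>r. norm (zd r))"
    if s: "0 \<le> s" "s \<le> s'" "s' \<le> S" for s s'
  proof -
    \<comment> \<open>\<open>\<tau>\<close> is a right inverse of \<open>th\<close> with values between \<open>s\<close> and \<open>s'\<close>, also where \<open>\<sigma>\<close> leaves that range at the two ends.\<close>
    define \<tau> where "\<tau> t = min s' (max s (\<sigma> t))" for t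
    define m where "m t = integral {s..\<tau> t} (\<lambda>r. norm (zd r))" for t
    have \<tau>: "s \<le> \<tau> t" "\<tau> t \<le> s'" for t using s by (auto simp: \<tau>_def)
    have th_\<tau>: "th (\<tau> t) = t" if t: "th s \<le> t" "t \<le> th s'" for t
    proof -
      have tab: "t \<in> {a..b}" using t th_in[of s] th_in[of s'] s by auto
      have \<sigma>t: "0 \<le> \<sigma> t" "th (\<sigma> t) = t" using \<sigma>_le[of a t] th_\<sigma>[OF tab] tab by (auto simp: \<sigma>_a)
      have "th s = t" if "\<sigma> t < s" using th_mono[of "\<sigma> t" s] \<sigma>t that t by auto
      moreover have "th s' = t" if "s' < \<sigma> t" using th_mono[of s' "\<sigma> t"] \<sigma>t that t s by auto
      ultimately show ?thesis
        using \<sigma>t s by (cases "\<sigma> t < s"; cases "s' < \<sigma> t") (auto simp: \<tau>_def)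
    qed
    have "Diss norm w (th s) (th s') \<le> m (th s') - m (th s)"
    proof (rule Diss_norm_le[OF th_mono[OF s(1,2)]])
      fix x y assume xy: "th s \<le> x" "x \<le> y" "y \<le> th s'"
      have xyab: "a \<le> x" "y \<le> b" using xy th_in[of s] th_in[of s'] s by auto
      have \<tau>xy: "\<tau> x \<le> \<tau> y" using \<sigma>_le[OF xyab(1) xy(2) xyab(2)] by (auto simp: \<tau>_def)
      have "w y - w x = w (th (\<tau> y)) - w (th (\<tau> x))" using xy th_\<tau>[of x] th_\<tau>[of y] by simp
      also have "\<dots> = integral {\<tau> x..\<tau> y} zd"
        using \<tau>[of x] \<tau>[of y] \<tau>xy s by (intro integral_unique[symmetric] zd_int) auto
      also have "norm \<dots> \<le> integral {\<tau> x..\<tau> y} (\<lambda>r. norm (zd r))"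
        by (intro integral_norm_bound_integral integrable_bounded_borel(2)[OF zd_m] n_int) auto
      also have "\<dots> = m y - m x"
        using Henstock_Kurzweil_Integration.integral_combine[OF \<tau>(1)[of x] \<tau>xy n_int]
        by (simp add: m_def)
      finally show "norm (w y - w x) \<le> m y - m x" .
    qed
    also have "\<dots> \<le> m (th s')"
      unfolding m_def by (simp add: integral_nonneg n_int)
    also have "\<dots> \<le> integral {s..s'} (\<lambda>r. norm (zd r))"
      unfolding m_def using \<tau>[of "th s'"] by (intro integral_subset_le n_int) auto
    finally show ?thesis .
  qed
  \<comment> \<open>Over \<open>{0..s1}\<close> and \<open>{s2..S}\<close> the parameter is used up at rate at most one, so the whole length \<open>S\<close> forces the rest onto \<open>{s1..s2}\<close>.\<close>
  have low: "s2 - s1 \<le> th s2 - th s1 + \<rho> * Diss norm w (th s1) (th s2)"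
    if s: "0 \<le> s1" "s1 \<le> s2" "s2 \<le> S" for s1 s2
  proof -
    have t: "a \<le> th s1" "th s1 \<le> th s2" "th s2 \<le> b"
      using th_in[of s1] th_in[of s2] th_mono[of s1 s2] s by auto
    have bv2: "BV_on (th s1) b w" by (rule BV_on_subinterval[OF bv]) (use t in auto)
    have "Diss norm w a b \<le> Diss norm w a (th s1) + Diss norm w (th s1) (th s2) + Diss norm w (th s2) b"
      using Diss_norm_triangle[OF bv, of "th s1"] Diss_norm_triangle[OF bv2, of "th s2"] t by linarith
    moreover have "Diss norm w a (th s1) \<le> integral {0..s1} (\<lambda>r. norm (zd r))"
      using Diss_le[of 0 s1] s by (simp add: th_0)
    moreover have "Diss norm w (th s2) b \<le> integral {s2..S} (\<lambda>r. norm (zd r))"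
      using Diss_le[of s2 S] s by (simp add: th_S)
    ultimately have "\<rho> * Diss norm w a b \<le> \<rho> * (integral {0..s1} (\<lambda>r. norm (zd r)) +
        Diss norm w (th s1) (th s2) + integral {s2..S} (\<lambda>r. norm (zd r)))"
      using \<rho> by (intro mult_left_mono) auto
    moreover have "S = b - a + \<rho> * Diss norm w a b" by (simp add: S_def \<sigma>_def)
    ultimately show ?thesis
      using up[of 0 s1] up[of s2 S] s unfolding th_0 th_S distrib_left by linarith
  qed
  have f_ge: "AE s in lebesgue. 0 < s \<and> s < S \<longrightarrow> 1 \<le> f s"
  proof (rule AE_le_of_integral_le[OF one f_m])
    fix x y assume xy: "0 < x" "x < y" "y < S"
    have "y - x \<le> th y - th x + \<rho> * Diss norm w (th x) (th y)"
      using xy by (intro low) auto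
    also have "\<dots> \<le> th y - th x + \<rho> * integral {x..y} (\<lambda>r. norm (zd r))"
      using xy \<rho> by (intro add_left_mono mult_left_mono Diss_le) auto
    finally show "integral {x..y} (\<lambda>_. 1) \<le> integral {x..y} f"
      using xy by (subst integral_unique[OF f_int]) auto
  qed
  show thesis
  proof (rule that[OF S td zd th_0 th_S])
    show "th x < th y" if "0 \<le> x" "x < y" "y \<le> S" for x y
      using low[of x y] th_mono[of x y] that by (cases "th x = th y") auto
    show "AE s in lebesgue. 0 < s \<and> s < S \<longrightarrow> 0 \<le> td s \<and> td s + \<rho> * norm (zd s) = 1"
      using td_nonneg f_le f_ge by eventually_elim (auto simp: f_def)
    show "integral {x..y} (\<lambda>r. norm (zd r)) \<le> Diss norm w (th x) (th y)"
      if "0 \<le> x" "x \<le> y" "y \<le> S" for x y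
    proof -
      have "\<rho> * integral {x..y} (\<lambda>r. norm (zd r)) \<le> \<rho> * Diss norm w (th x) (th y)"
        using up[OF that] low[OF that] by linarith
      then show ?thesis using \<rho> by simp
    qed
  qed
qed

section \<open>Integration by parts for the Kurzweil--Stieltjes integral\<close>

text \<open>The function \<open>\<Phi>\<close> stands for the indefinite integral of \<open>l\<close> against \<open>z\<close>. Summing the
  assumed local estimates over a division whose intervals are so small that \<open>\<sigma>\<close> varies by at
  most \<open>e'\<close> gives an error of at most \<open>C * (V b - V a) * e'\<close>, since the increments of \<open>V\<close>
  telescope.\<close>

lemma ks_integral_by_parts:
  fixes l z :: "real \<Rightarrow> 'a::real_inner" and \<Phi> \<sigma> V :: "real \<Rightarrow> real"
  assumes ab: "a \<le> b" and \<sigma>: "continuous_on {a..b} \<sigma>" and C: "0 \<le> C"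
    and V: "\<And>x y. a \<le> x \<Longrightarrow> x \<le> y \<Longrightarrow> y \<le> b \<Longrightarrow> V x \<le> V y"
    and bound: "\<And>x \<tau> y. a \<le> x \<Longrightarrow> x \<le> \<tau> \<Longrightarrow> \<tau> \<le> y \<Longrightarrow> y \<le> b \<Longrightarrow>
      \<bar>(l y \<bullet> z y - l x \<bullet> z x) - z \<tau> \<bullet> (l y - l x) - (\<Phi> y - \<Phi> x)\<bar> \<le> C * (V y - V x) * \<bar>\<sigma> y - \<sigma> x\<bar>"
    and I: "has_ks_integral z l I a b"
  shows "I = (l b \<bullet> z b - l a \<bullet> z a) - (\<Phi> b - \<Phi> a)"
proof -
  define h where "h t = l t \<bullet> z t - \<Phi> t" for t
  define K where "K = C * (V b - V a) + 1"
  have K: "K > 0" using C V[of a b] ab by (simp add: K_def add_nonneg_pos)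
  have "\<bar>(h b - h a) - I\<bar> \<le> e" if e: "e > 0" for e
  proof -
    define e' where "e' = e / (2 * K)"
    have e': "e' > 0" using e K by (simp add: e'_def)
    have "e / 2 > 0" using e by simp
    then obtain \<delta> where \<delta>: "\<forall>x. 0 < \<delta> x" and
      \<delta>I: "\<forall>p. p tagged_division_of {a..b} \<and> (\<lambda>x. ball x (\<delta> x)) fine p \<longrightarrow>
         \<bar>(\<Sum>(\<tau>, K)\<in>p. z \<tau> \<bullet> (l (Sup K) - l (Inf K))) - I\<bar> < e / 2"
      using I unfolding has_ks_integral_def by blast
    have "uniformly_continuous_on {a..b} \<sigma>"
      using \<sigma> by (intro compact_uniformly_continuous) auto
    then obtain \<eta> where \<eta>: "\<eta> > 0" and
      \<eta>\<sigma>: "\<And>x y. x \<in> {a..b} \<Longrightarrow> y \<in> {a..b} \<Longrightarrow> dist y x < \<eta> \<Longrightarrow> dist (\<sigma> y) (\<sigma> x) < e'"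
      using e' unfolding uniformly_continuous_on_def by metis
    have "gauge (\<lambda>x. ball x (\<delta> x) \<inter> ball x (\<eta> / 2))"
      using \<delta> \<eta> by (intro gauge_Int gauge_ball_dependent) auto
    then obtain p where p: "p tagged_division_of {a..b}"
      and fine: "(\<lambda>x. ball x (\<delta> x) \<inter> ball x (\<eta> / 2)) fine p"
      using fine_division_exists_real by blast
    have fine1: "(\<lambda>x. ball x (\<delta> x)) fine p" and fine2: "(\<lambda>x. ball x (\<eta> / 2)) fine p"
      using fine by (auto simp: fine_Int)
    have each: "\<bar>(h (Sup X) - h (Inf X)) - z \<tau> \<bullet> (l (Sup X) - l (Inf X))\<bar> \<le>
        (C * e') * (V (Sup X) - V (Inf X))" if X: "(\<tau>, X) \<in> p" for \<tau> X
    proof -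
      obtain u v where uv: "X = {u..v}" using tagged_division_ofD(4)[OF p X] by auto
      have \<tau>: "u \<le> \<tau>" "\<tau> \<le> v" using tagged_division_ofD(2)[OF p X] by (auto simp: uv)
      have sub: "a \<le> u" "v \<le> b" using tagged_division_ofD(3)[OF p X] \<tau> by (auto simp: uv)
      have "X \<subseteq> ball \<tau> (\<eta> / 2)" using fine2 X by (auto simp: fine_def)
      then have "dist \<tau> u < \<eta> / 2" "dist \<tau> v < \<eta> / 2" using \<tau> by (auto simp: uv subset_iff)
      then have "dist v u < \<eta>" by (smt (verit) dist_triangle_half_r)
      then have "\<bar>\<sigma> v - \<sigma> u\<bar> \<le> e'" using \<eta>\<sigma>[of u v] sub \<tau> by (simp add: dist_real_def)
      have "\<bar>(h v - h u) - z \<tau> \<bullet> (l v - l u)\<bar> \<le> C * (V v - V u) * \<bar>\<sigma> v - \<sigma> u\<bar>"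
        using bound[OF sub(1) \<tau> sub(2)] by (simp add: h_def algebra_simps)
      also have "\<dots> \<le> C * (V v - V u) * e'"
        using \<open>\<bar>\<sigma> v - \<sigma> u\<bar> \<le> e'\<close> C V[of u v] sub \<tau> by (intro mult_left_mono) auto
      finally show ?thesis using \<tau> by (simp add: uv mult_ac)
    qed
    have fin: "finite p" using p by blast
    have "\<bar>(h b - h a) - (\<Sum>(\<tau>, X)\<in>p. z \<tau> \<bullet> (l (Sup X) - l (Inf X)))\<bar> =
       \<bar>\<Sum>(\<tau>, X)\<in>p. (h (Sup X) - h (Inf X)) - z \<tau> \<bullet> (l (Sup X) - l (Inf X))\<bar>"
      unfolding additive_tagged_division_1[OF ab p, of h, symmetric]
      by (simp add: case_prod_beta sum_subtractf)
    also have "\<dots> \<le> (\<Sum>(\<tau>, X)\<in>p. (C * e') * (V (Sup X) - V (Inf X)))"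
      by (intro order_trans[OF sum_abs] sum_mono) (use each in auto)
    also have "\<dots> = (C * e') * (V b - V a)"
      unfolding additive_tagged_division_1[OF ab p, of V, symmetric]
      by (simp add: case_prod_beta sum_distrib_left)
    also have "\<dots> \<le> e' * K" using e' by (simp add: K_def algebra_simps)
    also have "\<dots> = e / 2" using K by (simp add: e'_def)
    finally have "\<bar>(h b - h a) - (\<Sum>(\<tau>, X)\<in>p. z \<tau> \<bullet> (l (Sup X) - l (Inf X)))\<bar> \<le> e / 2" .
    moreover have "\<bar>(\<Sum>(\<tau>, X)\<in>p. z \<tau> \<bullet> (l (Sup X) - l (Inf X))) - I\<bar> < e / 2"
      using \<delta>I p fine1 by blast
    ultimately show ?thesis by linarith
  qed
  then have "\<bar>(h b - h a) - I\<bar> \<le> 0" by (intro field_le_epsilon[of _ 0]) simp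
  then show ?thesis by (simp add: h_def)
qed

lemma has_ks_integral_cong:
  assumes eq: "\<And>t. t \<in> {a..b} \<Longrightarrow> f t = g t" and f: "has_ks_integral f l I a b"
  shows "has_ks_integral g l I a b"
proof -
  have "(\<Sum>(\<tau>, K)\<in>p. f \<tau> \<bullet> (l (Sup K) - l (Inf K))) = (\<Sum>(\<tau>, K)\<in>p. g \<tau> \<bullet> (l (Sup K) - l (Inf K)))"
    if p: "p tagged_division_of {a..b}" for p
  proof (rule sum.cong)
    fix X assume "X \<in> p"
    moreover obtain \<tau> K where "X = (\<tau>, K)" by (cases X)
    ultimately have "\<tau> \<in> {a..b}" using tagged_division_ofD(2,3)[OF p] by blast
    then show "(case X of (\<tau>, K) \<Rightarrow> f \<tau> \<bullet> (l (Sup K) - l (Inf K))) =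
        (case X of (\<tau>, K) \<Rightarrow> g \<tau> \<bullet> (l (Sup K) - l (Inf K)))"
      using eq \<open>X = (\<tau>, K)\<close> by simp
  qed simp
  note sums = this
  show ?thesis
    unfolding has_ks_integral_def
  proof (intro allI impI)
    fix e :: real assume "0 < e"
    then obtain \<delta> where "\<forall>x. 0 < \<delta> x"
      "\<forall>p. p tagged_division_of {a..b} \<and> (\<lambda>x. ball x (\<delta> x)) fine p \<longrightarrow>
         \<bar>(\<Sum>(\<tau>, K)\<in>p. f \<tau> \<bullet> (l (Sup K) - l (Inf K))) - I\<bar> < e"
      using f unfolding has_ks_integral_def by blast
    then show "\<exists>\<delta>. (\<forall>x. 0 < \<delta> x) \<and> (\<forall>p. p tagged_division_of {a..b} \<and> (\<lambda>x. ball x (\<delta> x)) fine p \<longrightarrow>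
         \<bar>(\<Sum>(\<tau>, K)\<in>p. g \<tau> \<bullet> (l (Sup K) - l (Inf K))) - I\<bar> < e)"
      using sums by (intro exI[of _ \<delta>]) auto
  qed
qed

section \<open>Admissible arcs\<close>

text \<open>For \<open>R = \<rho> * norm\<close>, gradient \<open>G\<close> of the energy and vanishing stability distance, these are the
  conditions of a relaxed solution without the prescribed end points. Under stability the energy
  balance is equivalent to the alignment \<open>(lh - G zh) \<bullet> zd = \<rho> * norm zd\<close>, which is local in \<open>s\<close>;
  this makes arcs easy to concatenate. The last clause says that a parameter at which the load is not
  the given one lies inside an interval on which the nondecreasing function \<open>th\<close> is constant, so
  it is not a point of increase.\<close>

definition admissible_arc ::
    "real \<Rightarrow> ('a \<Rightarrow> 'a) \<Rightarrow> (real \<Rightarrow> 'a) \<Rightarrow> real \<Rightarrow> (real \<Rightarrow> real) \<Rightarrow> (real \<Rightarrow> 'a::euclidean_space) \<Rightarrow> (real \<Rightarrow> 'a) \<Rightarrow> bool" where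
  "admissible_arc \<rho> G l S th zh lh \<longleftrightarrow> 0 \<le> S \<and> BV_on 0 S lh \<and>
     (\<exists>td zd. primitive_on S th td \<and> primitive_on S zh zd \<and>
        (AE s in lebesgue. 0 < s \<and> s < S \<longrightarrow>
           0 \<le> td s \<and> td s + \<rho> * norm (zd s) = 1 \<and>
           norm (lh s - G (zh s)) \<le> \<rho> \<and> (lh s - G (zh s)) \<bullet> zd s = \<rho> * norm (zd s) \<and>
           (lh s = l (th s) \<or> (\<exists>s1 s2. 0 \<le> s1 \<and> s1 < s \<and> s < s2 \<and> s2 \<le> S \<and> th s1 = th s2))))"

definition arc_joins ::
    "real \<Rightarrow> ('a \<Rightarrow> 'a) \<Rightarrow> (real \<Rightarrow> 'a) \<Rightarrow> (real \<Rightarrow> 'a::euclidean_space) \<Rightarrow> real \<times> 'a \<Rightarrow> real \<times> 'a \<Rightarrow> real set \<Rightarrow> bool" where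
  "arc_joins \<rho> G l z P Q D \<longleftrightarrow> (\<exists>S th zh lh. admissible_arc \<rho> G l S th zh lh \<and>
     P = (th 0, zh 0) \<and> Q = (th S, zh S) \<and> (\<forall>t\<in>D. \<exists>s\<in>{0..S}. (t, z t) = (th s, zh s)))"

lemma primitive_on_concat:
  assumes f: "primitive_on S1 f fd" and g: "primitive_on S2 g gd" and eq: "f S1 = g 0"
  shows "primitive_on (S1 + S2) (\<lambda>s. if s \<le> S1 then f s else g (s - S1))
           (\<lambda>s. if s \<le> S1 then fd s else gd (s - S1))"
    (is "primitive_on _ ?h ?hd")
  unfolding primitive_on_def
proof (intro conjI allI impI)
  have [measurable]: "fd \<in> borel_measurable borel" "gd \<in> borel_measurable borel"
    using f g by (auto simp: primitive_on_def)
  show "?hd \<in> borel_measurable borel" by measurable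
  have "range ?hd \<subseteq> range fd \<union> range gd" by auto
  then show "bounded (range ?hd)"
    using f g by (elim bounded_subset[rotated]) (auto simp: primitive_on_def)
  have h: "?h s = g (s - S1)" if "S1 \<le> s" for s using eq that by (cases "s = S1") auto
  have left: "(?hd has_integral (?h y - ?h x)) {x..y}" if "0 \<le> x" "x \<le> y" "y \<le> S1" for x y
  proof -
    have "(fd has_integral (f y - f x)) {x..y}" using f that by (simp add: primitive_on_def)
    then have "(?hd has_integral (f y - f x)) {x..y}"
      by (rule has_integral_eq[rotated]) (use that in auto)
    then show ?thesis using that by simp
  qed
  have right: "(?hd has_integral (?h y - ?h x)) {x..y}" if "S1 \<le> x" "x \<le> y" "y \<le> S1 + S2" for x y
  proof -
    have "(gd has_integral (g (y - S1) - g (x - S1))) {x - S1..y - S1}"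
      using g that by (simp add: primitive_on_def)
    from has_integral_shift_real_ivl[OF this, of "- S1"]
    have "((\<lambda>s. gd (s - S1)) has_integral (g (y - S1) - g (x - S1))) {x..y}" by simp
    then have "(?hd has_integral (g (y - S1) - g (x - S1))) {x..y}"
      by (rule has_integral_spike_finite[of "{S1}", rotated 2]) (use that in auto)
    then show ?thesis using h[of x] h[of y] that by simp
  qed
  fix x y assume xy: "0 \<le> x \<and> x \<le> y \<and> y \<le> S1 + S2"
  consider "y \<le> S1" | "S1 \<le> x" | "x \<le> S1" "S1 \<le> y" by linarith
  then show "(?hd has_integral (?h y - ?h x)) {x..y}"
  proof cases
    case 3
    have "(?hd has_integral ((?h S1 - ?h x) + (?h y - ?h S1))) {x..y}"
      by (rule has_integral_combine[OF 3 left right]) (use xy 3 in auto)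
    moreover have "(p - q) + (r - p) = r - q" for p q r :: 'a by simp
    ultimately show ?thesis by (simp only:)
  qed (use xy left right in auto)
qed

lemma AE_lebesgue_shift:
  assumes "AE s in lebesgue. P s"
  shows "AE s in lebesgue. P (s - c :: real)"
proof -
  have "negligible ((+) c ` {s. \<not> P s})"
    by (rule negligible_translation[OF negligible_of_AE[OF assms]])
  then have "AE s in lebesgue. s \<notin> (+) c ` {s. \<not> P s}"
    by (intro AE_not_in) (simp add: negligible_iff_null_sets)
  then show ?thesis
    by eventually_elim (auto simp: image_iff)
qed

lemma arc_joins_trans:
  assumes 1: "arc_joins \<rho> G l z P Q D" and 2: "arc_joins \<rho> G l z Q R D'"
  shows "arc_joins \<rho> G l z P R (D \<union> D')"
proof -
  obtain S1 th1 zh1 lh1 where a1: "admissible_arc \<rho> G l S1 th1 zh1 lh1"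
    and e1: "P = (th1 0, zh1 0)" "Q = (th1 S1, zh1 S1)"
    and c1: "\<forall>t\<in>D. \<exists>s\<in>{0..S1}. (t, z t) = (th1 s, zh1 s)"
    using 1 unfolding arc_joins_def by blast
  obtain S2 th2 zh2 lh2 where a2: "admissible_arc \<rho> G l S2 th2 zh2 lh2"
    and e2: "Q = (th2 0, zh2 0)" "R = (th2 S2, zh2 S2)"
    and c2: "\<forall>t\<in>D'. \<exists>s\<in>{0..S2}. (t, z t) = (th2 s, zh2 s)"
    using 2 unfolding arc_joins_def by blast
  obtain td1 zd1 where d1: "primitive_on S1 th1 td1" "primitive_on S1 zh1 zd1"
    and ae1: "AE s in lebesgue. 0 < s \<and> s < S1 \<longrightarrow>
           0 \<le> td1 s \<and> td1 s + \<rho> * norm (zd1 s) = 1 \<and>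
           norm (lh1 s - G (zh1 s)) \<le> \<rho> \<and> (lh1 s - G (zh1 s)) \<bullet> zd1 s = \<rho> * norm (zd1 s) \<and>
           (lh1 s = l (th1 s) \<or> (\<exists>s1 s2. 0 \<le> s1 \<and> s1 < s \<and> s < s2 \<and> s2 \<le> S1 \<and> th1 s1 = th1 s2))"
    using a1 unfolding admissible_arc_def by blast
  obtain td2 zd2 where d2: "primitive_on S2 th2 td2" "primitive_on S2 zh2 zd2"
    and ae2: "AE s in lebesgue. 0 < s \<and> s < S2 \<longrightarrow>
           0 \<le> td2 s \<and> td2 s + \<rho> * norm (zd2 s) = 1 \<and>
           norm (lh2 s - G (zh2 s)) \<le> \<rho> \<and> (lh2 s - G (zh2 s)) \<bullet> zd2 s = \<rho> * norm (zd2 s) \<and>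
           (lh2 s = l (th2 s) \<or> (\<exists>s1 s2. 0 \<le> s1 \<and> s1 < s \<and> s < s2 \<and> s2 \<le> S2 \<and> th2 s1 = th2 s2))"
    using a2 unfolding admissible_arc_def by blast
  have S: "0 \<le> S1" "0 \<le> S2" and lh: "BV_on 0 S1 lh1" "BV_on 0 S2 lh2"
    using a1 a2 by (auto simp: admissible_arc_def)
  define th where "th s = (if s \<le> S1 then th1 s else th2 (s - S1))" for s
  define zh where "zh s = (if s \<le> S1 then zh1 s else zh2 (s - S1))" for s
  define lh where "lh s = (if s \<le> S1 then lh1 s else lh2 (s - S1))" for s
  define td where "td s = (if s \<le> S1 then td1 s else td2 (s - S1))" for s
  define zd where "zd s = (if s \<le> S1 then zd1 s else zd2 (s - S1))" for s
  have join: "th1 S1 = th2 0" "zh1 S1 = zh2 0" using e1 e2 by auto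
  have th_right: "th s = th2 (s - S1)" and zh_right: "zh s = zh2 (s - S1)" if "S1 \<le> s" for s
    using that join by (cases "s = S1"; simp add: th_def zh_def)+
  have "admissible_arc \<rho> G l (S1 + S2) th zh lh"
    unfolding admissible_arc_def
  proof (intro conjI exI[of _ td] exI[of _ zd])
    show "0 \<le> S1 + S2" using S by simp
    show "BV_on 0 (S1 + S2) lh"
      unfolding lh_def[abs_def] by (rule BV_on_concat[OF lh S(1)])
    show "primitive_on (S1 + S2) th td"
      unfolding th_def[abs_def] td_def[abs_def] by (rule primitive_on_concat[OF d1(1) d2(1) join(1)])
    show "primitive_on (S1 + S2) zh zd"
      unfolding zh_def[abs_def] zd_def[abs_def] by (rule primitive_on_concat[OF d1(2) d2(2) join(2)])
    have "{S1} \<in> null_sets lebesgue" by (simp flip: negligible_iff_null_sets)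
    then have "AE s in lebesgue. s \<notin> {S1}" by (rule AE_not_in)
    with ae1 AE_lebesgue_shift[OF ae2, of S1]
    show "AE s in lebesgue. 0 < s \<and> s < S1 + S2 \<longrightarrow>
           0 \<le> td s \<and> td s + \<rho> * norm (zd s) = 1 \<and>
           norm (lh s - G (zh s)) \<le> \<rho> \<and> (lh s - G (zh s)) \<bullet> zd s = \<rho> * norm (zd s) \<and>
           (lh s = l (th s) \<or> (\<exists>s1 s2. 0 \<le> s1 \<and> s1 < s \<and> s < s2 \<and> s2 \<le> S1 + S2 \<and> th s1 = th s2))"
    proof eventually_elim
      case (elim s)
      show ?case
      proof
        assume s: "0 < s \<and> s < S1 + S2"
        show "0 \<le> td s \<and> td s + \<rho> * norm (zd s) = 1 \<and>
           norm (lh s - G (zh s)) \<le> \<rho> \<and> (lh s - G (zh s)) \<bullet> zd s = \<rho> * norm (zd s) \<and>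
           (lh s = l (th s) \<or> (\<exists>s1 s2. 0 \<le> s1 \<and> s1 < s \<and> s < s2 \<and> s2 \<le> S1 + S2 \<and> th s1 = th s2))"
        proof (cases "s < S1")
          case True
          have ex: "\<exists>s1 s2. 0 \<le> s1 \<and> s1 < s \<and> s < s2 \<and> s2 \<le> S1 + S2 \<and> th s1 = th s2"
            if "0 \<le> s1" "s1 < s" "s < s2" "s2 \<le> S1" "th1 s1 = th1 s2" for s1 s2
            using that S True by (intro exI[of _ s1] exI[of _ s2]) (auto simp: th_def)
          then show ?thesis
            using elim(1) s True by (simp add: td_def zd_def lh_def zh_def th_def[of s]) (blast intro: ex)
        next
          case False
          then have s': "S1 < s" "0 < s - S1" "s - S1 < S2" using elim(3) s by auto
          have ex: "\<exists>s1 s2. 0 \<le> s1 \<and> s1 < s \<and> s < s2 \<and> s2 \<le> S1 + S2 \<and> th s1 = th s2"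
            if "0 \<le> s1" "s1 < s - S1" "s - S1 < s2" "s2 \<le> S2" "th2 s1 = th2 s2" for s1 s2
            using that S th_right[of "s1 + S1"] th_right[of "s2 + S1"]
            by (intro exI[of _ "s1 + S1"] exI[of _ "s2 + S1"]) auto
          then show ?thesis
            using elim(2) s' by (simp add: td_def zd_def lh_def zh_def th_def[of s]) (blast intro: ex)
        qed
      qed
    qed
  qed
  moreover have "P = (th 0, zh 0)" using S e1 by (simp add: th_def zh_def)
  moreover have "R = (th (S1 + S2), zh (S1 + S2))" using S e2 th_right zh_right by simp
  moreover have "\<forall>t\<in>D \<union> D'. \<exists>s\<in>{0..S1 + S2}. (t, z t) = (th s, zh s)"
  proof
    fix t assume "t \<in> D \<union> D'"
    then show "\<exists>s\<in>{0..S1 + S2}. (t, z t) = (th s, zh s)"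
    proof
      assume "t \<in> D"
      then obtain s where "s \<in> {0..S1}" "(t, z t) = (th1 s, zh1 s)" using c1 by blast
      then show ?thesis using S by (intro bexI[of _ s]) (auto simp: th_def zh_def)
    next
      assume "t \<in> D'"
      then obtain s where "s \<in> {0..S2}" "(t, z t) = (th2 s, zh2 s)" using c2 by blast
      then show ?thesis using S th_right[of "s + S1"] zh_right[of "s + S1"]
        by (intro bexI[of _ "s + S1"]) auto
    qed
  qed
  ultimately show ?thesis unfolding arc_joins_def by blast
qed

lemma arc_joins_cover_endpoints:
  assumes "arc_joins \<rho> G l z (a, z a) (b, z b) D"
  shows "arc_joins \<rho> G l z (a, z a) (b, z b) (insert a (insert b D))"
proof -
  obtain S th zh lh where *: "admissible_arc \<rho> G l S th zh lh"
    "(a, z a) = (th 0, zh 0)" "(b, z b) = (th S, zh S)"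
    "\<forall>t\<in>D. \<exists>s\<in>{0..S}. (t, z t) = (th s, zh s)"
    using assms unfolding arc_joins_def by blast
  have "0 \<le> S" using *(1) by (simp add: admissible_arc_def)
  with * have "\<forall>t\<in>insert a (insert b D). \<exists>s\<in>{0..S}. (t, z t) = (th s, zh s)"
    by (auto intro: bexI[of _ 0] bexI[of _ S])
  with * show ?thesis unfolding arc_joins_def by blast
qed

text \<open>Time stands still, so the load may be chosen freely. On the straight line with velocity \<open>u\<close>, where
  \<open>norm u = 1 / \<rho>\<close>, the load \<open>G zh + \<rho>\<^sup>2 u\<close> puts the driving force \<open>lh - G zh\<close> on the boundary of
  the ball of radius \<open>\<rho>\<close>, in the direction of motion. The Lipschitz estimate for \<open>G\<close> makes this load a function of bounded variation.\<close>

lemma arc_joins_vertical: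
  assumes \<rho>: "0 < \<rho>"
    and G: "\<And>u v. u \<in> closed_segment x y \<Longrightarrow> v \<in> closed_segment x y \<Longrightarrow> norm (G u - G v) \<le> K * norm (u - v)"
  shows "arc_joins \<rho> G l z (a, x) (a, y) {}"
proof -
  define S where "S = \<rho> * norm (y - x)"
  \<comment> \<open>For \<open>x = y\<close> the arc is the single parameter \<open>S = 0\<close>, and division by zero gives \<open>u = 0\<close>.\<close>
  define u where "u = (1 / S) *\<^sub>R (y - x)"
  define zh where "zh s = x + s *\<^sub>R u" for s
  have S: "0 \<le> S" using \<rho> by (simp add: S_def)
  have zS: "zh S = y"
    using \<rho> by (cases "x = y") (auto simp: zh_def u_def S_def)
  have nu: "\<rho> * norm u = 1" if "0 < S"
  proof -
    have "y \<noteq> x" using that by (auto simp: S_def)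
    then show ?thesis using \<rho> by (simp add: u_def S_def)
  qed
  have seg: "zh s \<in> closed_segment x y" if "0 \<le> s" "s \<le> S" for s
  proof (cases "S = 0")
    case True
    then show ?thesis using that by (simp add: zh_def)
  next
    case False
    then have "zh s = (1 - s / S) *\<^sub>R x + (s / S) *\<^sub>R y"
      by (simp add: zh_def u_def algebra_simps)
    then show ?thesis unfolding closed_segment_def
      using that False by (intro CollectI exI[of _ "s / S"]) (auto simp: divide_le_eq)
  qed
  have "admissible_arc \<rho> G l S (\<lambda>_. a) zh (\<lambda>s. G (zh s) + (\<rho> * \<rho>) *\<^sub>R u)"
    unfolding admissible_arc_def
  proof (intro conjI exI[of _ "\<lambda>_::real. 0::real"] exI[of _ "\<lambda>_. u"] S)
    show "BV_on 0 S (\<lambda>s. G (zh s) + (\<rho> * \<rho>) *\<^sub>R u)"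
    proof (rule BV_onI[where m="\<lambda>s. K * norm u * s"])
      fix r s assume rs: "0 \<le> r" "r \<le> s" "s \<le> S"
      have "norm (G (zh s) - G (zh r)) \<le> K * norm (zh s - zh r)"
        using rs by (intro G seg) auto
      also have "zh s - zh r = (s - r) *\<^sub>R u" by (simp add: zh_def algebra_simps)
      also have "norm ((s - r) *\<^sub>R u) = (s - r) * norm u" using rs by simp
      finally show "norm (G (zh s) + (\<rho> * \<rho>) *\<^sub>R u - (G (zh r) + (\<rho> * \<rho>) *\<^sub>R u)) \<le> K * norm u * s - K * norm u * r"
        by (simp add: algebra_simps)
    qed
    show "primitive_on S (\<lambda>_. a) (\<lambda>_. 0)"
      by (auto simp: primitive_on_def)
    show "primitive_on S zh (\<lambda>_. u)"
    proof -
      have "((\<lambda>_. u) has_integral (zh s - zh r)) {r..s}" if "r \<le> s" for r s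
        using has_integral_const_real[of u r s] that by (simp add: zh_def algebra_simps)
      then show ?thesis by (auto simp: primitive_on_def)
    qed
    show "AE s in lebesgue. 0 < s \<and> s < S \<longrightarrow>
           0 \<le> (0::real) \<and> 0 + \<rho> * norm u = 1 \<and>
           norm (G (zh s) + (\<rho> * \<rho>) *\<^sub>R u - G (zh s)) \<le> \<rho> \<and>
           (G (zh s) + (\<rho> * \<rho>) *\<^sub>R u - G (zh s)) \<bullet> u = \<rho> * norm u \<and>
           (G (zh s) + (\<rho> * \<rho>) *\<^sub>R u = l a \<or> (\<exists>s1 s2. 0 \<le> s1 \<and> s1 < s \<and> s < s2 \<and> s2 \<le> S \<and> a = a))"
    proof (rule AE_I2, intro impI)
      fix s assume s: "0 < s \<and> s < S"
      then have n: "\<rho> * norm u = 1" using nu by simp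
      have N: "norm ((\<rho> * \<rho>) *\<^sub>R u) \<le> \<rho>" using n \<rho> by (simp add: mult.assoc)
      have "((\<rho> * \<rho>) *\<^sub>R u) \<bullet> u = (\<rho> * norm u) * (\<rho> * norm u)"
        by (simp add: dot_square_norm power2_eq_square)
      then have "((\<rho> * \<rho>) *\<^sub>R u) \<bullet> u = \<rho> * norm u" by (simp only: n mult_1_right)
      moreover have "\<exists>s1 s2. 0 \<le> s1 \<and> s1 < s \<and> s < s2 \<and> s2 \<le> S"
        using s by (intro exI[of _ 0] exI[of _ S]) auto
      ultimately show "0 \<le> (0::real) \<and> 0 + \<rho> * norm u = 1 \<and>
           norm (G (zh s) + (\<rho> * \<rho>) *\<^sub>R u - G (zh s)) \<le> \<rho> \<and>
           (G (zh s) + (\<rho> * \<rho>) *\<^sub>R u - G (zh s)) \<bullet> u = \<rho> * norm u \<and>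
           (G (zh s) + (\<rho> * \<rho>) *\<^sub>R u = l a \<or> (\<exists>s1 s2. 0 \<le> s1 \<and> s1 < s \<and> s < s2 \<and> s2 \<le> S \<and> a = a))"
        unfolding add_diff_cancel_left' add_0_left using n N order_refl by blast
    qed
  qed
  then show ?thesis
    unfolding arc_joins_def
    by (intro exI[of _ S] exI[of _ "\<lambda>_. a"] exI[of _ zh] exI conjI) (auto simp: zS, simp add: zh_def)
qed

section \<open>Arcs over intervals of continuity\<close>

text \<open>The indicator is needed because \<open>f\<close> is arbitrary outside \<open>{0..S}\<close>; only countably many
  discontinuities remain.\<close>

lemma BV_on_interior_borel:
  fixes f :: "real \<Rightarrow> 'a::euclidean_space"
  assumes S: "0 \<le> S" and bv: "BV_on 0 S f"
  shows "(\<lambda>s. indicator {0<..<S} s *\<^sub>R f s) \<in> borel_measurable borel"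
    and "bounded (range (\<lambda>s. indicator {0<..<S} s *\<^sub>R f s))"
proof -
  define X where "X = {t \<in> {0<..<S}. \<not> isCont f t} \<union> {0, S}"
  have "countable X"
    unfolding X_def using BV_on_countable_discontinuities[OF bv] by simp
  moreover have "continuous_on (- X) (\<lambda>s. indicator {0<..<S} s *\<^sub>R f s)"
  proof (rule continuous_at_imp_continuous_on, rule ballI)
    fix s assume s: "s \<in> - X"
    show "isCont (\<lambda>s. indicator {0<..<S} s *\<^sub>R f s) s"
    proof (cases "s \<in> {0<..<S}")
      case True
      then have "isCont f s" using s by (simp add: X_def)
      moreover have "\<forall>\<^sub>F r in nhds s. indicator {0<..<S} r *\<^sub>R f r = f r"
        using True by (intro eventually_mono[OF eventually_nhds_in_open[of "{0<..<S}" s]]) auto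
      ultimately show ?thesis by (simp add: isCont_cong)
    next
      case False
      then have "s \<in> - {0..S}" using s by (auto simp: X_def)
      then have "\<forall>\<^sub>F r in nhds s. indicator {0<..<S} r *\<^sub>R f r = 0"
        by (intro eventually_mono[OF eventually_nhds_in_open[of "- {0..S}" s]]) auto
      then show ?thesis by (subst isCont_cong[of _ "\<lambda>_. 0"]) auto
    qed
  qed
  ultimately show "(\<lambda>s. indicator {0<..<S} s *\<^sub>R f s) \<in> borel_measurable borel"
    by (rule borel_measurable_continuous_countable_exceptions)
  have "norm (indicator {0<..<S} s *\<^sub>R f s) \<le> norm (f 0) + Diss norm f 0 S" for s
  proof (cases "s \<in> {0<..<S}")
    case True
    have "norm (f s) \<le> norm (f 0) + norm (f s - f 0)"
      using norm_triangle_ineq[of "f 0" "f s - f 0"] by simp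
    moreover have "norm (f s - f 0) \<le> Diss norm f 0 s - Diss norm f 0 0"
      using True by (intro BV_on_variation[OF bv]) auto
    moreover have "norm (f S - f s) \<le> Diss norm f 0 S - Diss norm f 0 s"
      using True by (intro BV_on_variation[OF bv]) auto
    ultimately have "norm (f s) \<le> norm (f 0) + Diss norm f 0 S"
      using norm_ge_zero[of "f S - f s"] unfolding Diss_refl by linarith
    then show ?thesis using True by simp
  next
    case False
    have "norm (f S - f 0) \<le> Diss norm f 0 S - Diss norm f 0 0"
      using S by (intro BV_on_variation[OF bv]) auto
    then have "0 \<le> Diss norm f 0 S"
      using norm_ge_zero[of "f S - f 0"] unfolding Diss_refl by linarith
    then show ?thesis using False by simp
  qed
  then show "bounded (range (\<lambda>s. indicator {0<..<S} s *\<^sub>R f s))" by (auto simp: bounded_iff)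
qed

lemma bounded_inner_comp:
  fixes f g :: "'b \<Rightarrow> 'a::real_inner"
  assumes "bounded (range f)" "bounded (range g)"
  shows "bounded (range (\<lambda>s. f s \<bullet> g s))"
proof -
  obtain B C where B: "\<And>s. norm (f s) \<le> B" "\<And>s. norm (g s) \<le> C"
    using assms by (auto simp: bounded_iff)
  have "\<bar>f s \<bullet> g s\<bar> \<le> B * C" for s
    by (rule order_trans[OF Cauchy_Schwarz_ineq2], rule mult_mono)
       (use B order_trans[OF norm_ge_zero B(1)] in auto)
  then show ?thesis by (auto simp: bounded_iff)
qed

text \<open>The graph of \<open>w\<close> is parametrized by arclength and the load is the given one. Integration by parts for the
  Kurzweil integral turns the energy inequality into
  \<open>\<rho> * norm zd \<le> (l \<circ> th - G zh) \<bullet> zd\<close> almost everywhere. Stability holds at every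
  continuity point of \<open>l\<close>, hence for all parameters but countably many because \<open>th\<close> is injective;
  by the Cauchy--Schwarz inequality it bounds the right-hand side by \<open>\<rho> * norm zd\<close> again, so
  equality holds.\<close>

lemma arc_joins_continuous:
  fixes w l :: "real \<Rightarrow> 'a::euclidean_space"
  assumes \<rho>: "0 < \<rho>" and ab: "a < b"
    and w_cont: "continuous_on {a..b} w" and w_bv: "BV_on a b w" and l_bv: "BV_on a b l"
    and E: "\<And>x. (E has_derivative (\<lambda>h. G x \<bullet> h)) (at x)" and G: "continuous_on UNIV G"
    and stable: "AE t in lebesgue. a < t \<and> t < b \<longrightarrow> norm (l t - G (w t)) \<le> \<rho>"
    and energy: "\<And>t1 t2. a < t1 \<Longrightarrow> t1 \<le> t2 \<Longrightarrow> t2 < b \<Longrightarrow> \<exists>I. has_ks_integral w l I t1 t2 \<and>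
      E (w t2) - l t2 \<bullet> w t2 + \<rho> * Diss norm w t1 t2 \<le> E (w t1) - l t1 \<bullet> w t1 - I"
    and z: "\<And>t. a < t \<Longrightarrow> t < b \<Longrightarrow> z t = w t"
  shows "arc_joins \<rho> G l z (a, w a) (b, w b) {a<..<b}"
proof -
  obtain S th td zd where S: "0 < S" and td: "primitive_on S th td"
    and zd: "primitive_on S (\<lambda>s. w (th s)) zd" and th0: "th 0 = a" and thS: "th S = b"
    and th_less: "\<And>x y. 0 \<le> x \<Longrightarrow> x < y \<Longrightarrow> y \<le> S \<Longrightarrow> th x < th y"
    and unit: "AE s in lebesgue. 0 < s \<and> s < S \<longrightarrow> 0 \<le> td s \<and> td s + \<rho> * norm (zd s) = 1"
    and len: "\<And>x y. 0 \<le> x \<Longrightarrow> x \<le> y \<Longrightarrow> y \<le> S \<Longrightarrow>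
       integral {x..y} (\<lambda>r. norm (zd r)) \<le> Diss norm w (th x) (th y)"
    by (rule arclength_parametrization[OF ab w_cont w_bv \<rho>]) (rule that; assumption)
  have th_mono: "th x \<le> th y" if "0 \<le> x" "x \<le> y" "y \<le> S" for x y
    using th_less[of x y] that by (cases "x = y") auto
  have th_in: "th s \<in> {a<..<b}" if "0 < s" "s < S" for s
    using th_less[of 0 s] th_less[of s S] that th0 thS by auto
  have th_cont: "continuous_on {0..S} th" by (rule primitive_on_continuous[OF td])
  define lh where "lh s = l (th s)" for s
  define zh where "zh s = w (th s)" for s
  have zh: "primitive_on S zh zd" using zd by (simp add: zh_def[abs_def])
  have lh_bv: "BV_on 0 S lh"
    unfolding lh_def[abs_def] by (rule BV_on_compose_mono[OF l_bv th_mono th0 thS])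
  have "\<exists>s\<in>{0..S}. th s = t" if "t \<in> {a..b}" for t
    using IVT'[of th 0 t S] th_cont th0 thS S that by auto
  then obtain \<sigma> where \<sigma>: "\<And>t. t \<in> {a..b} \<Longrightarrow> \<sigma> t \<in> {0..S}" "\<And>t. t \<in> {a..b} \<Longrightarrow> th (\<sigma> t) = t"
    by metis
  have th_inj: "inj_on th {0..S}"
    by (rule linorder_inj_onI) (auto dest: th_less)
  have th_ab: "th s \<in> {a..b}" if "s \<in> {0..S}" for s
    using th_mono[of 0 s] th_mono[of s S] that th0 thS by auto
  have \<sigma>_th: "\<sigma> (th s) = s" if "s \<in> {0..S}" for s
    using \<sigma>[OF th_ab[OF that]] that th_inj by (auto dest: inj_onD)
  have \<sigma>_mono: "\<sigma> x \<le> \<sigma> y" if "x \<in> {a..b}" "y \<in> {a..b}" "x \<le> y" for x y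
    using th_less[of "\<sigma> y" "\<sigma> x"] \<sigma>[OF that(1)] \<sigma>[OF that(2)] that(3) by (auto simp: not_less[symmetric])
  have "th ` {0..S} = {a..b}"
  proof (rule antisym)
    show "th ` {0..S} \<subseteq> {a..b}" using th_ab by blast
    show "{a..b} \<subseteq> th ` {0..S}"
    proof
      fix t assume "t \<in> {a..b}"
      then show "t \<in> th ` {0..S}" using \<sigma>[of t] by (intro image_eqI[of _ _ "\<sigma> t"]) auto
    qed
  qed
  then have \<sigma>_cont: "continuous_on {a..b} \<sigma>"
    using continuous_on_inv[OF th_cont compact_Icc, of \<sigma>] \<sigma>_th by simp
  define lb where "lb s = indicator {0<..<S} s *\<^sub>R lh s" for s
  define gb where "gb s = indicator {0..S} s *\<^sub>R G (zh s)" for s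
  have zh_cont: "continuous_on {0..S} zh" by (rule primitive_on_continuous[OF zh])
  have Gzh: "continuous_on {0..S} (\<lambda>s. G (zh s))"
    by (rule continuous_on_compose2[OF G zh_cont]) simp
  have lb_m: "lb \<in> borel_measurable borel" "bounded (range lb)"
    unfolding lb_def[abs_def] by (rule BV_on_interior_borel[OF less_imp_le[OF S] lh_bv])+
  have gb_m: "gb \<in> borel_measurable borel" "bounded (range gb)"
  proof -
    show "gb \<in> borel_measurable borel" unfolding gb_def[abs_def]
      by (rule borel_measurable_continuous_on_indicator[OF _ Gzh]) simp
    have "bounded ((\<lambda>s. G (zh s)) ` {0..S})"
      by (intro compact_imp_bounded compact_continuous_image Gzh) simp
    then have "bounded (insert 0 ((\<lambda>s. G (zh s)) ` {0..S}))" by simp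
    then show "bounded (range gb)"
      by (rule bounded_subset) (auto simp: gb_def indicator_def)
  qed
  have zd_m: "zd \<in> borel_measurable borel" "bounded (range zd)"
    using zh by (auto simp: primitive_on_def)
  note [measurable] = lb_m(1) gb_m(1) zd_m(1)
  have q_m: "(\<lambda>s. lb s \<bullet> zd s) \<in> borel_measurable borel" "bounded (range (\<lambda>s. lb s \<bullet> zd s))"
    using lb_m(2) zd_m(2) by (auto intro: bounded_inner_comp)
  have p_m: "(\<lambda>s. gb s \<bullet> zd s) \<in> borel_measurable borel" "bounded (range (\<lambda>s. gb s \<bullet> zd s))"
    using gb_m(2) zd_m(2) by (auto intro: bounded_inner_comp)
  note q_int = integrable_bounded_borel(2)[OF q_m]
  note p_int = integrable_bounded_borel(2)[OF p_m]
  obtain B where B: "B > 0" "\<And>s. norm (zd s) \<le> B" using zd_m(2) by (auto simp: bounded_pos)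
  define V where "V = Diss norm l a"
  have V: "norm (l y - l x) \<le> V y - V x" if "a \<le> x" "x \<le> y" "y \<le> b" for x y
    unfolding V_def by (rule BV_on_variation[OF l_bv that])
  have V_mono: "V x \<le> V y" if "a \<le> x" "x \<le> y" "y \<le> b" for x y
    using V[OF that] norm_ge_zero[of "l y - l x"] by linarith
  define \<Phi> where "\<Phi> t = integral {0..\<sigma> t} (\<lambda>s. lb s \<bullet> zd s)" for t
  \<comment> \<open>Replacing the load by one of its values at the ends costs at most the variation of \<open>l\<close> times the length of the parameter interval. This is the local estimate for the integration by parts.\<close>
  have piece: "\<bar>l c \<bullet> (zh v - zh u) - integral {u..v} (\<lambda>s. lb s \<bullet> zd s)\<bar> \<le> (V y - V x) * B * (v - u)"
    if xy: "a \<le> x" "x \<le> y" "y \<le> b" and c: "c = x \<or> c = y"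
      and uv: "\<sigma> x \<le> u" "u \<le> v" "v \<le> \<sigma> y" for x y c u v
  proof -
    have uv': "0 \<le> u" "v \<le> S" using \<sigma>(1)[of x] \<sigma>(1)[of y] uv xy by auto
    have "((\<lambda>s. l c \<bullet> zd s) has_integral (l c \<bullet> (zh v - zh u))) {u..v}"
      using has_integral_linear[OF _ bounded_linear_inner_right, of zd "zh v - zh u" "{u..v}" "l c"] zh uv uv'
      by (simp add: o_def primitive_on_def)
    then have "((\<lambda>s. l c \<bullet> zd s - lb s \<bullet> zd s) has_integral
        (l c \<bullet> (zh v - zh u) - integral {u..v} (\<lambda>s. lb s \<bullet> zd s))) {u..v}"
      by (intro has_integral_diff integrable_integral q_int)
    then have "norm (l c \<bullet> (zh v - zh u) - integral {u..v} (\<lambda>s. lb s \<bullet> zd s))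
        \<le> (V y - V x) * B * measure lborel {u..v}"
    proof (rule has_integral_bound_real[of _ "{0, S}", rotated 2])
      show "0 \<le> (V y - V x) * B" using V_mono[OF xy] B by simp
      fix s assume s: "s \<in> {u..v} - {0, S}"
      then have s': "0 < s" "s < S" using uv' by auto
      have "th (\<sigma> x) \<le> th s" "th s \<le> th (\<sigma> y)"
        using s uv s' \<sigma>(1)[of x] \<sigma>(1)[of y] xy by (auto intro!: th_mono)
      then have ths: "x \<le> th s" "th s \<le> y" using \<sigma>(2)[of x] \<sigma>(2)[of y] xy by auto
      have "norm (l c - l (th s)) \<le> V y - V x"
        using V[of x "th s"] V[of "th s" y] V_mono[of x "th s"] V_mono[of "th s" y] ths xy c
        by (auto simp: norm_minus_commute)
      have "norm (l c \<bullet> zd s - lb s \<bullet> zd s) = \<bar>(l c - l (th s)) \<bullet> zd s\<bar>"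
        using s' by (simp add: lb_def lh_def inner_diff_left)
      also have "\<dots> \<le> norm (l c - l (th s)) * norm (zd s)" by (rule Cauchy_Schwarz_ineq2)
      also have "\<dots> \<le> (V y - V x) * B"
        using \<open>norm (l c - l (th s)) \<le> V y - V x\<close> B(2)[of s] V_mono[OF xy] by (intro mult_mono) auto
      finally show "norm (l c \<bullet> zd s - lb s \<bullet> zd s) \<le> (V y - V x) * B" .
    qed simp
    then show ?thesis using uv by simp
  qed
  have power_le: "AE s in lebesgue. 0 < s \<and> s < S \<longrightarrow> \<rho> * norm (zd s) \<le> lb s \<bullet> zd s - gb s \<bullet> zd s"
  proof (rule AE_le_of_integral_le)
    show "(\<lambda>s. \<rho> * norm (zd s)) \<in> borel_measurable borel" by measurable
    show "(\<lambda>s. lb s \<bullet> zd s - gb s \<bullet> zd s) \<in> borel_measurable borel" by measurable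
    have "\<bar>\<rho> * norm (zd s)\<bar> \<le> \<rho> * B" for s using \<rho> B by (simp add: abs_mult)
    then show "bounded (range (\<lambda>s. \<rho> * norm (zd s)))" by (auto simp: bounded_iff)
    show "bounded (range (\<lambda>s. lb s \<bullet> zd s - gb s \<bullet> zd s))"
      by (rule bounded_minus_comp[OF q_m(2) p_m(2)])
    fix x y assume xy: "0 < x" "x < y" "y < S"
    define t1 where "t1 = th x"
    define t2 where "t2 = th y"
    have t: "a < t1" "t1 \<le> t2" "t2 < b"
      using th_in[of x] th_in[of y] th_less[of x y] xy by (auto simp: t1_def t2_def)
    have \<sigma>t: "\<sigma> t1 = x" "\<sigma> t2 = y" using \<sigma>_th[of x] \<sigma>_th[of y] xy by (auto simp: t1_def t2_def)
    obtain I where I: "has_ks_integral w l I t1 t2"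
      and en: "E (w t2) - l t2 \<bullet> w t2 + \<rho> * Diss norm w t1 t2 \<le> E (w t1) - l t1 \<bullet> w t1 - I"
      using energy[OF t] by blast
    have "I = (l t2 \<bullet> w t2 - l t1 \<bullet> w t1) - (\<Phi> t2 - \<Phi> t1)"
    proof (rule ks_integral_by_parts[OF t(2) _ _ _ _ I])
      show "continuous_on {t1..t2} \<sigma>" by (rule continuous_on_subset[OF \<sigma>_cont]) (use t in auto)
      show "0 \<le> B" using B by simp
      show "V u \<le> V v" if "t1 \<le> u" "u \<le> v" "v \<le> t2" for u v
        using t that by (intro V_mono) auto
      \<comment> \<open>The product increment splits at the tag: \<open>l v\<close> multiplies the later and \<open>l u\<close> the earlier increment of \<open>w\<close>.\<close>
      fix u \<tau> v assume u: "t1 \<le> u" "u \<le> \<tau>" "\<tau> \<le> v" "v \<le> t2"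
      have \<sigma>u: "0 \<le> \<sigma> u" "\<sigma> u \<le> \<sigma> \<tau>" "\<sigma> \<tau> \<le> \<sigma> v"
        using \<sigma>_mono[of u \<tau>] \<sigma>_mono[of \<tau> v] \<sigma>(1)[of u] u t by auto
      have zhu: "zh (\<sigma> u) = w u" "zh (\<sigma> \<tau>) = w \<tau>" "zh (\<sigma> v) = w v"
        using \<sigma>(2)[of u] \<sigma>(2)[of \<tau>] \<sigma>(2)[of v] u t by (auto simp: zh_def)
      have \<Phi>: "\<Phi> v - \<Phi> u = integral {\<sigma> u..\<sigma> \<tau>} (\<lambda>s. lb s \<bullet> zd s) + integral {\<sigma> \<tau>..\<sigma> v} (\<lambda>s. lb s \<bullet> zd s)"
        using Henstock_Kurzweil_Integration.integral_combine[OF \<sigma>u(1) order_trans[OF \<sigma>u(2,3)] q_int]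
          Henstock_Kurzweil_Integration.integral_combine[OF \<sigma>u(2,3) q_int]
        by (simp add: \<Phi>_def)
      have "(l v \<bullet> w v - l u \<bullet> w u) - w \<tau> \<bullet> (l v - l u) - (\<Phi> v - \<Phi> u) =
         (l v \<bullet> (zh (\<sigma> v) - zh (\<sigma> \<tau>)) - integral {\<sigma> \<tau>..\<sigma> v} (\<lambda>s. lb s \<bullet> zd s)) +
         (l u \<bullet> (zh (\<sigma> \<tau>) - zh (\<sigma> u)) - integral {\<sigma> u..\<sigma> \<tau>} (\<lambda>s. lb s \<bullet> zd s))"
        by (simp add: \<Phi> zhu inner_diff_right inner_commute)
      moreover have "\<bar>l v \<bullet> (zh (\<sigma> v) - zh (\<sigma> \<tau>)) - integral {\<sigma> \<tau>..\<sigma> v} (\<lambda>s. lb s \<bullet> zd s)\<bar> \<le>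
          (V v - V u) * B * (\<sigma> v - \<sigma> \<tau>)"
        by (rule piece) (use u t \<sigma>u in auto)
      moreover have "\<bar>l u \<bullet> (zh (\<sigma> \<tau>) - zh (\<sigma> u)) - integral {\<sigma> u..\<sigma> \<tau>} (\<lambda>s. lb s \<bullet> zd s)\<bar> \<le>
          (V v - V u) * B * (\<sigma> \<tau> - \<sigma> u)"
        by (rule piece) (use u t \<sigma>u in auto)
      moreover have "(V v - V u) * B * (\<sigma> v - \<sigma> \<tau>) + (V v - V u) * B * (\<sigma> \<tau> - \<sigma> u) =
          B * (V v - V u) * \<bar>\<sigma> v - \<sigma> u\<bar>"
        using \<sigma>u by (simp add: algebra_simps)
      ultimately show "\<bar>(l v \<bullet> w v - l u \<bullet> w u) - w \<tau> \<bullet> (l v - l u) - (\<Phi> v - \<Phi> u)\<bar> \<le>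
          B * (V v - V u) * \<bar>\<sigma> v - \<sigma> u\<bar>"
        by linarith
    qed
    moreover have "\<Phi> t2 - \<Phi> t1 = integral {x..y} (\<lambda>s. lb s \<bullet> zd s)"
      using Henstock_Kurzweil_Integration.integral_combine[of 0 x y, OF _ _ q_int] xy
      by (simp add: \<Phi>_def \<sigma>t)
    moreover have "integral {x..y} (\<lambda>s. gb s \<bullet> zd s) = E (w t2) - E (w t1)"
    proof -
      have "((\<lambda>s. G (zh s) \<bullet> zd s) has_integral (E (zh y) - E (zh x))) {x..y}"
        by (rule primitive_on_chain_rule[OF zh E G]) (use xy in auto)
      then have "((\<lambda>s. gb s \<bullet> zd s) has_integral (E (zh y) - E (zh x))) {x..y}"
        by (rule has_integral_eq[rotated]) (use xy in \<open>auto simp: gb_def\<close>)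
      then show ?thesis by (simp add: integral_unique zh_def t1_def t2_def)
    qed
    moreover have "\<rho> * integral {x..y} (\<lambda>s. norm (zd s)) \<le> \<rho> * Diss norm w t1 t2"
      using len[of x y] xy \<rho> by (intro mult_left_mono) (auto simp: t1_def t2_def)
    moreover have "integral {x..y} (\<lambda>s. \<rho> * norm (zd s)) = \<rho> * integral {x..y} (\<lambda>s. norm (zd s))"
      by simp
    moreover have "integral {x..y} (\<lambda>s. lb s \<bullet> zd s - gb s \<bullet> zd s) =
        integral {x..y} (\<lambda>s. lb s \<bullet> zd s) - integral {x..y} (\<lambda>s. gb s \<bullet> zd s)"
      by (rule integral_diff[OF q_int p_int])
    ultimately show "integral {x..y} (\<lambda>s. \<rho> * norm (zd s)) \<le>
        integral {x..y} (\<lambda>s. lb s \<bullet> zd s - gb s \<bullet> zd s)"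
      using en by linarith
  qed
  \<comment> \<open>Instability at a point of continuity would persist on an open set, which has positive measure.\<close>
  have stable_cont: "norm (l t - G (w t)) \<le> \<rho>" if t: "t \<in> {a<..<b}" "isCont l t" for t
  proof (rule ccontr)
    assume "\<not> norm (l t - G (w t)) \<le> \<rho>"
    have "isCont w t"
      using w_cont t by (simp add: continuous_on_interior)
    moreover have "isCont G (w t)"
      using G by (simp add: continuous_on_eq_continuous_at)
    ultimately have "isCont (\<lambda>t. norm (l t - G (w t))) t"
      using t(2) by (intro continuous_intros isCont_o2[of t w G]) auto
    then have "((\<lambda>t. norm (l t - G (w t))) \<longlongrightarrow> norm (l t - G (w t))) (nhds t)"
      using tendsto_at_iff_tendsto_nhds[of "\<lambda>t. norm (l t - G (w t))" t] by (simp add: isCont_def)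
    then have "\<forall>\<^sub>F s in nhds t. \<rho> < norm (l s - G (w s))"
      using \<open>\<not> norm (l t - G (w t)) \<le> \<rho>\<close> by (intro order_tendstoD(1)) auto
    moreover have "\<forall>\<^sub>F s in nhds t. s \<in> {a<..<b}"
      using t(1) by (intro eventually_nhds_in_open) auto
    ultimately have "\<forall>\<^sub>F s in nhds t. s \<in> {a<..<b} \<and> \<rho> < norm (l s - G (w s))"
      by eventually_elim auto
    then obtain U where U: "open U" "t \<in> U" "\<And>s. s \<in> U \<Longrightarrow> s \<in> {a<..<b} \<and> \<rho> < norm (l s - G (w s))"
      unfolding eventually_nhds by blast
    then have "U \<subseteq> {t. \<not> (a < t \<and> t < b \<longrightarrow> norm (l t - G (w t)) \<le> \<rho>)}" by force
    then have "negligible U" by (rule negligible_subset[OF negligible_of_AE[OF stable]])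
    then show False using U open_not_negligible by blast
  qed
  define X where "X = {s \<in> {0..S}. th s \<in> {t \<in> {a<..<b}. \<not> isCont l t}}"
  have "countable (th ` X)"
    by (rule countable_subset[OF _ BV_on_countable_discontinuities[OF l_bv]]) (auto simp: X_def)
  moreover have "inj_on th X" by (rule inj_on_subset[OF th_inj]) (auto simp: X_def)
  ultimately have "countable X" by (rule countable_image_inj_on)
  then have "X \<in> null_sets lebesgue"
    by (intro null_sets_completionI countable_imp_null_set_lborel)
  then have "AE s in lebesgue. s \<notin> X" by (rule AE_not_in)
  with unit power_le
  have "AE s in lebesgue. 0 < s \<and> s < S \<longrightarrow>
           0 \<le> td s \<and> td s + \<rho> * norm (zd s) = 1 \<and>
           norm (lh s - G (zh s)) \<le> \<rho> \<and> (lh s - G (zh s)) \<bullet> zd s = \<rho> * norm (zd s) \<and>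
           (lh s = l (th s) \<or> (\<exists>s1 s2. 0 \<le> s1 \<and> s1 < s \<and> s < s2 \<and> s2 \<le> S \<and> th s1 = th s2))"
  proof eventually_elim
    case (elim s)
    show ?case
    proof
      assume s: "0 < s \<and> s < S"
      have n: "norm (lh s - G (zh s)) \<le> \<rho>"
        using elim(3) s th_in[of s] stable_cont[of "th s"] by (auto simp: X_def lh_def zh_def)
      have "(lh s - G (zh s)) \<bullet> zd s \<le> norm (lh s - G (zh s)) * norm (zd s)"
        by (rule norm_cauchy_schwarz)
      also have "\<dots> \<le> \<rho> * norm (zd s)" using n by (rule mult_right_mono) simp
      finally have "(lh s - G (zh s)) \<bullet> zd s \<le> \<rho> * norm (zd s)" .
      moreover have "\<rho> * norm (zd s) \<le> (lh s - G (zh s)) \<bullet> zd s"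
        using elim(2) s by (simp add: lb_def gb_def inner_diff_left)
      ultimately show "0 \<le> td s \<and> td s + \<rho> * norm (zd s) = 1 \<and>
           norm (lh s - G (zh s)) \<le> \<rho> \<and> (lh s - G (zh s)) \<bullet> zd s = \<rho> * norm (zd s) \<and>
           (lh s = l (th s) \<or> (\<exists>s1 s2. 0 \<le> s1 \<and> s1 < s \<and> s < s2 \<and> s2 \<le> S \<and> th s1 = th s2))"
        using elim(1) s n by (simp add: lh_def)
    qed
  qed
  with S td zh lh_bv have "admissible_arc \<rho> G l S th zh lh"
    unfolding admissible_arc_def by (intro conjI exI[of _ td] exI[of _ zd]) auto
  moreover have "\<exists>s\<in>{0..S}. (t, z t) = (th s, zh s)" if "t \<in> {a<..<b}" for t
    using \<sigma>[of t] that z[of t] by (intro bexI[of _ "\<sigma> t"]) (auto simp: zh_def)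
  ultimately show ?thesis
    unfolding arc_joins_def using th0 thS
    by (intro exI[of _ S] exI[of _ th] exI[of _ zh] exI[of _ lh]) (auto simp: zh_def)
qed

section \<open>Norm potentials and gradients of the energy\<close>

text \<open>By symmetry \<open>R\<close> is constant on spheres, and homogeneity fixes its growth along rays.\<close>

lemma norm_symmetric_potential:
  fixes R :: "'a::euclidean_space \<Rightarrow> real"
  assumes R: "dissipation_potential R" and symm: "\<And>v w. R v = R w \<longleftrightarrow> norm v = norm w"
  obtains \<rho> where "0 < \<rho>" "\<And>v. R v = \<rho> * norm v"
proof -
  obtain c C where c: "c > 0" "\<And>v. c * norm v \<le> R v" "\<And>v. R v \<le> C * norm v"
    using R unfolding dissipation_potential_def by blast
  have hom: "R (r *\<^sub>R v) = r * R v" if "r > 0" for r v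
    using R that by (auto simp: dissipation_potential_def)
  obtain e :: 'a where e: "norm e = 1" using vector_choose_size[of 1] by auto
  show thesis
  proof (rule that[of "R e"])
    show "0 < R e" using c(1) c(2)[of e] e by simp
    fix v
    show "R v = R e * norm v"
    proof (cases "v = 0")
      case True
      then show ?thesis using c(2)[of 0] c(3)[of 0] by simp
    next
      case False
      have "R v = R (norm v *\<^sub>R e)" using symm e by simp
      then show ?thesis using hom[of "norm v" e] False by simp
    qed
  qed
qed

lemma subdifferential_norm:
  fixes R :: "'a::euclidean_space \<Rightarrow> real"
  assumes \<rho>: "0 < \<rho>" and R: "\<And>v. R v = \<rho> * norm v"
  shows "subdifferential R 0 = cball 0 \<rho>"
proof (intro set_eqI iffI)
  fix w assume "w \<in> subdifferential R 0"
  then have "w \<bullet> w \<le> \<rho> * norm w" by (auto simp: subdifferential_def R)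
  then have "norm w * norm w \<le> \<rho> * norm w" by (simp add: dot_square_norm power2_eq_square)
  then show "w \<in> cball 0 \<rho>" using \<rho> by (cases "w = 0") auto
next
  fix w :: 'a assume "w \<in> cball 0 \<rho>"
  then have "w \<bullet> v \<le> \<rho> * norm v" for v
    using norm_cauchy_schwarz[of w v] mult_right_mono[of "norm w" \<rho> "norm v"] by auto
  then show "w \<in> subdifferential R 0" by (simp add: subdifferential_def R)
qed

lemma grad_eqI:
  assumes "(f has_derivative (\<lambda>h. D \<bullet> h)) (at x)"
  shows "grad f x = D"
  unfolding grad_def
proof (rule the_equality)
  show "GDERIV f x :> D" using assms by (simp add: gderiv_def inner_commute)
  fix D' assume "GDERIV f x :> D'"
  then have "(f has_derivative (\<lambda>h. D' \<bullet> h)) (at x)" by (simp add: gderiv_def inner_commute)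
  then have "(\<lambda>h. D' \<bullet> h) = (\<lambda>h. D \<bullet> h)" using assms by (rule has_derivative_unique)
  then have "(D' - D) \<bullet> (D' - D) = 0" by (metis inner_diff_left right_minus_eq)
  then show "D' = D" by simp
qed

lemma grad_loaded_energy:
  assumes "\<And>x. (E has_derivative (\<lambda>h. G x \<bullet> h)) (at x)"
  shows "grad (loaded_energy E l t) x = G x - l t"
proof (rule grad_eqI)
  have "((\<lambda>x. E x - l t \<bullet> x) has_derivative (\<lambda>h. G x \<bullet> h - l t \<bullet> h)) (at x)"
    by (intro has_derivative_diff assms has_derivative_inner_right has_derivative_ident)
  then show "(loaded_energy E l t has_derivative (\<lambda>h. (G x - l t) \<bullet> h)) (at x)"
    by (simp add: loaded_energy_def[abs_def] inner_diff_left)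
qed

lemma C2_has_gradient:
  fixes F :: "real^'n \<Rightarrow> real"
  assumes "C2 F"
  shows "(F has_derivative (\<lambda>h. grad F x \<bullet> h)) (at x)"
proof -
  have "F differentiable (at x)" using assms by (simp add: C2_def)
  then obtain F' where F': "(F has_derivative F') (at x)" by (auto simp: differentiable_def)
  interpret bounded_linear F' by (rule has_derivative_bounded_linear[OF F'])
  define D where "D = (\<Sum>i\<in>Basis. F' i *\<^sub>R i)"
  have "F' h = D \<bullet> h" for h
  proof -
    have "F' h = F' (\<Sum>i\<in>Basis. (h \<bullet> i) *\<^sub>R i)" by (simp add: euclidean_representation)
    also have "\<dots> = (\<Sum>i\<in>Basis. (h \<bullet> i) * F' i)" by (simp add: sum scaleR)
    also have "\<dots> = D \<bullet> h" by (simp add: D_def inner_sum_left inner_commute[of h] mult.commute)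
    finally show ?thesis .
  qed
  then have "F' = (\<lambda>h. D \<bullet> h)" by (rule ext)
  with F' show ?thesis using grad_eqI[of F D x] by simp
qed

text \<open>Symmetry of \<open>A\<close> merges the two terms of the derivative of the quadratic form.\<close>

lemma has_gradient_energy:
  fixes F :: "real^'n \<Rightarrow> real"
  assumes sym: "transpose A = A" and F: "C2 F"
  shows "(energy A F has_derivative (\<lambda>h. (A *v x + grad F x) \<bullet> h)) (at x)"
proof -
  have A: "((\<lambda>x. A *v x) has_derivative (\<lambda>h. A *v h)) (at x)"
    by (rule bounded_linear_imp_has_derivative) (rule matrix_vector_mul_bounded_linear)
  have "((\<lambda>x. (A *v x) \<bullet> x) has_derivative (\<lambda>h. (A *v x) \<bullet> h + (A *v h) \<bullet> x)) (at x)"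
    by (rule has_derivative_inner[OF A has_derivative_ident])
  then have "((\<lambda>x. 1/2 * ((A *v x) \<bullet> x) + F x) has_derivative
      (\<lambda>h. 1/2 * ((A *v x) \<bullet> h + (A *v h) \<bullet> x) + grad F x \<bullet> h)) (at x)"
    by (intro has_derivative_add has_derivative_mult_right C2_has_gradient[OF F])
  moreover have "(A *v h) \<bullet> x = (A *v x) \<bullet> h" for h
    using dot_lmul_matrix[of x A h] sym by (metis inner_commute transpose_matrix_vector)
  ultimately show ?thesis
    unfolding energy_def[abs_def] by (simp add: inner_add_left)
qed

text \<open>The growth condition bounds the Hessian on the segment, and the mean value inequality applies.\<close>

lemma grad_lipschitz_on_segments:
  fixes F :: "real^'n \<Rightarrow> real"
  assumes F: "C2 F"
    and growth: "\<exists>C>0. \<exists>q\<ge>1. \<forall>x v. norm (hessian F x *v v) \<le> C * (1 + norm x powr q) * norm v"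
  shows "\<exists>K. \<forall>u\<in>closed_segment x y. \<forall>v\<in>closed_segment x y.
    norm ((A *v u + grad F u) - (A *v v + grad F v)) \<le> K * norm (u - v)"
proof -
  obtain C q where C: "C > 0" "q \<ge> 1" "\<And>x v. norm (hessian F x *v v) \<le> C * (1 + norm x powr q) * norm v"
    using growth by blast
  obtain M where M: "M > 0" "\<And>u. u \<in> closed_segment x y \<Longrightarrow> norm u \<le> M"
    using compact_imp_bounded[OF compact_segment(1)[of x y]] unfolding bounded_pos by blast
  define K where "K = C * (1 + M powr q)"
  have der: "((\<lambda>x. A *v x + grad F x) has_derivative (\<lambda>h. A *v h + hessian F u *v h)) (at u within U)" for u U
  proof -
    have "grad F differentiable (at u)" using F by (simp add: C2_def)
    then have "(grad F has_derivative (\<lambda>h. hessian F u *v h)) (at u within U)"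
      unfolding jacobian_works hessian_def by (rule has_derivative_at_withinI)
    moreover have "((\<lambda>x. A *v x) has_derivative (\<lambda>h. A *v h)) (at u within U)"
      by (rule bounded_linear_imp_has_derivative) (rule matrix_vector_mul_bounded_linear)
    ultimately show ?thesis by (intro has_derivative_add)
  qed
  have on: "onorm (\<lambda>h. A *v h + hessian F u *v h) \<le> onorm (\<lambda>h. A *v h) + K" if "u \<in> closed_segment x y" for u
  proof (rule onorm_le)
    fix h
    have "norm (A *v h) \<le> onorm (\<lambda>h. A *v h) * norm h"
      by (rule onorm) (rule matrix_vector_mul_bounded_linear)
    moreover have "norm (hessian F u *v h) \<le> K * norm h"
    proof -
      have "norm u powr q \<le> M powr q" using M(2)[OF that] C by (intro powr_mono2) auto
      then have "C * (1 + norm u powr q) * norm h \<le> K * norm h"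
        unfolding K_def using C by (intro mult_right_mono mult_left_mono) auto
      with C(3)[of u h] show ?thesis by linarith
    qed
    ultimately show "norm (A *v h + hessian F u *v h) \<le> (onorm (\<lambda>h. A *v h) + K) * norm h"
      using norm_triangle_ineq[of "A *v h" "hessian F u *v h"] unfolding distrib_right by linarith
  qed
  show ?thesis
    using differentiable_bound[OF convex_closed_segment der on] by blast
qed

section \<open>Local solutions with finitely many jumps are covered by relaxed solutions\<close>

text \<open>Induction on the exceptional set: an interval is split at an exceptional point inside it. On an
  interval without such points, an arc over the open interval joins some pair of states at the
  two ends, and vertical arcs connect these states with the values of \<open>z\<close> there.\<close>

lemma arc_joins_interval:
  fixes z :: "real \<Rightarrow> 'a::euclidean_space"
  assumes J: "finite J"
    and vert: "\<And>a x y. arc_joins \<rho> G l z (a, x) (a, y) {}"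
    and cont: "\<And>a b. \<alpha> \<le> a \<Longrightarrow> a < b \<Longrightarrow> b \<le> \<beta> \<Longrightarrow> (\<And>t. a < t \<Longrightarrow> t < b \<Longrightarrow> isCont z t) \<Longrightarrow>
      \<exists>p q. arc_joins \<rho> G l z (a, p) (b, q) {a<..<b}"
    and ab: "\<alpha> \<le> a" "a < b" "b \<le> \<beta>" "\<And>t. t \<in> {a<..<b} - J \<Longrightarrow> isCont z t"
  shows "arc_joins \<rho> G l z (a, z a) (b, z b) {a..b}"
  using J ab
proof (induction J arbitrary: a b rule: finite_induct)
  case empty
  obtain p q where "arc_joins \<rho> G l z (a, p) (b, q) {a<..<b}"
    using cont[of a b] empty by auto
  from arc_joins_trans[OF arc_joins_trans[OF vert this] vert]
  have "arc_joins \<rho> G l z (a, z a) (b, z b) {a<..<b}" by simp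
  from arc_joins_cover_endpoints[OF this]
  have "arc_joins \<rho> G l z (a, z a) (b, z b) (insert a (insert b {a<..<b}))" .
  moreover have "insert a (insert b {a<..<b}) = {a..b}" using empty(2) by auto
  ultimately show ?case by simp
next
  case (insert c J)
  show ?case
  proof (cases "c \<in> {a<..<b}")
    case True
    have "arc_joins \<rho> G l z (a, z a) (c, z c) {a..c}"
      using True insert.prems by (intro insert.IH) auto
    moreover have "arc_joins \<rho> G l z (c, z c) (b, z b) {c..b}"
      using True insert.prems by (intro insert.IH) auto
    ultimately have "arc_joins \<rho> G l z (a, z a) (b, z b) ({a..c} \<union> {c..b})"
      by (rule arc_joins_trans)
    moreover have "{a..c} \<union> {c..b} = {a..b}" using True by auto
    ultimately show ?thesis by simp
  next
    case False
    then show ?thesis using insert.prems by (intro insert.IH) auto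
  qed
qed

text \<open>Along an admissible arc the stability distance vanishes almost everywhere, so by alignment the dissipation
  rate equals \<open>lh \<bullet> zd - G zh \<bullet> zd\<close>; the chain rule integrates the last term to the energy
  difference. The end points differ in time, which excludes \<open>S = 0\<close>.\<close>

lemma arc_joins_relaxed_solution:
  fixes z l :: "real \<Rightarrow> 'a::euclidean_space"
  assumes T: "0 < T" and \<rho>: "0 < \<rho>" and R: "\<And>v. R v = \<rho> * norm v"
    and E: "\<And>x. (E has_derivative (\<lambda>h. G x \<bullet> h)) (at x)" and G: "continuous_on UNIV G"
    and join: "arc_joins \<rho> G l z (0, z0) (T, zT) {0..T}"
  shows "\<exists>S th zh lh. relaxed_solution T E R z0 l S th zh lh \<and> z \<in> projections T S th zh"
proof -
  obtain S th zh lh where arc: "admissible_arc \<rho> G l S th zh lh"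
    and ends: "(0, z0) = (th 0, zh 0)" "(T, zT) = (th S, zh S)"
    and cover: "\<forall>t\<in>{0..T}. \<exists>s\<in>{0..S}. (t, z t) = (th s, zh s)"
    using join unfolding arc_joins_def by blast
  obtain td zd where S: "0 \<le> S" and lh: "BV_on 0 S lh"
    and td: "primitive_on S th td" and zd: "primitive_on S zh zd"
    and ae: "AE s in lebesgue. 0 < s \<and> s < S \<longrightarrow>
           0 \<le> td s \<and> td s + \<rho> * norm (zd s) = 1 \<and>
           norm (lh s - G (zh s)) \<le> \<rho> \<and> (lh s - G (zh s)) \<bullet> zd s = \<rho> * norm (zd s) \<and>
           (lh s = l (th s) \<or> (\<exists>s1 s2. 0 \<le> s1 \<and> s1 < s \<and> s < s2 \<and> s2 \<le> S \<and> th s1 = th s2))"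
    using arc unfolding admissible_arc_def by blast
  have S_pos: "0 < S" using S ends T by (cases "S = 0") auto
  have grad: "grad (loaded_energy E lh s) x = G x - lh s" for s x
    by (rule grad_loaded_energy[OF E])
  have dist0: "stability_dist E R lh s x = 0" if "norm (lh s - G x) \<le> \<rho>" for s x
    using that unfolding stability_dist_def subdifferential_norm[OF \<rho> R] grad by simp
  define f where "f r = R (zd r) + norm (zd r) * stability_dist E R lh r (zh r)" for r
  have zd_m: "zd \<in> borel_measurable borel" "bounded (range zd)"
    using zd by (auto simp: primitive_on_def)
  have balance: "E (zh s2) + (LINT r=ereal s1..ereal s2|lebesgue. f r) =
      E (zh s1) + (LINT r=ereal s1..ereal s2|lebesgue. (lh r \<bullet> zd r))"
    if s: "0 \<le> s1" "s1 \<le> s2" "s2 \<le> S" for s1 s2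
  proof -
    define N where "N = {s. \<not> (0 < s \<and> s < S \<longrightarrow> f s = \<rho> * norm (zd s) \<and>
        lh s \<bullet> zd s = \<rho> * norm (zd s) + G (zh s) \<bullet> zd s)}"
    have N: "negligible N"
      unfolding N_def
    proof (rule negligible_of_AE)
      show "AE s in lebesgue. 0 < s \<and> s < S \<longrightarrow> f s = \<rho> * norm (zd s) \<and>
        lh s \<bullet> zd s = \<rho> * norm (zd s) + G (zh s) \<bullet> zd s"
        using ae by eventually_elim (auto simp: f_def R dist0 inner_diff_left)
    qed
    have n_abs: "(\<lambda>r. \<rho> * norm (zd r)) absolutely_integrable_on {s1..s2}"
      using zd_m by (intro set_integrable_mult_right integrable_bounded_borel(1)) (auto simp: bounded_iff)
    have "continuous_on {s1..s2} (\<lambda>r. G (zh r))"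
      by (rule continuous_on_compose2[OF G continuous_on_subset[OF primitive_on_continuous[OF zd]]])
        (use s in auto)
    then have G_abs: "(\<lambda>r. G (zh r) \<bullet> zd r) absolutely_integrable_on {s1..s2}"
      by (intro continuous_times_bounded_integrable zd_m bounded_bilinear_inner)
    have sub: "h absolutely_integrable_on {s1<..<s2}" if "h absolutely_integrable_on {s1..s2}" for h :: "real \<Rightarrow> real"
      by (rule set_integrable_subset[OF that]) auto
    have G_int: "integral {s1..s2} (\<lambda>r. G (zh r) \<bullet> zd r) = E (zh s2) - E (zh s1)"
      by (rule integral_unique[OF primitive_on_chain_rule[OF zd E G s]])
    have f_abs: "f absolutely_integrable_on {s1<..<s2}"
      by (rule absolutely_integrable_spike[OF sub[OF n_abs] N]) (use s in \<open>auto simp: N_def\<close>)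
    \<comment> \<open>The alignment condition supplies integrability of the power \<open>lh \<bullet> zd\<close>: almost everywhere it is a sum of integrable functions.\<close>
    have l_abs: "(\<lambda>r. lh r \<bullet> zd r) absolutely_integrable_on {s1<..<s2}"
      by (rule absolutely_integrable_spike[OF set_integral_add(1)[OF sub[OF n_abs] sub[OF G_abs]] N])
        (use s in \<open>auto simp: N_def\<close>)
    have LINT: "(LINT r=ereal s1..ereal s2|lebesgue. h r) = integral {s1..s2} h"
      if "h absolutely_integrable_on {s1<..<s2}" for h :: "real \<Rightarrow> real"
      using set_lebesgue_integral_eq_integral(2)[OF that] s
      by (simp add: interval_lebesgue_integral_le_eq integral_open_interval_real)
    have N': "negligible (N \<union> {s1, s2})" using N by (intro negligible_Un) auto
    have "integral {s1..s2} (\<lambda>r. lh r \<bullet> zd r) = integral {s1..s2} (\<lambda>r. \<rho> * norm (zd r) + G (zh r) \<bullet> zd r)"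
      by (rule integral_spike[OF N']) (use s in \<open>auto simp: N_def\<close>)
    also have "\<dots> = integral {s1..s2} (\<lambda>r. \<rho> * norm (zd r)) + integral {s1..s2} (\<lambda>r. G (zh r) \<bullet> zd r)"
      by (intro integral_add set_lebesgue_integral_eq_integral(1) n_abs G_abs)
    also have "integral {s1..s2} (\<lambda>r. \<rho> * norm (zd r)) = integral {s1..s2} f"
      by (rule integral_spike[OF N']) (use s in \<open>auto simp: N_def\<close>)
    finally show ?thesis unfolding LINT[OF f_abs] LINT[OF l_abs] G_int by simp
  qed
  have rev: "(LINT r=ereal s1..ereal s2|lebesgue. h r) = - (LINT r=ereal s2..ereal s1|lebesgue. h r)"
    if "s2 < s1" for s1 s2 and h :: "real \<Rightarrow> real"
    using that by (simp add: interval_lebesgue_integral_def)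
  have "relaxed_solution T E R z0 l S th zh lh"
    unfolding relaxed_solution_def
  proof (intro conjI exI[of _ td] exI[of _ zd] ballI S_pos lh)
    show "W1inf S th td" "W1inf S zh zd"
      by (rule primitive_on_W1inf[OF S_pos td], rule primitive_on_W1inf[OF S_pos zd])
    show "th 0 = 0" "th S = T" "zh 0 = z0" using ends by auto
    show "AE s in lebesgue_on {0<..<S}. 0 \<le> td s \<and> td s * stability_dist E R lh s (zh s) = 0 \<and>
        td s + R (zd s) + norm (zd s) * stability_dist E R lh s (zh s) = 1"
      unfolding AE_restrict_space_iff[of "{0<..<S}" lebesgue, simplified]
      using ae by eventually_elim (auto simp: R dist0)
    show "E (zh s2) + (LINT r=ereal s1..ereal s2|lebesgue.
            (R (zd r) + norm (zd r) * stability_dist E R lh r (zh r))) =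
          E (zh s1) + (LINT r=ereal s1..ereal s2|lebesgue. (lh r \<bullet> zd r))"
      if "s1 \<in> {0..S}" "s2 \<in> {0..S}" for s1 s2
    proof (cases "s1 \<le> s2")
      case True
      then show ?thesis using balance[of s1 s2] that by (simp add: f_def)
    next
      case False
      then show ?thesis
        using balance[of s2 s1] that unfolding f_def[abs_def] rev[of s2 s1, OF not_le_imp_less[OF False]]
        by simp
    qed
    show "AE s in lebesgue. s \<in> increase_points S th \<longrightarrow> lh s = l (th s)"
      using ae
    proof eventually_elim
      case (elim s)
      show ?case
      proof
        assume s: "s \<in> increase_points S th"
        then have "0 < s" "s < S" by (auto simp: increase_points_def)
        moreover have "th s1 < th s2" if "0 \<le> s1" "s1 < s" "s < s2" "s2 \<le> S" for s1 s2
          using s that by (auto simp: increase_points_def)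
        ultimately show "lh s = l (th s)" using elim by fastforce
      qed
    qed
  qed
  moreover have "z \<in> projections T S th zh"
    using cover by (simp add: projections_def)
  ultimately show ?thesis by blast
qed

theorem theorem4p3:
  fixes T :: real
    and A :: "real^'n^'n"
    and F R :: "real^'n \<Rightarrow> real"
    and z0 :: "real^'n"
    and l z :: "real \<Rightarrow> real^'n"
  assumes T_pos: "0 < T"
    and A_sym: "transpose A = A"
    and A_pos: "\<And>v. v \<noteq> 0 \<Longrightarrow> 0 < (A *v v) \<bullet> v"
    and F_C2: "C2 F"
    and F_nonneg: "\<And>v. 0 \<le> F v"
    and F_growth: "\<exists>C>0. \<exists>q\<ge>1. \<forall>x v. norm (hessian F x *v v) \<le> C * (1 + norm x powr q) * norm v"
    and R_pot: "dissipation_potential R"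
    and z0_adm: "\<exists>l0. - grad (energy A F) z0 + l0 \<in> subdifferential R 0"
    and l_BV: "BV_on 0 T l"
    and z_BV: "BV_on 0 T z"
    and z_sol: "local_solution T (energy A F) R l z"
    and R_symm: "\<And>z1 z2. R z1 = R z2 \<longleftrightarrow> norm z1 = norm z2"
    and z_jumps: "finite (jump_points T z)"
  shows "\<exists>S th zh lh. relaxed_solution T (energy A F) R z0 l S th zh lh \<and>
           z \<in> projections T S th zh"
proof -
  obtain \<rho> where \<rho>: "0 < \<rho>" and R: "\<And>v. R v = \<rho> * norm v"
    using norm_symmetric_potential[OF R_pot R_symm] by blast
  define E where "E = energy A F"
  define G where "G x = A *v x + grad F x" for x
  have E: "(E has_derivative (\<lambda>h. G x \<bullet> h)) (at x)" for x
    unfolding E_def G_def by (rule has_gradient_energy[OF A_sym F_C2])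
  have G: "continuous_on UNIV G"
    unfolding G_def[abs_def]
  proof (rule continuous_on_add)
    show "continuous_on UNIV (\<lambda>x. A *v x)"
      by (rule linear_continuous_on[OF matrix_vector_mul_bounded_linear])
    show "continuous_on UNIV (grad F)"
      using F_C2 by (auto simp: C2_def intro!: continuous_at_imp_continuous_on
          differentiable_imp_continuous_within)
  qed
  have G_lip: "\<exists>K. \<forall>u\<in>closed_segment x y. \<forall>v\<in>closed_segment x y. norm (G u - G v) \<le> K * norm (u - v)" for x y
    unfolding G_def by (rule grad_lipschitz_on_segments[OF F_C2 F_growth])
  have vert: "arc_joins \<rho> G l z (a, x) (a, y) {}" for a x y
  proof -
    obtain K where "\<And>u v. u \<in> closed_segment x y \<Longrightarrow> v \<in> closed_segment x y \<Longrightarrow> norm (G u - G v) \<le> K * norm (u - v)"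
      using G_lip[of x y] by blast
    then show ?thesis by (rule arc_joins_vertical[OF \<rho>])
  qed
  have grad: "grad (loaded_energy E l t) x = G x - l t" for t x
    by (rule grad_loaded_energy[OF E])
  have stable: "AE t in lebesgue. 0 < t \<and> t < T \<longrightarrow> norm (l t - G (z t)) \<le> \<rho>"
  proof -
    have "AE t in lebesgue_on {0..T}.
        0 \<in> {w + grad (loaded_energy E l t) (z t) |w. w \<in> subdifferential R 0}"
      using z_sol by (simp add: local_solution_def E_def)
    then have "AE t in lebesgue. t \<in> {0..T} \<longrightarrow>
        0 \<in> {w + grad (loaded_energy E l t) (z t) |w. w \<in> subdifferential R 0}"
      by (subst (asm) AE_restrict_space_iff) auto
    then show ?thesis
    proof eventually_elim
      case (elim t)
      show ?case
      proof
        assume "0 < t \<and> t < T"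
        then obtain w where "0 = w + (G (z t) - l t)" "norm w \<le> \<rho>"
          using elim by (auto simp: grad subdifferential_norm[OF \<rho> R])
        then have "l t - G (z t) = w" by (simp add: algebra_simps)
        then show "norm (l t - G (z t)) \<le> \<rho>" using \<open>norm w \<le> \<rho>\<close> by simp
      qed
    qed
  qed
  have cont: "\<exists>p q. arc_joins \<rho> G l z (a, p) (b, q) {a<..<b}"
    if ab: "0 \<le> a" "a < b" "b \<le> T" and z_cont: "\<And>t. a < t \<Longrightarrow> t < b \<Longrightarrow> isCont z t" for a b
  proof -
    have z_bv: "BV_on a b z" by (rule BV_on_subinterval[OF z_BV ab(1,3)])
    have l_bv: "BV_on a b l" by (rule BV_on_subinterval[OF l_BV ab(1,3)])
    obtain p where p: "(z \<longlongrightarrow> p) (at_right a)" using BV_on_one_sided_limits(1)[OF z_bv ab(2)] by blast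
    obtain q where q: "(z \<longlongrightarrow> q) (at_left b)" using BV_on_one_sided_limits(2)[OF z_bv ab(2)] by blast
    \<comment> \<open>\<open>w\<close> extends the restriction of \<open>z\<close> to the open interval continuously; its values at the ends are the one-sided limits and in general not those of \<open>z\<close>.\<close>
    define w where "w = z(a := p, b := q)"
    have w: "w t = z t" if "a < t" "t < b" for t using that by (simp add: w_def)
    have w_ab: "w a = p" "w b = q" using ab by (auto simp: w_def)
    have w_cont: "continuous_on {a..b} w"
    proof (rule continuous_on_IccI)
      have "\<forall>\<^sub>F t in at_right a. a < t \<and> t < b" using ab(2) by (auto simp: eventually_at_right_field)
      then have "\<forall>\<^sub>F t in at_right a. z t = w t" by eventually_elim (simp add: w)
      then show "(w \<longlongrightarrow> w a) (at_right a)" unfolding w_ab by (rule Lim_transform_eventually[OF p])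
      have "\<forall>\<^sub>F t in at_left b. a < t \<and> t < b" using ab(2) by (auto simp: eventually_at_left_field)
      then have "\<forall>\<^sub>F t in at_left b. z t = w t" by eventually_elim (simp add: w)
      then show "(w \<longlongrightarrow> w b) (at_left b)" unfolding w_ab by (rule Lim_transform_eventually[OF q])
      fix t assume t: "a < t" "t < b"
      have "\<forall>\<^sub>F s in at t. s \<in> {a<..<b}" using t by (intro eventually_at_in_open') auto
      then have "\<forall>\<^sub>F s in at t. z s = w s" by eventually_elim (simp add: w)
      moreover have "z \<midarrow>t\<rightarrow> w t" using z_cont[OF t] w[OF t] by (simp add: isCont_def)
      ultimately show "w \<midarrow>t\<rightarrow> w t" by (rule Lim_transform_eventually[rotated])
    qed (rule ab)
    have "BV_on a b (z(a := p))" by (rule BV_on_change_one[OF z_bv, of a]) simp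
    then have w_bv: "BV_on a b w"
      unfolding w_def by (rule BV_on_change_one[of _ _ _ b]) simp
    have "arc_joins \<rho> G l z (a, w a) (b, w b) {a<..<b}"
    proof (rule arc_joins_continuous[OF \<rho> ab(2) w_cont w_bv l_bv E G])
      show "AE t in lebesgue. a < t \<and> t < b \<longrightarrow> norm (l t - G (w t)) \<le> \<rho>"
        using stable by eventually_elim (use ab w in auto)
      show "z t = w t" if "a < t" "t < b" for t using w[OF that] by simp
      fix t1 t2 assume t: "a < t1" "t1 \<le> t2" "t2 < b"
      have "0 \<le> t1 \<and> t1 \<le> t2 \<and> t2 \<le> T" using t ab by simp
      then obtain I where I: "has_ks_integral z l I t1 t2"
        "loaded_energy E l t2 (z t2) + Diss R z t1 t2 \<le> loaded_energy E l t1 (z t1) - I"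
        using z_sol unfolding local_solution_def E_def by blast
      have eq: "z t = w t" if "t \<in> {t1..t2}" for t using that t by (simp add: w)
      have "has_ks_integral w l I t1 t2"
        using eq I(1) by (rule has_ks_integral_cong)
      moreover have "\<rho> * Diss norm w t1 t2 \<le> Diss R w t1 t2"
        using t by (intro Diss_norm_le_scaled[OF \<rho> R] BV_on_subinterval[OF w_bv]) auto
      moreover have "Diss R w t1 t2 = Diss R z t1 t2"
        unfolding Diss_def using dissipation_sums_cong[of t1 t2 z w R] eq by simp
      ultimately show "\<exists>I. has_ks_integral w l I t1 t2 \<and>
          E (w t2) - l t2 \<bullet> w t2 + \<rho> * Diss norm w t1 t2 \<le> E (w t1) - l t1 \<bullet> w t1 - I"
        using I(2) eq[of t1] eq[of t2] t by (intro exI[of _ I]) (auto simp: loaded_energy_def)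
    qed
    then show ?thesis by blast
  qed
  have "arc_joins \<rho> G l z (0, z 0) (T, z T) {0..T}"
  proof (rule arc_joins_interval[OF z_jumps vert cont])
    fix t assume t: "t \<in> {0<..<T} - jump_points T z"
    then have "continuous (at t within {0..T}) z" by (auto simp: jump_points_def)
    moreover have "at t within {0..T} = at t" using t by (intro at_within_interior) (simp add: interior_atLeastAtMost_real)
    ultimately show "isCont z t" by simp
  qed (use T_pos in auto)
  from arc_joins_trans[OF vert this] have "arc_joins \<rho> G l z (0, z0) (T, z T) {0..T}" by simp
  from arc_joins_relaxed_solution[OF T_pos \<rho> R E G this]
  show ?thesis unfolding E_def .
qed

end
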